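(* Consider the algorithm $$X_{n+1}=X_n+a_n b_n(X_n,\xi_n)+a_n h(X_n,\zeta_n)+a_n h_0(\tilde\zeta_n)+a_n\beta_n,\qquad n\ge 0,$$ with values in $\mathbb R^d$, and let $X^n(\cdot)$ be the shifted piecewise linear interpolations of $\{X_n\}$ (see context). Assume that $\{X_n\}$ is bounded w.p.1 and that the following hold. (A-i) $h(\cdot,\zeta)$ is continuous in $x$, uniformly in $\zeta$, on bounded sets of $x$. (A-ii) Either $h$ is a bounded measurable function, or there are non-negative measurable functions $g_1$ (of $x$) and $g_2,g_3$ (of $\zeta$) such that $g_1$ is bounded on bounded sets, $|h(x,\zeta)|\le g_1(x)g_2(\zeta)+g_3(\zeta)$, and for each $\varepsilon>0$ $$\lim_{\Delta\to0}\lim_{n\to\infty}\mathbb P\Big\{\sup_{j\ge n}\max_{t\le\Delta}\sum_{i=m(j\Delta)}^{m(j\Delta+t)-1}a_i[g_2(\zeta_i)+g_3(\zeta_i)]\ge\varepsilon\Big\}=0.$$ (A-iii) There is a continuous function $\bar h:\mathbb R^d\to\mathbb R^d$ such that for some $T>0$, each $\varepsilon>0$ and each $x$, $$\lim_{n\to\infty}\mathbb P\Big\{\sup_{j\ge n}\max_{t\le T}\Big|\sum_{i=m(jT)}^{m(jT+t)-1}a_i\big(h(x,\zeta_i)-\bar h(x)\big)\Big|\ge\varepsilon\Big\}=0.$$ (A-iv) $\{\xi_n\},\{\zeta_n\},\{\tilde\zeta_n\}$ are independent of each other and are exogenous noises, and $h_0$ is measurable such that for some $T>0$ and each $\varepsilon>0$,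 $$\lim_{n\to\infty}\mathbb P\Big\{\sup_{j\ge n}\max_{t\le T}\Big|\sum_{i=m(jT)}^{m(jT+t)-1}a_ih_0(\tilde\zeta_i)\Big|\ge\varepsilon\Big\}=0.$$ (A-v) $\{\beta_n\}$ is a sequence of bounded random variables with $|\beta_n|\to0$ w.p.1. (K) There are a locally bounded function $\bar b:\mathbb R^d\to\mathbb R^d$ and a sequence of positive real-valued functions $m_n(x,\xi)$, continuous in $x$ uniformly in $\xi$, such that for all $n,x,\xi$, $$b_n(x,\xi)\in\mathcal K[\bar b](x)+m_n(x,\xi)\bar B,$$ and for some $T>0$, each $\varepsilon>0$ and each $x$, $$\lim_{n\to\infty}\mathbb P\Big\{\sup_{j\ge n}\max_{t\le T}\Big|\sum_{i=m(jT)}^{m(jT+t)-1}a_im_i(x,\xi_i)\Big|\ge\varepsilon\Big\}=0.$$ Then: (1) There is a null set $\Omega_0$ such that for all $\omega\notin\Omega_0$, $\{X^n(\cdot)\}$ is bounded and equicontinuous on bounded intervals. (2) (For $\omega\notin\Omega_0$.) If $X(\cdot)$ is the limit of a convergent subsequence of $\{X^n(\cdot)\}$, then $X(\cdot)$ is a Krasovskii solution of $\dot X(t)=\bar b(X(t))+\bar h(X(t))$, that is, a solution of the differential inclusion $$\dot X(t)\in\mathcal K[\bar b+\bar h](X(t)).\qquad( * )$$ (3) The limit set of $X(\cdot)$ is internally chain transitive with respect to $( * )$, and the limit points of $\{X_n\}$ are contained in $\mathcal R$, the set of chain-recurrent points of $( * )$. (4) Let $\Lambda$ be a locally asymptotically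 stable set (in the sense of Lyapunov) for all solutions of $( * )$, with domain of attraction $DA(\Lambda)$. If $\{X_n\}$ visits a compact subset of $DA(\Lambda)$ infinitely often with probability $1$ (resp. with probability $\ge\rho$), then $X_n\to\Lambda$ as $n\to\infty$ with probability $1$ (resp. with probability $\ge\rho$).
   Context: All random variables live on a complete probability space $(\Omega,\mathcal F,\mathbb P)$; $|\cdot|$ is the Euclidean norm on $\mathbb R^d$; $B$ is the open unit ball of $\mathbb R^d$, $\bar B$ its closure, $B(y,\delta)$ the open ball of center $y$ and radius $\delta$; $\overline{\mathrm{co}}$ is closed convex hull. For sets, $S+S_1=\{x+y:x\in S,y\in S_1\}$, $kS=\{kx:x\in S\}$. Step sizes: $a_n>0$, $a_n\to0$, $\sum_n a_n=\infty$. The noises $\xi_n,\zeta_n,\tilde\zeta_n$ take values in measurable spaces; $b_n(x,\xi)$, $h(x,\zeta)$, $h_0(\tilde\zeta)$ and $\beta_n$ are $\mathbb R^d$-valued. Exogenous means: the distribution of $\{\xi_i,i>n\}$ conditioned on $\{\xi_i,X_n:i\le n\}$ equals that conditioned on $\{\xi_i:i\le n\}$, and similarly for $\zeta_n$ and $\tilde\zeta_n$. $t_0=0$, $t_n=\sum_{i=0}^{n-1}a_i$; $m(t)=\max\{n:t_n\le t\}$ for $t\ge0$ and $m(t)=0$ for $t<0$. $X^0(\cdot)$ is the piecewise linear interpolation: $X^0(t_n)=X_n$, $X^0(t)=\frac{t_{n+1}-t}{a_n}X_n+\frac{t-t_n}{a_n}X_{n+1}$ for $t\in(t_n,t_{n+1})$.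 The shifted processes on $(-\infty,\infty)$ are $X^n(t)=X^0(t+t_n)$ if $t\ge-t_n$, $X^n(t)=X_0$ if $t\le-t_n$. Convergence of functions means uniform convergence on bounded intervals. Krasovskii operator: $\mathcal K[f](y)=\bigcap_{\delta>0}\overline{\mathrm{co}}\,f(B(y,\delta))$. A solution of $\dot X(t)\in F(X(t))$ is an absolutely continuous (on compact intervals) function satisfying the inclusion for almost every $t$. For a differential inclusion $\dot X\in F(X)$: the limit set of a solution is $L(X)=\bigcap_{t\ge0}\overline{\{X(s):s\ge t\}}$. Points $x,y\in A$ are chain connected in $A$ if for every $\varepsilon>0,T>0$ there are $n\in\mathbb N$, solutions $X_1,\dots,X_n$ and $t_1,\dots,t_n>T$ with $X_i(s)\in A$ for $0\le s\le t_i$, $|X_i(t_i)-X_{i+1}(0)|\le\varepsilon$ for $i\le n-1$, $|X_1(0)-x|\le\varepsilon$, $|X_n(t_n)-y|\le\varepsilon$. $A$ is internally chain transitive if it is compact and all $x,y\in A$ are chain connected in $A$. A point $\theta$ is chain-recurrent if for any $\varepsilon>0,T>0$ there are $n\in\mathbb N$, solutions $X_1,\dots,X_n$ and $t_1,\dots,t_n>T$ with $|X_1(0)-\theta|\le\varepsilon$, $|X_i(t_i)-X_{i+1}(0)|\le\varepsilon$ ($i\le n-1$), $|X_n(t_n)-\theta|\le\varepsilon$. $\Lambda$ is locally asymptotically stable (Lyapunov) for all solutions if every solution starting sufficiently close to $\Lambda$ stays in any prescribed neighborhood of $\Lambda$ for all $t\ge0$, and all solutions starting in some neighborhood of $\Lambda$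 converge to $\Lambda$ as $t\to\infty$; $DA(\Lambda)$ is the set of initial points from which all solutions converge to $\Lambda$.
   Formalization: In (K), the functions m_n(x,ξ) are required to be continuous in x uniformly in both n and ξ; with continuity uniform only in ξ for each n the claim fails (m_n may be a narrowing spike following the iterates). *)

theory Defs
  imports "HOL-Probability.Probability"
begin

section \<open>Interpolated processes\<close>

definition step_time :: "(nat \<Rightarrow> real) \<Rightarrow> nat \<Rightarrow> real" where
  "step_time a n = (\<Sum>i<n. a i)"

text \<open>For positive steps with divergent sum the set below is finite and contains 0.\<close>

definition step_index :: "(nat \<Rightarrow> real) \<Rightarrow> real \<Rightarrow> nat" where
  "step_index a t = (if t < 0 then 0 else Max {n. step_time a n \<le> t})"

text \<open>At \<open>t = step_time a n\<close> the second weight vanishes and the first one is 1, so the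
  single formula also gives the values at the nodes.\<close>

definition interpolation :: "(nat \<Rightarrow> real) \<Rightarrow> (nat \<Rightarrow> 'a::real_normed_vector) \<Rightarrow> real \<Rightarrow> 'a" where
  "interpolation a x t =
    (let n = step_index a t in
      ((step_time a (Suc n) - t) / a n) *\<^sub>R x n + ((t - step_time a n) / a n) *\<^sub>R x (Suc n))"

definition shifted :: "(nat \<Rightarrow> real) \<Rightarrow> (nat \<Rightarrow> 'a::real_normed_vector) \<Rightarrow> nat \<Rightarrow> real \<Rightarrow> 'a" where
  "shifted a x n t =
    (if t \<ge> - step_time a n then interpolation a x (t + step_time a n) else x 0)"

text \<open>\<open>sup\<^bsub>j \<ge> n\<^esub> max\<^bsub>0 \<le> t \<le> T\<^esub> S {m(jT), \<dots>, m(jT + t) - 1}\<close>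
  with values in the extended reals, as the supremum over \<open>j\<close> need not be finite.\<close>

definition window_sup :: "(nat \<Rightarrow> real) \<Rightarrow> real \<Rightarrow> nat \<Rightarrow> (nat set \<Rightarrow> real) \<Rightarrow> ereal" where
  "window_sup a T n S =
    (SUP j\<in>{n..}. SUP t\<in>{0..T}.
      ereal (S {step_index a (real j * T) ..< step_index a (real j * T + t)}))"

definition converges_locally_uniformly ::
    "(nat \<Rightarrow> real \<Rightarrow> 'a::metric_space) \<Rightarrow> (real \<Rightarrow> 'a) \<Rightarrow> bool" where
  "converges_locally_uniformly f g \<longleftrightarrow> (\<forall>r. uniform_limit {-r..r} f g sequentially)"

definition equicontinuous_on :: "real set \<Rightarrow> (nat \<Rightarrow> real \<Rightarrow> 'a::metric_space) \<Rightarrow> bool" where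
  "equicontinuous_on S f \<longleftrightarrow>
    (\<forall>e>0. \<exists>d>0. \<forall>n. \<forall>s\<in>S. \<forall>t\<in>S. dist s t < d \<longrightarrow> dist (f n s) (f n t) < e)"


section \<open>Exogenous noise\<close>

text \<open>The sigma-algebra on \<open>space M\<close> generated by \<open>Y i\<close>, \<open>i \<in> I\<close>.\<close>

definition generated_by :: "'w measure \<Rightarrow> 'n measure \<Rightarrow> (nat \<Rightarrow> 'w \<Rightarrow> 'n) \<Rightarrow> nat set \<Rightarrow> 'w measure" where
  "generated_by M N Y I =
    vimage_algebra (space M) (\<lambda>\<omega>. \<lambda>i\<in>I. Y i \<omega>) (PiM I (\<lambda>_. N))"

definition generated_by_with ::
    "'w measure \<Rightarrow> 'n measure \<Rightarrow> (nat \<Rightarrow> 'w \<Rightarrow> 'n) \<Rightarrow> nat set \<Rightarrow> ('w \<Rightarrow> 'a::topological_space) \<Rightarrow> 'w measure" where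
  "generated_by_with M N Y I Z =
    vimage_algebra (space M) (\<lambda>\<omega>. (\<lambda>i\<in>I. Y i \<omega>, Z \<omega>)) (PiM I (\<lambda>_. N) \<Otimes>\<^sub>M borel)"

text \<open>Equality of the two conditional laws of the future \<open>(Y i)\<close>, \<open>i > n\<close>: every event
  of the future has the same conditional probability, almost surely.\<close>

definition exogenous ::
    "'w measure \<Rightarrow> 'n measure \<Rightarrow> (nat \<Rightarrow> 'w \<Rightarrow> 'n) \<Rightarrow> (nat \<Rightarrow> 'w \<Rightarrow> 'a::topological_space) \<Rightarrow> bool" where
  "exogenous M N Y X \<longleftrightarrow>
    (\<forall>n. \<forall>A \<in> sets (generated_by M N Y {n<..}). AE \<omega> in M.
       real_cond_exp M (generated_by_with M N Y {..n} (X n)) (indicator A) \<omega> =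
       real_cond_exp M (generated_by M N Y {..n}) (indicator A) \<omega>)"

definition mutually_independent_noises ::
    "'w measure \<Rightarrow> 'x measure \<Rightarrow> (nat \<Rightarrow> 'w \<Rightarrow> 'x) \<Rightarrow> 'y measure \<Rightarrow> (nat \<Rightarrow> 'w \<Rightarrow> 'y) \<Rightarrow>
      'z measure \<Rightarrow> (nat \<Rightarrow> 'w \<Rightarrow> 'z) \<Rightarrow> bool" where
  "mutually_independent_noises M N\<^sub>1 Y\<^sub>1 N\<^sub>2 Y\<^sub>2 N\<^sub>3 Y\<^sub>3 \<longleftrightarrow>
    prob_space.indep_sets M
      (\<lambda>k. [sets (generated_by M N\<^sub>1 Y\<^sub>1 UNIV), sets (generated_by M N\<^sub>2 Y\<^sub>2 UNIV),
            sets (generated_by M N\<^sub>3 Y\<^sub>3 UNIV)] ! k)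
      {..<3}"


section \<open>Differential inclusions\<close>

definition locally_bounded :: "('a::metric_space \<Rightarrow> 'b::metric_space) \<Rightarrow> bool" where
  "locally_bounded f \<longleftrightarrow> (\<forall>x. \<exists>d>0. bounded (f ` ball x d))"

definition krasovskii :: "('a::euclidean_space \<Rightarrow> 'a) \<Rightarrow> 'a \<Rightarrow> 'a set" where
  "krasovskii f y = (\<Inter>\<delta>\<in>{0<..}. closure (convex hull (f ` ball y \<delta>)))"

definition absolutely_continuous_on :: "real set \<Rightarrow> (real \<Rightarrow> 'a::metric_space) \<Rightarrow> bool" where
  "absolutely_continuous_on S f \<longleftrightarrow>
    (\<forall>e>0. \<exists>d>0. \<forall>(n::nat) u v.
       (\<forall>i<n. u i \<le> v i \<and> {u i..v i} \<subseteq> S) \<longrightarrow>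
       disjoint_family_on (\<lambda>i. {u i<..<v i}) {..<n} \<longrightarrow>
       (\<Sum>i<n. v i - u i) < d \<longrightarrow> (\<Sum>i<n. dist (f (u i)) (f (v i))) < e)"

text \<open>Solutions on a (possibly unbounded) interval \<open>I\<close>.\<close>

definition solution_on ::
    "('a::euclidean_space \<Rightarrow> 'a set) \<Rightarrow> real set \<Rightarrow> (real \<Rightarrow> 'a) \<Rightarrow> bool" where
  "solution_on F I x \<longleftrightarrow>
    (\<forall>s t. {s..t} \<subseteq> I \<longrightarrow> absolutely_continuous_on {s..t} x) \<and>
    (AE t in lborel. t \<in> I \<longrightarrow> (\<exists>v\<in>F (x t). (x has_vector_derivative v) (at t within I)))"

definition limit_set :: "(real \<Rightarrow> 'a::topological_space) \<Rightarrow> 'a set" where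
  "limit_set x = (\<Inter>t\<in>{0..}. closure (x ` {t..}))"

text \<open>An \<open>(\<epsilon>, T)\<close>-chain from \<open>x\<close> to \<open>y\<close> made of pieces of forward solutions that stay in
  \<open>A\<close>. The solutions are \<open>Z 1, \<dots>, Z n\<close>; other values of \<open>Z\<close> and \<open>\<tau>\<close> are irrelevant.\<close>

definition solution_chain ::
    "('a::euclidean_space \<Rightarrow> 'a set) \<Rightarrow> 'a set \<Rightarrow> real \<Rightarrow> real \<Rightarrow> 'a \<Rightarrow> 'a \<Rightarrow> bool" where
  "solution_chain F A \<epsilon> T x y \<longleftrightarrow>
    (\<exists>(n::nat) Z \<tau>. n \<ge> 1 \<and>
      (\<forall>i\<in>{1..n}. solution_on F {0..} (Z i) \<and> \<tau> i > T \<and> (\<forall>s\<in>{0..\<tau> i}. Z i s \<in> A)) \<and>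
      (\<forall>i\<in>{1..<n}. norm (Z i (\<tau> i) - Z (Suc i) 0) \<le> \<epsilon>) \<and>
      norm (Z 1 0 - x) \<le> \<epsilon> \<and> norm (Z n (\<tau> n) - y) \<le> \<epsilon>)"

definition chain_connected ::
    "('a::euclidean_space \<Rightarrow> 'a set) \<Rightarrow> 'a set \<Rightarrow> 'a \<Rightarrow> 'a \<Rightarrow> bool" where
  "chain_connected F A x y \<longleftrightarrow> (\<forall>\<epsilon>>0. \<forall>T>0. solution_chain F A \<epsilon> T x y)"

definition internally_chain_transitive ::
    "('a::euclidean_space \<Rightarrow> 'a set) \<Rightarrow> 'a set \<Rightarrow> bool" where
  "internally_chain_transitive F A \<longleftrightarrow>
    compact A \<and> (\<forall>x\<in>A. \<forall>y\<in>A. chain_connected F A x y)"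

definition chain_recurrent_points :: "('a::euclidean_space \<Rightarrow> 'a set) \<Rightarrow> 'a set" where
  "chain_recurrent_points F = {\<theta>. \<forall>\<epsilon>>0. \<forall>T>0. solution_chain F UNIV \<epsilon> T \<theta> \<theta>}"

text \<open>Neighbourhoods of \<open>\<Lambda>\<close> are metric ones, \<open>{x. infdist x \<Lambda> < \<epsilon>}\<close>; for compact nonempty
  \<open>\<Lambda>\<close> they form a basis of all neighbourhoods. Only solutions on all of \<open>[0, \<infinity>)\<close> are
  considered, so that statements for all \<open>t \<ge> 0\<close> and \<open>t \<rightarrow> \<infinity>\<close> make sense.\<close>

definition converges_to_set ::
    "('t \<Rightarrow> 'a::metric_space) \<Rightarrow> 'a set \<Rightarrow> 't filter \<Rightarrow> bool" where
  "converges_to_set x \<Lambda> G \<longleftrightarrow> ((\<lambda>t. infdist (x t) \<Lambda>) \<longlongrightarrow> 0) G"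

definition locally_asymptotically_stable ::
    "('a::euclidean_space \<Rightarrow> 'a set) \<Rightarrow> 'a set \<Rightarrow> bool" where
  "locally_asymptotically_stable F \<Lambda> \<longleftrightarrow>
    (\<forall>\<epsilon>>0. \<exists>\<delta>>0. \<forall>Z. solution_on F {0..} Z \<longrightarrow> infdist (Z 0) \<Lambda> < \<delta> \<longrightarrow>
       (\<forall>t\<ge>0. infdist (Z t) \<Lambda> < \<epsilon>)) \<and>
    (\<exists>\<delta>>0. \<forall>Z. solution_on F {0..} Z \<longrightarrow> infdist (Z 0) \<Lambda> < \<delta> \<longrightarrow>
       converges_to_set Z \<Lambda> at_top)"

definition domain_of_attraction ::
    "('a::euclidean_space \<Rightarrow> 'a set) \<Rightarrow> 'a set \<Rightarrow> 'a set" where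
  "domain_of_attraction F \<Lambda> =
    {x. \<forall>Z. solution_on F {0..} Z \<longrightarrow> Z 0 = x \<longrightarrow> converges_to_set Z \<Lambda> at_top}"


section \<open>Standing hypotheses\<close>

definition continuous_uniformly_on_bounded ::
    "('a::metric_space \<Rightarrow> 'z \<Rightarrow> 'b::metric_space) \<Rightarrow> 'z set \<Rightarrow> bool" where
  "continuous_uniformly_on_bounded h Q \<longleftrightarrow>
    (\<forall>S. bounded S \<longrightarrow> (\<forall>e>0. \<exists>d>0. \<forall>x\<in>S. \<forall>y\<in>S. dist x y < d \<longrightarrow>
       (\<forall>z\<in>Q. dist (h x z) (h y z) < e)))"

text \<open>For the sequence \<open>m n\<close> the modulus of continuity is uniform in the index as well as in
  the noise variable: the index is treated as part of the noise. With a modulus depending on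
  \<open>n\<close>, averaging at each fixed \<open>x\<close> says nothing about \<open>m n\<close> along the moving iterates
  (\<open>m n\<close> may be a spike centred at the current iterate whose width tends to 0).\<close>

definition continuous_uniformly_seq ::
    "(nat \<Rightarrow> 'a::metric_space \<Rightarrow> 'z \<Rightarrow> 'b::metric_space) \<Rightarrow> 'z set \<Rightarrow> bool" where
  "continuous_uniformly_seq m Q \<longleftrightarrow>
    (\<forall>x. \<forall>e>0. \<exists>d>0. \<forall>y. dist y x < d \<longrightarrow>
       (\<forall>n. \<forall>z\<in>Q. dist (m n y z) (m n x z) < e))"

text \<open>The inner limit below always exists, the events being decreasing in \<open>n\<close>.\<close>

definition growth_condition ::
    "'w measure \<Rightarrow> (nat \<Rightarrow> real) \<Rightarrow> 'z measure \<Rightarrow> (nat \<Rightarrow> 'w \<Rightarrow> 'z) \<Rightarrow>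
      ('a::euclidean_space \<Rightarrow> 'z \<Rightarrow> 'a) \<Rightarrow> bool" where
  "growth_condition M a N \<zeta> h \<longleftrightarrow>
    (\<exists>g\<^sub>1 \<in> borel_measurable borel. \<exists>g\<^sub>2 \<in> borel_measurable N. \<exists>g\<^sub>3 \<in> borel_measurable N.
      (\<forall>x. g\<^sub>1 x \<ge> (0::real)) \<and> (\<forall>z\<in>space N. g\<^sub>2 z \<ge> (0::real) \<and> g\<^sub>3 z \<ge> (0::real)) \<and>
      (\<forall>S. bounded S \<longrightarrow> bounded (g\<^sub>1 ` S)) \<and>
      (\<forall>x. \<forall>z\<in>space N. norm (h x z) \<le> g\<^sub>1 x * g\<^sub>2 z + g\<^sub>3 z) \<and>
      (\<forall>\<epsilon>>0. ((\<lambda>\<Delta>. lim (\<lambda>n.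
          \<P>(\<omega> in M. window_sup a \<Delta> n (\<lambda>I. \<Sum>i\<in>I. a i * (g\<^sub>2 (\<zeta> i \<omega>) + g\<^sub>3 (\<zeta> i \<omega>))) \<ge> ereal \<epsilon>)))
        \<longlongrightarrow> 0) (at_right 0)))"

end

theory Submission
  imports Defs "HOL-Complex_Analysis.Great_Picard"
begin

text \<open>
  Probability is used only to choose the null set; everything else is deterministic and is done
  for one sample path. Such a path satisfies \<open>x (Suc n) = x n + a n *\<^sub>R (w n + e n)\<close>, where
  \<open>w n = u n + hbar (x n)\<close> with \<open>u n \<in> krasovskii bbar (x n)\<close>, so that \<open>w n\<close> lies in the
  right-hand side \<open>krasovskii (\<lambda>y. bbar y + hbar y) (x n)\<close> of the inclusion because \<open>hbar\<close> is
  continuous (\<open>krasovskii_add_continuous\<close>), and \<open>e n\<close> collects the error of size at most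
  \<open>m n (x n) (\<xi> n)\<close>, the fluctuation \<open>h (x n) (\<zeta> n) - hbar (x n)\<close>, and the noises
  \<open>h\<^sub>0 (\<eta> n)\<close> and \<open>\<beta> n\<close>.

  \<^bold>\<open>The noise averages out.\<close> Call \<open>e\<close> negligible if its sums weighted by the steps tend to 0 over late
  time windows of bounded length. Almost surely the averaging hypotheses make the noise at every
  frozen point \<open>y\<close> negligible: the events in them decrease, so that their intersection is null, and
  a countable dense set of points suffices by equicontinuity (\<open>AE_all_negligible_noise\<close>). It remains
  to replace the frozen point by the iterates. For the positive \<open>m n\<close> this is a comparison with
  finitely many frozen points (\<open>negligible_noise_along_bounded_sequence\<close>). For \<open>h\<close>, whose averages
  rest on cancellation, one needs that the iterates move slowly compared with the time scale
  \<open>step_time a\<close>. They do, because \<open>h y z - h 0 z\<close> is bounded uniformly in \<open>z\<close> for bounded \<open>y\<close>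
  (\<open>bounded_oscillation\<close>); over a short window one frozen point then serves all iterates
  (\<open>negligible_noise_along_iterates\<close>).

  \<^bold>\<open>Limits are solutions.\<close> The inclusion is used in integrated form: a curve \<open>y\<close> is a mean value path
  if its difference quotient over \<open>[s, t]\<close> lies in the closed convex hull of \<open>f ` U\<close> for every open \<open>U\<close>
  containing \<open>y ` {s..t}\<close>. This form passes to locally uniform limits at once, and the limits of the
  interpolated iterates have it, since up to negligible noise their difference quotients are convex
  combinations of the \<open>w i\<close> (\<open>interpolated_limit_mean_value_path\<close>). A bounded mean value path
  is Lipschitz, hence differentiable almost everywhere (\<open>lipschitz_differentiable_AE\<close>, proved here
  with the Vitali covering theorem), and letting \<open>t\<close> tend to \<open>s\<close> and \<open>U\<close> shrink to \<open>y s\<close> puts the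
  derivative into \<open>krasovskii f (y s)\<close> (\<open>mean_value_path_solution\<close>).

  \<^bold>\<open>Long-term behaviour.\<close> The interpolated iterates and their limits share one property, called
  asymptotic solution below: they are bounded and uniformly continuous, and all limits of their
  time-translates are mean value paths. By the theorem of Arzela and Ascoli such limits exist, so
  that at late times the curve follows, over windows of any prescribed length, a solution that
  lies in its limit set. Cutting the curve into long windows gives the chains required
  for internal chain transitivity (\<open>limit_set_internally_chain_transitive\<close>). If the curve is late and
  close to \<open>\<Lambda>\<close>, the solution it follows stays close to \<open>\<Lambda>\<close> and comes closer, and so the curve stays
  close and returns; iterating this gives the convergence to \<open>\<Lambda>\<close>
  (\<open>asymptotic_solution_converges_to_attractor\<close>).
\<close>

section \<open>Almost everywhere differentiability of Lipschitz curves\<close>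

text \<open>Serves two purposes for the pair \<open>L x + f x\<close>, \<open>L x - f x\<close> made from a Lipschitz function \<open>f\<close>: both
  Stieltjes measures are absolutely continuous, and an upper bound for one of them is a lower
  bound for the other.\<close>

lemma interval_measures_add_to_lborel:
  fixes f g :: "real \<Rightarrow> real"
  assumes mono: "mono f" "mono g"
    and cont: "continuous_on UNIV f" "continuous_on UNIV g"
    and sum: "\<And>x. f x + g x = K * x" and E: "E \<in> sets borel"
  shows "emeasure (interval_measure f) E + emeasure (interval_measure g) E = ennreal K * emeasure lborel E"
proof -
  let ?\<mu> = "\<lambda>A. emeasure (interval_measure f) A + emeasure (interval_measure g) A"
  define P where "P = measure_of UNIV (sets borel) ?\<mu>"
  have K0: "K \<ge> 0"
    using sum[of 0] sum[of 1] monoD[OF mono(1), of 0 1] monoD[OF mono(2), of 0 1] by simp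
  have eP: "emeasure P A = ?\<mu> A" if "A \<in> sets borel" for A
  proof (rule emeasure_measure_of[OF P_def])
    show "countably_additive (sets P) ?\<mu>"
      unfolding countably_additive_def
    proof (intro allI impI)
      fix A :: "nat \<Rightarrow> real set"
      assume A: "range A \<subseteq> sets P" "disjoint_family A"
      have "range A \<subseteq> sets borel" using A(1) unfolding P_def by (simp add: sets.sigma_sets_eq[of borel, simplified])
      then show "(\<Sum>i. ?\<mu> (A i)) = ?\<mu> (\<Union>i. A i)"
        using A(2) by (simp add: suminf_add[symmetric] suminf_emeasure del: suminf_add)
    qed
    show "A \<in> sets P" using that unfolding P_def by (simp add: sets.sigma_sets_eq[of borel, simplified])
    show "positive (sets P) ?\<mu>" by (simp add: positive_def)
  qed (use sets.space_closed[of borel] in auto)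
  have Ioc: "emeasure P {a<..b} = ennreal K * emeasure lborel {a<..b}" if "a \<le> b" for a b
  proof -
    have c: "continuous (at_right u) f" "continuous (at_right u) g" for u
      using cont by (auto simp: continuous_on_eq_continuous_at intro: continuous_at_imp_continuous_within)
    have "emeasure P {a<..b} = ennreal (f b - f a) + ennreal (g b - g a)"
      using that c monoD[OF mono(1)] monoD[OF mono(2)] by (simp add: eP emeasure_interval_measure_Ioc)
    also have "\<dots> = ennreal ((f b + g b) - (f a + g a))"
      using that monoD[OF mono(1), of a b] monoD[OF mono(2), of a b] by (subst ennreal_plus[symmetric]) (auto simp: algebra_simps)
    also have "\<dots> = ennreal K * emeasure lborel {a<..b}"
      using that K0 by (simp add: sum ennreal_mult[symmetric] algebra_simps)
    finally show ?thesis .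
  qed
  have "P = scale_measure (ennreal K) lborel"
  proof (rule measure_eqI_generator_eq[where E="range (\<lambda>(a,b). {a<..b::real})" and \<Omega>=UNIV and A="\<lambda>n. {- real n<..real n}"])
    show "Int_stable (range (\<lambda>(a, b). {a<..b::real}))"
      by (auto simp: Int_stable_def image_iff) 
    show "\<And>X. X \<in> range (\<lambda>(a, b). {a<..b}) \<Longrightarrow> emeasure P X = emeasure (scale_measure (ennreal K) lborel) X"
    proof -
      fix X :: "real set" assume "X \<in> range (\<lambda>(a, b). {a<..b})"
      then obtain a b where X: "X = {a<..b}" by auto
      show "emeasure P X = emeasure (scale_measure (ennreal K) lborel) X"
        using Ioc[of a b] unfolding X by (cases "a \<le> b") (auto simp: eP)
    qed
    show "sets P = sigma_sets UNIV (range (\<lambda>(a, b). {a<..b}))"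
      unfolding P_def by (simp add: sets.sigma_sets_eq[of borel, simplified])
         (simp add: borel_sigma_sets_Ioc)
    show "sets (scale_measure (ennreal K) lborel) = sigma_sets UNIV (range (\<lambda>(a, b). {a<..b::real}))"
      by (simp add: borel_sigma_sets_Ioc)
    show "(\<Union>i. {- real i<..real i}) = UNIV"
    proof (intro set_eqI iffI UNIV_I)
      fix x :: real
      obtain n where "\<bar>x\<bar> < real n" using reals_Archimedean2 by blast
      then show "x \<in> (\<Union>i. {- real i<..real i})" by (auto intro!: exI[of _ n])
    qed
    show "\<And>i. emeasure P {- real i<..real i} \<noteq> \<infinity>"
      using Ioc by (simp add: ennreal_mult_eq_top_iff)
  qed auto
  then show ?thesis using eP[OF E] by simp
qed

text \<open>The intervals of small slope inside an open superset \<open>U\<close> of \<open>E\<close> form a Vitali cover of \<open>E\<close>. A disjoint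
  subfamily fills \<open>E\<close> up to a null set, and its total Stieltjes measure is at most \<open>p\<close> times the
  Lebesgue measure of \<open>U\<close>, which exceeds that of \<open>E\<close> by as little as one likes.\<close>

lemma interval_measure_le_of_small_slopes:
  fixes f :: "real \<Rightarrow> real"
  assumes mono: "mono f" and cont: "continuous_on UNIV f" and p: "p \<ge> 0"
    and ac: "\<And>N. N \<in> null_sets lborel \<Longrightarrow> emeasure (interval_measure f) N = 0"
    and E: "E \<in> sets borel"
    and slope: "\<And>x d. x \<in> E \<Longrightarrow> 0 < d \<Longrightarrow> 
       \<exists>u v. u < v \<and> v - u < d \<and> u \<le> x \<and> x \<le> v \<and> f v - f u \<le> p * (v - u)"
  shows "emeasure (interval_measure f) E \<le> ennreal p * emeasure lborel E"
proof -
  let ?\<mu> = "interval_measure f"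
  have "emeasure ?\<mu> E \<le> ennreal p * emeasure lborel E + ennreal p * ennreal e" if e: "e > 0" for e
  proof -
    obtain U where U: "open U" "E \<subseteq> U" "emeasure lborel (U - E) < ennreal e"
      using outer_regular_lborel[OF E e] by auto
    define I where "I = (\<lambda>(u::real,v::real). {u..v})"
    define K where "K = {(u,v). u < v \<and> {u..v} \<subseteq> U \<and> f v - f u \<le> p * (v - u)}"
    \<comment> \<open>the covering theorem is stated for balls: an interval is the closed ball about its midpoint\<close>
    have cb: "cball (fst i + (snd i - fst i)/2) ((snd i - fst i)/2) = I i" for i
      by (auto simp: I_def dist_real_def abs_real_def field_simps split: if_splits prod.splits)
    have cov: "\<exists>i. i \<in> K \<and> x \<in> cball (fst i + (snd i - fst i)/2) ((snd i - fst i)/2) \<and> (snd i - fst i)/2 < d"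
      if x: "x \<in> E" and d: "d > 0" for x d
    proof -
      obtain r where r: "r > 0" "cball x r \<subseteq> U" using U x by (meson open_contains_cball subsetD)
      obtain u v where uv: "u < v" "v - u < min d r" "u \<le> x" "x \<le> v" "f v - f u \<le> p * (v - u)"
        using slope[OF x, of "min d r"] d r by auto
      have "{u..v} \<subseteq> cball x r" using uv by (auto simp: dist_real_def)
      then have "(u,v) \<in> K" using uv r(2) by (auto simp: K_def)
      then show ?thesis unfolding cb using uv d by (intro exI[of _ "(u,v)"]) (auto simp: I_def)
    qed
    obtain C where C: "countable C" "C \<subseteq> K"
      "pairwise (\<lambda>i j. disjnt (I i) (I j)) C" "negligible (E - (\<Union>i\<in>C. I i))"
    proof (rule Vitali_covering_theorem_cballs[of K "\<lambda>i. (snd i - fst i)/2" E "\<lambda>i. fst i + (snd i - fst i)/2"])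
      show "\<And>i. i \<in> K \<Longrightarrow> 0 < (snd i - fst i)/2" by (auto simp: K_def)
      show "\<And>x d. \<lbrakk>x \<in> E; 0 < d\<rbrakk> \<Longrightarrow> \<exists>i. i \<in> K \<and> x \<in> cball (fst i + (snd i - fst i)/2) ((snd i - fst i)/2) \<and> (snd i - fst i)/2 < d" 
        using cov by blast
    qed (unfold cb, blast)
    have mI: "I i \<in> sets borel" for i by (auto simp: I_def split: prod.splits)
    have mUC: "(\<Union>i\<in>C. I i) \<in> sets borel" using C(1) mI by auto
    have disj: "disjoint_family_on I C"
      using C(3) by (auto simp: disjoint_family_on_def pairwise_def disjnt_def)
    have nul: "E - (\<Union>i\<in>C. I i) \<in> null_sets lborel"
      using C(4) E mUC negligible_iff_null_sets null_sets_completion_iff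
      by (metis sets.Diff sets_lborel)
    have "emeasure ?\<mu> E \<le> emeasure ?\<mu> ((E - (\<Union>i\<in>C. I i)) \<union> (\<Union>i\<in>C. I i))"
      using E mUC by (intro emeasure_mono) auto
    also have "\<dots> \<le> emeasure ?\<mu> (E - (\<Union>i\<in>C. I i)) + emeasure ?\<mu> (\<Union>i\<in>C. I i)"
      using E mUC by (intro emeasure_subadditive) auto
    also have "\<dots> = emeasure ?\<mu> (\<Union>i\<in>C. I i)" using ac[OF nul] by simp
    also have "\<dots> = (\<integral>\<^sup>+i. emeasure ?\<mu> (I i) \<partial>count_space C)"
      using C(1) disj mI by (intro emeasure_UN_countable) auto
    also have "\<dots> \<le> (\<integral>\<^sup>+i. ennreal p * emeasure lborel (I i) \<partial>count_space C)"
    proof (rule nn_integral_mono)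
      fix i assume "i \<in> space (count_space C)"
      then have "i \<in> K" using C by auto
      then obtain u v where i: "i = (u,v)" "u < v" "f v - f u \<le> p * (v - u)" by (auto simp: K_def)
      show "emeasure ?\<mu> (I i) \<le> ennreal p * emeasure lborel (I i)"
        using i p monoD[OF mono] cont 
        by (auto simp: I_def emeasure_interval_measure_Icc ennreal_mult[symmetric])
    qed
    also have "\<dots> = ennreal p * (\<integral>\<^sup>+i. emeasure lborel (I i) \<partial>count_space C)"
      by (rule nn_integral_cmult) simp
    also have "(\<integral>\<^sup>+i. emeasure lborel (I i) \<partial>count_space C) = emeasure lborel (\<Union>i\<in>C. I i)"
      using C(1) disj mI by (intro emeasure_UN_countable[symmetric]) auto
    also have "\<dots> \<le> emeasure lborel (E \<union> (U - E))"
      using C(2) U E by (intro emeasure_mono) (auto simp: K_def I_def)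
    also have "\<dots> \<le> emeasure lborel E + emeasure lborel (U - E)"
      using E U by (intro emeasure_subadditive) auto
    also have "\<dots> \<le> emeasure lborel E + ennreal e" using U by (intro add_left_mono) auto
    finally show ?thesis by (simp add: distrib_left mult_left_mono)
  qed
  note * = this
  show ?thesis
  proof (cases "p = 0")
    case True then show ?thesis using *[of 1] by simp
  next
    case False
    then have p: "p > 0" using p by simp
    show ?thesis
    proof (rule ennreal_le_epsilon)
      fix e :: real assume "0 < e"
      then show "emeasure ?\<mu> E \<le> ennreal p * emeasure lborel E + ennreal e"
        using *[of "e / p"] p by (simp add: ennreal_mult[symmetric])
    qed
  qed
qed

text \<open>On the exceptional set \<open>E\<close> the functions \<open>L x + f x\<close> and \<open>L x - f x\<close> have slopes at most \<open>p + L\<close> and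
  \<open>L - q\<close> on arbitrarily small intervals. Their Stieltjes measures add up to \<open>2 * L\<close> times Lebesgue measure,
  whereas the bounds add up to \<open>2 * L - (q - p)\<close> times it; so \<open>E\<close> is null.\<close>

lemma not_between_slopes_AE:
  fixes f :: "real \<Rightarrow> real"
  assumes lip: "\<And>x y. \<bar>f x - f y\<bar> \<le> L * \<bar>x - y\<bar>" and pq: "p < q"
  shows "AE x in lborel. \<not> ((\<exists>\<^sub>F h in at 0. (f (x + h) - f x) / h < p) \<and> (\<exists>\<^sub>F h in at 0. (f (x + h) - f x) / h > q))"
proof -
  define Q where "Q h x = (f (x + h) - f x) / h" for h x
  have L0: "L \<ge> 0" using lip[of 0 1] by simp
  have cf: "continuous_on UNIV f"
  proof (rule lipschitz_on_continuous_on)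
    show "L-lipschitz_on UNIV f" using lip L0 by (auto simp: lipschitz_on_def dist_real_def)
  qed
  have cQ: "continuous_on UNIV (Q h)" for h
    unfolding Q_def divide_inverse 
    by (intro continuous_intros continuous_on_compose2[OF cf]) auto
  \<comment> \<open>increments \<open>h\<close> shrinking to 0; the sets below are countable intersections of open sets\<close>
  define H where "H n = {h::real. h \<noteq> 0 \<and> \<bar>h\<bar> < 1 / real (Suc n)}" for n
  have freq: "(\<exists>\<^sub>F h in at (0::real). P h) \<longleftrightarrow> (\<forall>n. \<exists>h\<in>H n. P h)" for P
  proof
    assume "\<exists>\<^sub>F h in at 0. P h"
    then show "\<forall>n. \<exists>h\<in>H n. P h"
    proof (intro allI)
      fix n
      have "eventually (\<lambda>h. h \<in> H n) (at 0)"
        unfolding eventually_at H_def by (auto simp: dist_real_def intro!: exI[of _ "1 / real (Suc n)"])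
      then have "\<exists>\<^sub>F h in at 0. P h \<and> h \<in> H n"
        by (rule frequently_eventually_frequently[OF \<open>\<exists>\<^sub>F h in at 0. P h\<close>])
      then show "\<exists>h\<in>H n. P h" using frequently_ex by blast
    qed
  next
    assume *: "\<forall>n. \<exists>h\<in>H n. P h"
    show "\<exists>\<^sub>F h in at 0. P h"
    proof (rule ccontr)
      assume "\<not> (\<exists>\<^sub>F h in at 0. P h)"
      then obtain d where "d > 0" and d: "\<And>h. h \<noteq> 0 \<Longrightarrow> \<bar>h\<bar> < d \<Longrightarrow> \<not> P h"
        unfolding frequently_def eventually_at by (auto simp: dist_real_def)
      then obtain n where n: "1 / real (Suc n) < d" using nat_approx_posE by blast
      obtain h where "h \<in> H n" "P h" using * by blast
      then show False using d[of h] n by (auto simp: H_def)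
    qed
  qed
  define A where "A = (\<Inter>n. \<Union>h\<in>H n. {x. Q h x < p})"
  define B where "B = (\<Inter>n. \<Union>h\<in>H n. {x. Q h x > q})"
  have AB: "x \<in> A \<inter> B \<longleftrightarrow> (\<exists>\<^sub>F h in at 0. (f (x + h) - f x) / h < p) \<and> (\<exists>\<^sub>F h in at 0. (f (x + h) - f x) / h > q)" for x
    unfolding freq A_def B_def Q_def by auto
  have "open (\<Union>h\<in>H n. {x. Q h x < p})" "open (\<Union>h\<in>H n. {x. Q h x > q})" for n
    by (auto intro!: open_Collect_less cQ continuous_intros)
  then have mAB: "A \<in> sets borel" "B \<in> sets borel" unfolding A_def B_def by auto
  have slope: "\<exists>u v. u < v \<and> v - u < d \<and> u \<le> x \<and> x \<le> v \<and> Q h x = (f v - f u) / (v - u)"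
    if "h \<noteq> 0" "\<bar>h\<bar> < d" for h x d
    using that by (intro exI[of _ "min x (x + h)"] exI[of _ "max x (x + h)"]) (auto simp: Q_def min_def max_def field_simps)
  define F where "F x = L * x + f x" for x
  define G where "G x = L * x - f x" for x
  have mono: "mono F" "mono G"
  proof -
    have "F x \<le> F y \<and> G x \<le> G y" if "x \<le> y" for x y
      using lip[of x y] that unfolding F_def G_def by (auto simp: abs_if algebra_simps split: if_splits)
    then show "mono F" "mono G" by (auto intro!: monoI)
  qed
  have cont: "continuous_on UNIV F" "continuous_on UNIV G"
    unfolding F_def G_def by (intro continuous_intros cf)+
  have add: "emeasure (interval_measure F) E + emeasure (interval_measure G) E = ennreal (2 * L) * emeasure lborel E"
    if "E \<in> sets borel" for E
    by (rule interval_measures_add_to_lborel[OF mono cont _ that]) (simp add: F_def G_def)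
  have ac: "emeasure (interval_measure F) N = 0" "emeasure (interval_measure G) N = 0" 
    if "N \<in> null_sets lborel" for N
    using add[of N] that by (auto simp: null_sets_def)
  have null: "A \<inter> B \<inter> {-real n..real n} \<in> null_sets lborel" for n
  proof (cases "A \<inter> B = {}")
    case True then show ?thesis by simp
  next
    case False
    define E where "E = A \<inter> B \<inter> {-real n..real n}"
    have E: "E \<in> sets borel" using mAB by (auto simp: E_def)
    obtain x where x: "x \<in> A" "x \<in> B" using False by auto
    have Qb: "\<bar>Q h x\<bar> \<le> L" if "h \<noteq> 0" for h x using lip[of "x+h" x] that by (simp add: Q_def field_simps)
    obtain h h' where "h \<in> H 0" "Q h x < p" "h' \<in> H 0" "Q h' x > q" using x unfolding A_def B_def by blast
    then have pL: "p + L \<ge> 0" and qL: "L - q \<ge> 0" using Qb[of h x] Qb[of h' x] by (auto simp: H_def)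
    have small: "\<exists>n. \<forall>h\<in>H n. \<bar>h\<bar> < d" if d: "d > 0" for d
    proof -
      obtain n where "1 / real (Suc n) < d" using d nat_approx_posE by blast
      then show ?thesis unfolding H_def by (intro exI[of _ n]) auto
    qed
    have "emeasure (interval_measure F) E \<le> ennreal (p + L) * emeasure lborel E"
    proof (rule interval_measure_le_of_small_slopes[OF mono(1) cont(1) pL ac(1) E])
      fix x d :: real assume x: "x \<in> E" and d: "d > 0"
      obtain n where n: "\<forall>h\<in>H n. \<bar>h\<bar> < d" using small[OF d] by blast
      obtain h where h: "h \<in> H n" "Q h x < p" using x unfolding E_def A_def by blast
      then obtain u v where uv: "u < v" "v - u < d" "u \<le> x" "x \<le> v" "Q h x = (f v - f u) / (v - u)"
        using slope[of h d x] n unfolding H_def by blast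
      then have "f v - f u = Q h x * (v - u)" by simp
      also have "\<dots> \<le> p * (v - u)" using h(2) uv(1) by (intro mult_right_mono) auto
      finally have "f v - f u \<le> p * (v - u)" .
      then show "\<exists>u v. u < v \<and> v - u < d \<and> u \<le> x \<and> x \<le> v \<and> F v - F u \<le> (p + L) * (v - u)"
        using uv unfolding F_def by (intro exI[of _ u] exI[of _ v]) (auto simp: algebra_simps)
    qed
    moreover have "emeasure (interval_measure G) E \<le> ennreal (L - q) * emeasure lborel E"
    proof (rule interval_measure_le_of_small_slopes[OF mono(2) cont(2) qL ac(2) E])
      fix x d :: real assume x: "x \<in> E" and d: "d > 0"
      obtain n where n: "\<forall>h\<in>H n. \<bar>h\<bar> < d" using small[OF d] by blast
      obtain h where h: "h \<in> H n" "Q h x > q" using x unfolding E_def B_def by blast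
      then obtain u v where uv: "u < v" "v - u < d" "u \<le> x" "x \<le> v" "Q h x = (f v - f u) / (v - u)"
        using slope[of h d x] n unfolding H_def by blast
      have "q * (v - u) \<le> Q h x * (v - u)" using h(2) uv(1) by (intro mult_right_mono) auto
      also have "\<dots> = f v - f u" using uv by simp
      finally have "q * (v - u) \<le> f v - f u" .
      then show "\<exists>u v. u < v \<and> v - u < d \<and> u \<le> x \<and> x \<le> v \<and> G v - G u \<le> (L - q) * (v - u)"
        using uv unfolding G_def by (intro exI[of _ u] exI[of _ v]) (auto simp: algebra_simps)
    qed
    ultimately have le: "ennreal (2 * L) * emeasure lborel E \<le> ennreal (p + L) * emeasure lborel E + ennreal (L - q) * emeasure lborel E"
      unfolding add[OF E, symmetric] by (rule add_mono)
    have "emeasure lborel E \<le> emeasure lborel {-real n..real n}"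
      by (rule emeasure_mono) (auto simp: E_def)
    then have "emeasure lborel E < \<infinity>" by (simp add: order_le_less_trans)
    then obtain r where r: "emeasure lborel E = ennreal r" "r \<ge> 0" by (cases "emeasure lborel E") auto
    have "2 * L * r \<le> (p + L) * r + (L - q) * r"
      using le L0 pL qL r by (simp add: ennreal_mult[symmetric] ennreal_plus[symmetric] del: ennreal_plus)
    then have "(q - p) * r \<le> 0" by (simp add: algebra_simps)
    then have "r = 0" using pq r(2) by (simp add: mult_le_0_iff)
    then show ?thesis using r(1) E unfolding E_def[symmetric] by (simp add: null_sets_def)
  qed
  have "(\<Union>n. A \<inter> B \<inter> {-real n..real n}) \<in> null_sets lborel" using null by blast
  moreover have "A \<inter> B \<subseteq> (\<Union>n. A \<inter> B \<inter> {-real n..real n})"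
  proof
    fix x assume "x \<in> A \<inter> B"
    moreover obtain n where "\<bar>x\<bar> < real n" using reals_Archimedean2 by blast
    ultimately show "x \<in> (\<Union>n. A \<inter> B \<inter> {-real n..real n})" by (auto intro!: exI[of _ n])
  qed
  ultimately have "AE x in lborel. x \<notin> A \<inter> B"
    by (metis (no_types, lifting) AE_not_in eventually_mono subsetD)
  then show ?thesis unfolding AB .
qed

lemma tendsto_of_no_oscillation:
  fixes Q :: "real \<Rightarrow> real"
  assumes b: "eventually (\<lambda>h. \<bar>Q h\<bar> \<le> L) F" and F: "F \<noteq> bot"
    and no: "\<And>p q :: rat. p < q \<Longrightarrow> \<not> ((\<exists>\<^sub>F h in F. Q h < of_rat p) \<and> (\<exists>\<^sub>F h in F. Q h > of_rat q))"
  obtains D where "(Q \<longlongrightarrow> D) F"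
proof -
  let ?l = "Liminf F (\<lambda>h. ereal (Q h))" and ?u = "Limsup F (\<lambda>h. ereal (Q h))"
  have lu: "?l \<le> ?u" using F by (rule Liminf_le_Limsup)
  have "?u \<le> ?l"
  proof (rule ccontr)
    assume "\<not> ?u \<le> ?l"
    then obtain r s :: rat where r: "?l < real_of_rat r" and s: "real_of_rat r < real_of_rat s" "real_of_rat s < ?u"
      by (metis ereal_dense3 ereal_less(2) less_ereal.simps(1) not_le)
    have "\<exists>\<^sub>F h in F. Q h < of_rat r"
    proof (rule ccontr)
      assume "\<not> (\<exists>\<^sub>F h in F. Q h < of_rat r)"
      then have "eventually (\<lambda>h. ereal (of_rat r) \<le> ereal (Q h)) F" by (simp add: frequently_def not_less)
      from Liminf_bounded[OF this] show False using r by simp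
    qed
    moreover have "\<exists>\<^sub>F h in F. Q h > of_rat s"
    proof (rule ccontr)
      assume "\<not> (\<exists>\<^sub>F h in F. Q h > of_rat s)"
      then have "eventually (\<lambda>h. ereal (Q h) \<le> ereal (of_rat s)) F" by (simp add: frequently_def not_less)
      from Limsup_bounded[OF this] show False using s by simp
    qed
    ultimately show False using no[of r s] s(1) by (simp add: of_rat_less)
  qed
  then have eq: "?l = ?u" using lu by simp
  have "ereal (-L) \<le> ?l" by (rule Liminf_bounded) (use b in eventually_elim, auto)
  moreover have "?u \<le> ereal L" by (rule Limsup_bounded) (use b in eventually_elim, auto)
  ultimately have "\<bar>?l\<bar> \<noteq> \<infinity>" using eq by (metis ereal_infty_less_eq(1) ereal_infty_less_eq2(2) PInfty_neq_ereal(1) MInfty_neq_ereal(1) abs_neq_infinity_cases ereal_infinity_cases)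
  then obtain D where D: "?l = ereal D" by (metis ereal_real)
  have "((\<lambda>h. ereal (Q h)) \<longlongrightarrow> ereal D) F"
    using tendsto_iff_Liminf_eq_Limsup[OF F] D eq by metis
  then show ?thesis using that by simp
qed

text \<open>Outside a null set the lower and the upper derivative are not separated by any pair of rationals.\<close>

lemma lipschitz_real_differentiable_AE:
  fixes f :: "real \<Rightarrow> real"
  assumes lip: "\<And>x y. \<bar>f x - f y\<bar> \<le> L * \<bar>x - y\<bar>"
  shows "AE x in lborel. f differentiable (at x)"
proof -
  have "AE x in lborel. \<forall>p q::rat. p < q \<longrightarrow> \<not> ((\<exists>\<^sub>F h in at 0. (f (x + h) - f x) / h < of_rat p) \<and> (\<exists>\<^sub>F h in at 0. (f (x + h) - f x) / h > of_rat q))"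
    unfolding AE_all_countable
  proof (intro allI)
    fix p q :: rat
    show "AE x in lborel. p < q \<longrightarrow> \<not> ((\<exists>\<^sub>F h in at 0. (f (x + h) - f x) / h < of_rat p) \<and> (\<exists>\<^sub>F h in at 0. (f (x + h) - f x) / h > of_rat q))"
      using not_between_slopes_AE[of f L "of_rat p" "of_rat q", OF lip] by (cases "p < q") (auto simp: of_rat_less)
  qed
  then show ?thesis
  proof eventually_elim
    case (elim x)
    have "eventually (\<lambda>h. \<bar>(f (x + h) - f x) / h\<bar> \<le> L) (at 0)"
      unfolding eventually_at using lip[of "x + h" x for h] by (auto simp: field_simps intro!: exI[of _ 1])
    from tendsto_of_no_oscillation[OF this] elim obtain D where "((\<lambda>h. (f (x + h) - f x) / h) \<longlongrightarrow> D) (at 0)" by auto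
    then show ?case by (auto simp: real_differentiable_def DERIV_def)
  qed
qed

lemma lipschitz_differentiable_AE:
  fixes f :: "real \<Rightarrow> 'a::euclidean_space"
  assumes lip: "L-lipschitz_on UNIV f"
  shows "AE x in lborel. f differentiable (at x)"
proof -
  have "AE x in lborel. (\<lambda>t. f t \<bullet> b) differentiable (at x)" if b: "b \<in> Basis" for b
  proof (rule lipschitz_real_differentiable_AE[of _ L])
    fix x y
    have "\<bar>f x \<bullet> b - f y \<bullet> b\<bar> \<le> norm (f x - f y)"
      using Basis_le_norm[OF b, of "f x - f y"] by (simp add: inner_diff_left)
    then show "\<bar>f x \<bullet> b - f y \<bullet> b\<bar> \<le> L * \<bar>x - y\<bar>"
      using lipschitz_onD[OF lip, of x y] by (simp add: dist_norm)
  qed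
  then have "AE x in lborel. \<forall>b\<in>Basis. (\<lambda>t. f t \<bullet> b) differentiable (at x)"
    by (simp add: AE_ball_countable countable_finite)
  then show ?thesis
    by (rule eventually_mono) (subst differentiable_componentwise_within, simp)
qed

section \<open>The Krasovskii operator of a locally bounded map\<close>

text \<open>The radii may depend on the centre, as the moduli of continuity in the averaging hypotheses do.\<close>

lemma bounded_finite_ball_cover:
  fixes S :: "'a::heine_borel set"
  assumes S: "bounded S" and d: "\<And>y. d y > 0"
  obtains C where "finite C" "C \<subseteq> closure S" "S \<subseteq> (\<Union>y\<in>C. ball y (d y))"
proof -
  have "closure S \<subseteq> (\<Union>y\<in>closure S. ball y (d y))" using d by (meson UN_I centre_in_ball subsetI)
  then obtain C where "C \<subseteq> closure S" "finite C" "closure S \<subseteq> (\<Union>y\<in>C. ball y (d y))"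
    using compactE_image[of "closure S" "closure S" "\<lambda>y. ball y (d y)"] S by (metis compact_closure open_ball)
  then show ?thesis using that closure_subset[of S] by (metis subset_trans)
qed

lemma locally_bounded_imp_bounded_image:
  fixes f :: "'a::heine_borel \<Rightarrow> 'b::metric_space"
  assumes f: "locally_bounded f" and S: "bounded S"
  shows "bounded (f ` S)"
proof -
  obtain d where d: "\<And>x. d x > 0" "\<And>x. bounded (f ` ball x (d x))"
    using f unfolding locally_bounded_def by metis
  obtain C where C: "finite C" "S \<subseteq> (\<Union>x\<in>C. ball x (d x))"
    by (rule bounded_finite_ball_cover[where d=d, OF S d(1)]) (rule that)
  have "f ` S \<subseteq> (\<Union>x\<in>C. f ` ball x (d x))" using C(2) by blast
  moreover have "bounded (\<Union>x\<in>C. f ` ball x (d x))" using C(1) d(2) by blast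
  ultimately show ?thesis using bounded_subset by blast
qed

lemma locally_bounded_add_continuous:
  fixes f g :: "'a::euclidean_space \<Rightarrow> 'a"
  assumes f: "locally_bounded f" and g: "continuous_on UNIV g"
  shows "locally_bounded (\<lambda>x. f x + g x)"
  unfolding locally_bounded_def
proof
  fix x
  have "bounded (f ` ball x 1)" using locally_bounded_imp_bounded_image[OF f] by simp
  moreover have "bounded (g ` ball x 1)"
    by (rule bounded_subset[OF compact_imp_bounded[OF compact_continuous_image[OF continuous_on_subset[OF g], of "cball x 1"]]]) auto
  ultimately obtain A B where "\<forall>y\<in>ball x 1. norm (f y) \<le> A" "\<forall>y\<in>ball x 1. norm (g y) \<le> B"
    unfolding bounded_iff by auto
  then have "\<forall>y\<in>ball x 1. norm (f y + g y) \<le> A + B" by (meson add_mono norm_triangle_le)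
  then show "\<exists>d>0. bounded ((\<lambda>x. f x + g x) ` ball x d)"
    unfolding bounded_iff by (intro exI[of _ 1]) auto
qed

abbreviation hull_image :: "('a::euclidean_space \<Rightarrow> 'a) \<Rightarrow> 'a set \<Rightarrow> 'a set" where
  "hull_image f U \<equiv> closure (convex hull (f ` U))"

lemma hull_image_mono: "U \<subseteq> V \<Longrightarrow> hull_image f U \<subseteq> hull_image f V"
  by (intro closure_mono hull_mono image_mono)

lemma krasovskii_subset_hull_image:
  assumes "open U" "x \<in> U"
  shows "krasovskii f x \<subseteq> hull_image f U"
proof -
  obtain d where "d > 0" "ball x d \<subseteq> U" using assms open_contains_ball by blast
  then show ?thesis unfolding krasovskii_def using hull_image_mono[of "ball x d" U f] by blast
qed

text \<open>Adding \<open>g\<close>, which is nearly the constant \<open>c\<close> on \<open>S\<close>, moves convex combinations by nearly \<open>c\<close>.\<close>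

lemma convex_hull_add_close:
  fixes f g :: "'b \<Rightarrow> 'a::real_normed_vector"
  assumes close: "\<And>y. y \<in> S \<Longrightarrow> norm (g y - c) \<le> e" and u: "u \<in> convex hull (f ` S)"
  shows "\<exists>v \<in> convex hull ((\<lambda>y. f y + g y) ` S). norm (u + c - v) \<le> e"
proof -
  let ?W = "{u. \<exists>v \<in> convex hull ((\<lambda>y. f y + g y) ` S). norm (u + c - v) \<le> e}"
  have "convex hull (f ` S) \<subseteq> ?W"
  proof (rule hull_minimal)
    show "f ` S \<subseteq> ?W"
    proof clarify
      fix y assume y: "y \<in> S"
      show "\<exists>v \<in> convex hull ((\<lambda>y. f y + g y) ` S). norm (f y + c - v) \<le> e"
        using close[OF y] y
        by (intro bexI[of _ "f y + g y"]) (auto simp: norm_minus_commute intro: hull_inc)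
    qed
    show "convex ?W"
    proof (rule convexI)
      fix u1 u2 :: 'a and s t :: real
      assume st: "0 \<le> s" "0 \<le> t" "s + t = 1" and "u1 \<in> ?W" "u2 \<in> ?W"
      then obtain v1 v2 where v1: "v1 \<in> convex hull ((\<lambda>y. f y + g y) ` S)" "norm (u1 + c - v1) \<le> e"
        and v2: "v2 \<in> convex hull ((\<lambda>y. f y + g y) ` S)" "norm (u2 + c - v2) \<le> e" by blast
      let ?v = "s *\<^sub>R v1 + t *\<^sub>R v2"
      have "?v \<in> convex hull ((\<lambda>y. f y + g y) ` S)"
        using v1(1) v2(1) st by (intro convexD[OF convex_convex_hull])
      moreover have "(s *\<^sub>R u1 + t *\<^sub>R u2) + c - ?v = s *\<^sub>R (u1 + c - v1) + t *\<^sub>R (u2 + c - v2)"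
        using st(3) by (simp add: algebra_simps scaleR_add_left[symmetric])
      then have "norm ((s *\<^sub>R u1 + t *\<^sub>R u2) + c - ?v) \<le> s * e + t * e"
        using st v1(2) v2(2) by (auto intro!: norm_triangle_le add_mono mult_left_mono)
      then have "norm ((s *\<^sub>R u1 + t *\<^sub>R u2) + c - ?v) \<le> e"
        using st(3) by (simp add: distrib_right[symmetric])
      ultimately show "s *\<^sub>R u1 + t *\<^sub>R u2 \<in> ?W" by blast
    qed
  qed
  then show ?thesis using u by blast
qed

text \<open>On a small ball \<open>g\<close> is nearly the constant \<open>g x\<close>, so it can be taken inside the convex hull.\<close>

lemma krasovskii_add_continuous:
  fixes f g :: "'a::euclidean_space \<Rightarrow> 'a"
  assumes g: "isCont g x" and u: "u \<in> krasovskii f x"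
  shows "u + g x \<in> krasovskii (\<lambda>y. f y + g y) x"
  unfolding krasovskii_def
proof (rule INT_I)
  fix d :: real assume "d \<in> {0<..}"
  then have d: "d > 0" by simp
  show "u + g x \<in> closure (convex hull ((\<lambda>y. f y + g y) ` ball x d))"
    unfolding closure_approachable
  proof (intro allI impI)
    fix e :: real assume e: "e > 0"
    obtain d' where d': "d' > 0" "\<And>y. dist y x < d' \<Longrightarrow> dist (g y) (g x) < e / 2"
      using g e unfolding continuous_at_eps_delta by (meson half_gt_zero)
    define r where "r = min d d'"
    have "r > 0" using d d' by (simp add: r_def)
    then have "u \<in> closure (convex hull (f ` ball x r))" using u unfolding krasovskii_def by blast
    then obtain w where w: "w \<in> convex hull (f ` ball x r)" "dist w u < e / 2"
      unfolding closure_approachable using e by (meson half_gt_zero)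
    have "\<exists>v \<in> convex hull ((\<lambda>y. f y + g y) ` ball x r). norm (w + g x - v) \<le> e / 2"
    proof (rule convex_hull_add_close[OF _ w(1)])
      fix y assume "y \<in> ball x r"
      then show "norm (g y - g x) \<le> e / 2" using d'(2)[of y] by (simp add: r_def dist_norm norm_minus_commute)
    qed
    then obtain v where v: "v \<in> convex hull ((\<lambda>y. f y + g y) ` ball x r)" "norm (w + g x - v) \<le> e / 2" by blast
    have "v \<in> convex hull ((\<lambda>y. f y + g y) ` ball x d)"
      using v(1) hull_mono[OF image_mono[OF subset_ball, of r d]] unfolding r_def by fastforce
    moreover have "dist v (u + g x) < e"
    proof -
      have "v - (u + g x) = (w - u) - (w + g x - v)" by simp
      then have "norm (v - (u + g x)) \<le> norm (w - u) + norm (w + g x - v)" by (metis norm_triangle_ineq4)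
      then show ?thesis using w(2) v(2) by (simp add: dist_norm)
    qed
    ultimately show "\<exists>y\<in>convex hull (\<lambda>y. f y + g y) ` ball x d. dist y (u + g x) < e" by blast
  qed
qed

lemma hull_image_bounded:
  assumes f: "locally_bounded f" and S: "bounded S"
  obtains K where "K \<ge> 0" "\<And>v. v \<in> hull_image f S \<Longrightarrow> norm v \<le> K"
proof -
  have "bounded (hull_image f S)"
    using locally_bounded_imp_bounded_image[OF f S] by (intro bounded_closure bounded_convex_hull)
  then show ?thesis using that unfolding bounded_pos by (metis less_le)
qed

lemma krasovskii_bounded_along:
  fixes x w :: "nat \<Rightarrow> 'a::euclidean_space"
  assumes f: "locally_bounded f" and bd: "bounded (range x)" and w: "\<And>i. w i \<in> krasovskii f (x i)"
  shows "bounded (range w)"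
proof -
  obtain R where R: "range x \<subseteq> ball 0 R" using bd bounded_subset_ballD by blast
  obtain K where K: "\<And>v. v \<in> hull_image f (ball 0 R) \<Longrightarrow> norm v \<le> K"
    by (rule hull_image_bounded[OF f bounded_ball[of 0 R]]) (rule that)
  have "w i \<in> hull_image f (ball 0 R)" for i
  proof (rule subsetD[OF krasovskii_subset_hull_image w])
    show "x i \<in> ball 0 R" using R by blast
  qed simp
  then have "norm (w i) \<le> K" for i by (rule K)
  then show ?thesis unfolding bounded_iff by auto
qed

section \<open>Locally uniform convergence of curves\<close>

lemma converges_locally_uniformly_pointwise:
  "converges_locally_uniformly F y \<Longrightarrow> (\<lambda>k. F k t) \<longlonglongrightarrow> y t"
  by (rule tendsto_uniform_limitI[where S="{-\<bar>t\<bar>..\<bar>t\<bar>}"]) (auto simp: converges_locally_uniformly_def)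

lemma converges_locally_uniformly_eventually:
  assumes "converges_locally_uniformly F y" "e > 0"
  shows "eventually (\<lambda>k. \<forall>t\<in>{-T..T}. dist (F k t) (y t) < e) sequentially"
  using assms(1) uniform_limitD[OF _ assms(2)] unfolding converges_locally_uniformly_def by blast

lemma converges_locally_uniformly_continuous:
  fixes y :: "real \<Rightarrow> 'a::metric_space"
  assumes Z: "\<And>k. continuous_on UNIV (Z k)" and lim: "converges_locally_uniformly Z y"
  shows "continuous_on UNIV y"
proof -
  have "continuous_on {-r..r} y" for r
  proof (rule uniform_limit_theorem[of _ Z sequentially])
    show "\<forall>\<^sub>F k in sequentially. continuous_on {-r..r} (Z k)"
      using Z by (meson always_eventually continuous_on_subset subset_UNIV)
  qed (use lim in \<open>auto simp: converges_locally_uniformly_def\<close>)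
  then have "continuous_on {-(\<bar>t\<bar>+1)<..<\<bar>t\<bar>+1} y" for t
    by (rule continuous_on_subset[of "{-(\<bar>t\<bar>+1)..\<bar>t\<bar>+1}"]) auto
  then have "isCont y t" for t
    by (rule continuous_on_interior[of "{-(\<bar>t\<bar>+1)<..<\<bar>t\<bar>+1}"]) (auto simp: interior_open)
  then show ?thesis by (simp add: continuous_at_imp_continuous_on)
qed

lemma converges_locally_uniformly_eventually_subset:
  fixes y :: "real \<Rightarrow> 'a::heine_borel"
  assumes cy: "continuous_on UNIV y" and lim: "converges_locally_uniformly Z y"
    and U: "open U" "y ` {s..t} \<subseteq> U"
  shows "eventually (\<lambda>k. Z k ` {s..t} \<subseteq> U) sequentially"
proof -
  have "compact (y ` {s..t})" using cy by (intro compact_continuous_image) (auto intro: continuous_on_subset)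
  then obtain e where e: "e > 0" "(\<Union>x\<in>y ` {s..t}. ball x e) \<subseteq> U"
    using compact_subset_open_imp_ball_epsilon_subset[OF _ U] by blast
  have "uniform_limit {s..t} Z y sequentially"
    by (rule uniform_limit_on_subset[where J="{-max \<bar>s\<bar> \<bar>t\<bar>..max \<bar>s\<bar> \<bar>t\<bar>}"])
      (use lim in \<open>auto simp: converges_locally_uniformly_def\<close>)
  then have "eventually (\<lambda>k. \<forall>r\<in>{s..t}. dist (Z k r) (y r) < e) sequentially"
    using e(1) uniform_limitD by blast
  then show ?thesis
  proof eventually_elim
    case (elim k)
    then have "Z k r \<in> (\<Union>x\<in>y ` {s..t}. ball x e)" if "r \<in> {s..t}" for r
      using that by (metis UN_I dist_commute imageI mem_ball)
    then show ?case using e(2) by blast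
  qed
qed

text \<open>On a bounded interval finitely many rationals control all times, by equicontinuity.\<close>

lemma equicontinuous_pointwise_convergent_imp_locally_uniform:
  fixes F :: "nat \<Rightarrow> real \<Rightarrow> 'a::complete_space"
  assumes equi: "\<And>e. e > 0 \<Longrightarrow> \<exists>d>0. \<forall>n s t. dist s t < d \<longrightarrow> dist (F n s) (F n t) < e"
    and conv: "\<And>q. q \<in> \<rat> \<Longrightarrow> convergent (\<lambda>n. F n q)"
  shows "converges_locally_uniformly F (\<lambda>t. lim (\<lambda>n. F n t))"
  unfolding converges_locally_uniformly_def
proof
  fix r :: real
  have "uniformly_Cauchy_on {-r..r} F"
    unfolding uniformly_Cauchy_on_def
  proof (intro allI impI)
    fix e :: real assume "e > 0"
    then have e: "e / 3 > 0" by simp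
    obtain d where d: "d > 0" "\<And>n s t. dist s t < d \<Longrightarrow> dist (F n s) (F n t) < e / 3"
      using equi[OF e] by blast
    have "{-r..r} \<subseteq> (\<Union>q\<in>\<rat>. ball q d)"
    proof
      fix t :: real
      obtain q where "q \<in> \<rat>" "t < q" "q < t + d" using Rats_dense_in_real[of t "t + d"] d(1) by auto
      then show "t \<in> (\<Union>q\<in>\<rat>. ball q d)" by (auto intro!: bexI[of _ q] simp: dist_real_def)
    qed
    then obtain N where N: "N \<subseteq> \<rat>" "finite N" "{-r..r} \<subseteq> (\<Union>q\<in>N. ball q d)"
      using compactE_image[of "{-r..r}" \<rat> "\<lambda>q. ball q d"] by auto
    have "\<exists>M. \<forall>m\<ge>M. \<forall>n\<ge>M. dist (F m q) (F n q) < e / 3" if "q \<in> N" for q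
      using convergent_Cauchy[OF conv[of q]] that N(1) e unfolding Cauchy_def by (meson subsetD)
    then obtain M where M: "\<And>q m n. q \<in> N \<Longrightarrow> m \<ge> M q \<Longrightarrow> n \<ge> M q \<Longrightarrow> dist (F m q) (F n q) < e / 3"
      by metis
    show "\<exists>K. \<forall>x\<in>{-r..r}. \<forall>m\<ge>K. \<forall>n\<ge>K. dist (F m x) (F n x) < e"
    proof (intro exI[of _ "Max (insert 0 (M ` N))"] ballI allI impI)
      fix t m n assume t: "t \<in> {-r..r}" and mn: "Max (insert 0 (M ` N)) \<le> m" "Max (insert 0 (M ` N)) \<le> n"
      obtain q where q: "q \<in> N" "dist q t < d" using N(3) t by auto
      have "M q \<le> Max (insert 0 (M ` N))" using q N(2) by (intro Max_ge) auto
      then have "dist (F m q) (F n q) < e / 3" using mn by (intro M[OF q(1)]) linarith+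
      moreover have "dist (F m q) (F m t) < e / 3" "dist (F n q) (F n t) < e / 3" using d(2) q(2) by auto
      ultimately show "dist (F m t) (F n t) < e"
        using dist_triangle[of "F m t" "F n t" "F m q"] dist_triangle[of "F m q" "F n t" "F n q"]
          dist_commute[of "F m q" "F m t"] by linarith
    qed
  qed
  then have "uniformly_convergent_on {-r..r} F" by (rule Cauchy_uniformly_convergent)
  then show "uniform_limit {-r..r} F (\<lambda>t. lim (\<lambda>n. F n t)) sequentially"
    by (simp add: uniformly_convergent_uniform_limit_iff)
qed

text \<open>The theorem of Arzela and Ascoli on the whole line.\<close>

lemma locally_uniform_subsequence:
  fixes F :: "nat \<Rightarrow> real \<Rightarrow> 'a::euclidean_space"
  assumes equi: "\<And>e. e > 0 \<Longrightarrow> \<exists>d>0. \<forall>n s t. dist s t < d \<longrightarrow> dist (F n s) (F n t) < e"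
    and bd: "\<And>n t. norm (F n t) \<le> C"
  obtains r y where "strict_mono (r :: nat \<Rightarrow> nat)" "converges_locally_uniformly (\<lambda>k. F (r k)) y"
proof -
  obtain r where r: "strict_mono (r :: nat \<Rightarrow> nat)" "\<And>q. q \<in> \<rat> \<Longrightarrow> \<exists>l. (\<lambda>n. F (r n) q) \<longlonglongrightarrow> l"
    using function_convergent_subsequence[of "\<rat>" F C] bd countable_rat by metis
  have "converges_locally_uniformly (\<lambda>k. F (r k)) (\<lambda>t. lim (\<lambda>n. F (r n) t))"
  proof (rule equicontinuous_pointwise_convergent_imp_locally_uniform)
    fix e :: real assume "e > 0"
    then show "\<exists>d>0. \<forall>n s t. dist s t < d \<longrightarrow> dist (F (r n) s) (F (r n) t) < e" using equi by meson
  qed (use r(2) in \<open>auto simp: convergent_def\<close>)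
  then show ?thesis using r(1) that by blast
qed

section \<open>Differential inclusions in integrated form\<close>

text \<open>The inclusion \<open>y' \<in> krasovskii f y\<close> in integrated form: while a solution stays in an open set \<open>U\<close>, its
  derivatives lie in the closed convex set \<open>hull_image f U\<close>, and hence so do their averages.\<close>

definition mean_value_path :: "('a::euclidean_space \<Rightarrow> 'a) \<Rightarrow> (real \<Rightarrow> 'a) \<Rightarrow> bool" where
  "mean_value_path f y \<longleftrightarrow> continuous_on UNIV y \<and>
    (\<forall>s t U. s < t \<longrightarrow> open U \<longrightarrow> y ` {s..t} \<subseteq> U \<longrightarrow> (y t - y s) /\<^sub>R (t - s) \<in> hull_image f U)"

lemma mean_value_path_lipschitz:
  assumes f: "locally_bounded f" and y: "mean_value_path f y" and b: "bounded (range y)"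
  obtains K where "K-lipschitz_on UNIV y"
proof -
  obtain R where R: "range y \<subseteq> ball 0 R" using b bounded_subset_ballD by blast
  obtain K where K: "K \<ge> 0" "\<And>v. v \<in> hull_image f (ball 0 R) \<Longrightarrow> norm v \<le> K"
    by (rule hull_image_bounded[OF f bounded_ball[of 0 R]]) blast
  have le: "norm (y t - y s) \<le> K * (t - s)" if "s < t" for s t
  proof -
    have "norm ((y t - y s) /\<^sub>R (t - s)) \<le> K"
    proof (rule K(2))
      have "y ` {s..t} \<subseteq> ball 0 R" using R by blast
      then show "(y t - y s) /\<^sub>R (t - s) \<in> hull_image f (ball 0 R)"
        using y that unfolding mean_value_path_def by blast
    qed
    then show ?thesis using that unfolding norm_scaleR by (simp add: field_simps)
  qed
  have "K-lipschitz_on UNIV y"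
  proof (rule lipschitz_onI)
    fix s t
    show "dist (y s) (y t) \<le> K * dist s t"
      using le[of s t] le[of t s] by (cases s t rule: linorder_cases) (auto simp: dist_norm norm_minus_commute)
  qed (rule K(1))
  then show ?thesis by (rule that)
qed

lemma lipschitz_imp_absolutely_continuous:
  fixes y :: "real \<Rightarrow> 'a::metric_space"
  assumes "K-lipschitz_on UNIV y"
  shows "absolutely_continuous_on S y"
  unfolding absolutely_continuous_on_def
proof (intro allI impI)
  fix e :: real assume e: "e > 0"
  have K: "K \<ge> 0" by (rule lipschitz_on_nonneg[OF assms])
  show "\<exists>d>0. \<forall>(n::nat) u v. (\<forall>i<n. u i \<le> v i \<and> {u i..v i} \<subseteq> S) \<longrightarrow>
       disjoint_family_on (\<lambda>i. {u i<..<v i}) {..<n} \<longrightarrow>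
       (\<Sum>i<n. v i - u i) < d \<longrightarrow> (\<Sum>i<n. dist (y (u i)) (y (v i))) < e"
  proof (intro exI[of _ "e / (K + 1)"] conjI allI impI)
    show "e / (K + 1) > 0" using e K by simp
    fix n :: nat and u v :: "nat \<Rightarrow> real"
    assume uv: "\<forall>i<n. u i \<le> v i \<and> {u i..v i} \<subseteq> S" and sum: "(\<Sum>i<n. v i - u i) < e / (K + 1)"
    have "(\<Sum>i<n. dist (y (u i)) (y (v i))) \<le> (\<Sum>i<n. (K + 1) * (v i - u i))"
    proof (rule sum_mono)
      fix i assume "i \<in> {..<n}"
      then have "u i \<le> v i" using uv by auto
      then show "dist (y (u i)) (y (v i)) \<le> (K + 1) * (v i - u i)"
        using lipschitz_onD[OF assms, of "u i" "v i"] by (auto simp: dist_real_def algebra_simps)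
    qed
    also have "\<dots> = (K + 1) * (\<Sum>i<n. v i - u i)" by (simp add: sum_distrib_left)
    also have "\<dots> < e" using sum K by (simp add: field_simps)
    finally show "(\<Sum>i<n. dist (y (u i)) (y (v i))) < e" .
  qed
qed

text \<open>The difference quotients over \<open>[s, t]\<close> for \<open>t\<close> close to \<open>s\<close> lie in the closed set \<open>hull_image f (ball (y s) \<delta>)\<close>.\<close>

lemma mean_value_path_derivative:
  assumes y: "mean_value_path f y" and d: "(y has_vector_derivative v) (at s)"
  shows "v \<in> krasovskii f (y s)"
  unfolding krasovskii_def
proof (rule INT_I)
  fix \<delta> :: real assume "\<delta> \<in> {0<..}"
  then have \<delta>: "\<delta> > 0" by simp
  have "isCont y s" using y by (simp add: mean_value_path_def continuous_on_eq_continuous_at)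
  then obtain r where r: "r > 0" "\<And>t. dist t s < r \<Longrightarrow> dist (y t) (y s) < \<delta>"
    unfolding continuous_at_eps_delta using \<delta> by blast
  have "((\<lambda>t. (y t - y s) /\<^sub>R (t - s)) \<longlongrightarrow> v) (at_right s)"
  proof -
    have "(y has_vector_derivative v) (at s within {s<..})" using d has_vector_derivative_at_within by blast
    then have "((\<lambda>t. (y t - (y s + (t - s) *\<^sub>R v)) /\<^sub>R norm (t - s)) \<longlongrightarrow> 0) (at_right s)"
      by (simp add: has_vector_derivative_def has_derivative_within divide_inverse)
    then have "((\<lambda>t. (y t - (y s + (t - s) *\<^sub>R v)) /\<^sub>R norm (t - s) + v) \<longlongrightarrow> 0 + v) (at_right s)"
      by (intro tendsto_intros)
    moreover have "eventually (\<lambda>t. (y t - (y s + (t - s) *\<^sub>R v)) /\<^sub>R norm (t - s) + v = (y t - y s) /\<^sub>R (t - s)) (at_right s)"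
      unfolding eventually_at_right_field
    proof (intro exI[of _ "s + 1"] conjI allI impI)
      fix t assume "s < t"
      then show "(y t - (y s + (t - s) *\<^sub>R v)) /\<^sub>R norm (t - s) + v = (y t - y s) /\<^sub>R (t - s)"
        unfolding diff_diff_eq[symmetric] scaleR_diff_right[of _ "y t - y s"] by simp
    qed simp
    ultimately show ?thesis by (simp add: tendsto_cong)
  qed
  moreover have "eventually (\<lambda>t. (y t - y s) /\<^sub>R (t - s) \<in> hull_image f (ball (y s) \<delta>)) (at_right s)"
    unfolding eventually_at_right_field
  proof (intro exI[of _ "s + r"] conjI allI impI)
    fix t assume t: "s < t" "t < s + r"
    have "y ` {s..t} \<subseteq> ball (y s) \<delta>" using r(2) t by (force simp: dist_real_def dist_commute)
    then show "(y t - y s) /\<^sub>R (t - s) \<in> hull_image f (ball (y s) \<delta>)"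
      using y t unfolding mean_value_path_def by blast
  qed (use r in simp)
  ultimately show "v \<in> hull_image f (ball (y s) \<delta>)"
    by (intro Lim_in_closed_set[of "hull_image f (ball (y s) \<delta>)" _ "at_right s"]) auto
qed

lemma mean_value_path_solution:
  assumes f: "locally_bounded f" and y: "mean_value_path f y" and b: "bounded (range y)"
  shows "solution_on (krasovskii f) I y"
proof -
  obtain K where K: "K-lipschitz_on UNIV y" using mean_value_path_lipschitz[OF assms] .
  have "AE t in lborel. t \<in> I \<longrightarrow> (\<exists>v\<in>krasovskii f (y t). (y has_vector_derivative v) (at t within I))"
    using lipschitz_differentiable_AE[OF K]
  proof eventually_elim
    case (elim t)
    then have "(y has_vector_derivative vector_derivative y (at t)) (at t)" using vector_derivative_works by blast
    then show ?case using mean_value_path_derivative[OF y] has_vector_derivative_at_within by blast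
  qed
  then show ?thesis
    unfolding solution_on_def using lipschitz_imp_absolutely_continuous[OF K] by blast
qed

text \<open>If the limit stays in the open set \<open>U\<close> during \<open>[s, t]\<close>, so do the approximating paths from some index on.\<close>

lemma mean_value_path_limit:
  fixes y :: "real \<Rightarrow> 'a::euclidean_space"
  assumes Z: "\<And>k. mean_value_path f (Z k)" and lim: "converges_locally_uniformly Z y"
  shows "mean_value_path f y"
  unfolding mean_value_path_def
proof (intro conjI allI impI)
  show cy: "continuous_on UNIV y"
    by (rule converges_locally_uniformly_continuous[OF _ lim]) (use Z in \<open>simp add: mean_value_path_def\<close>)
  fix s t :: real and U assume st: "s < t" and U: "open U" "y ` {s..t} \<subseteq> U"
  from converges_locally_uniformly_eventually_subset[OF cy lim U]
  have "eventually (\<lambda>k. (Z k t - Z k s) /\<^sub>R (t - s) \<in> hull_image f U) sequentially"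
  proof eventually_elim
    case (elim k)
    then show ?case using Z[of k] st U(1) unfolding mean_value_path_def by blast
  qed
  moreover have "(\<lambda>k. (Z k t - Z k s) /\<^sub>R (t - s)) \<longlonglongrightarrow> (y t - y s) /\<^sub>R (t - s)"
    by (intro tendsto_intros converges_locally_uniformly_pointwise[OF lim])
  ultimately show "(y t - y s) /\<^sub>R (t - s) \<in> hull_image f U"
    by (intro Lim_in_closed_set[of "hull_image f U" _ sequentially]) auto
qed

lemma mean_value_path_shift:
  assumes y: "mean_value_path f y"
  shows "mean_value_path f (\<lambda>t. y (c + t))"
  unfolding mean_value_path_def
proof (intro conjI allI impI)
  show "continuous_on UNIV (\<lambda>t. y (c + t))"
    using y unfolding mean_value_path_def
    by (auto intro!: continuous_on_compose2[of UNIV y UNIV "\<lambda>t. c + t"] continuous_on_add continuous_on_const continuous_on_id)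
  fix s t :: real and U assume st: "s < t" and U: "open U" "(\<lambda>t. y (c + t)) ` {s..t} \<subseteq> U"
  have "{c + s..c + t} = (+) c ` {s..t}" by simp
  then have "y ` {c + s..c + t} \<subseteq> U" using U(2) by (simp only: image_image)
  moreover have "c + s < c + t" using st by simp
  ultimately have "(y (c + t) - y (c + s)) /\<^sub>R ((c + t) - (c + s)) \<in> hull_image f U"
    using y U(1) unfolding mean_value_path_def by blast
  then show "(y (c + t) - y (c + s)) /\<^sub>R (t - s) \<in> hull_image f U" by simp
qed

section \<open>Limit sets of asymptotic solutions\<close>

text \<open>The common property of the interpolated iterates and of their limits from which all statements
  about the long-term behaviour are derived.\<close>

definition asymptotic_solution :: "('a::euclidean_space \<Rightarrow> 'a) \<Rightarrow> (real \<Rightarrow> 'a) \<Rightarrow> bool" where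
  "asymptotic_solution f Z \<longleftrightarrow> bounded (range Z) \<and> uniformly_continuous_on UNIV Z \<and>
    (\<forall>s y. filterlim s at_top sequentially \<longrightarrow>
       converges_locally_uniformly (\<lambda>k t. Z (s k + t)) y \<longrightarrow> mean_value_path f y)"

lemma limit_set_seqI:
  assumes s: "filterlim s at_top sequentially" and lim: "(\<lambda>k. Z (s k)) \<longlonglongrightarrow> p"
  shows "p \<in> limit_set Z"
  unfolding limit_set_def
proof (rule INT_I)
  fix t :: real
  have "eventually (\<lambda>k. t \<le> s k) sequentially" using s by (simp add: filterlim_at_top)
  then have "eventually (\<lambda>k. Z (s k) \<in> closure (Z ` {t..})) sequentially"
    by eventually_elim (intro subsetD[OF closure_subset] imageI, simp)
  then show "p \<in> closure (Z ` {t..})"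
    using lim by (intro Lim_in_closed_set[of _ _ sequentially]) auto
qed

lemma asymptotic_solution_subsequence:
  assumes Z: "asymptotic_solution f Z" and s: "filterlim s at_top sequentially"
  obtains r y where "strict_mono (r :: nat \<Rightarrow> nat)"
    "converges_locally_uniformly (\<lambda>k t. Z (s (r k) + t)) y" "mean_value_path f y" 
    "bounded (range y)" "range y \<subseteq> limit_set Z"
proof -
  obtain C where C: "\<And>t. norm (Z t) \<le> C"
    using Z unfolding asymptotic_solution_def bounded_iff by auto
  have "\<exists>d>0. \<forall>n u v. dist u v < d \<longrightarrow> dist (Z (s n + u)) (Z (s n + v)) < e" if e: "e > 0" for e
  proof -
    obtain d where "d > 0" "\<And>u v. dist u v < d \<Longrightarrow> dist (Z u) (Z v) < e"
      using Z e unfolding asymptotic_solution_def uniformly_continuous_on_def by (metis UNIV_I)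
    then show ?thesis by (intro exI[of _ d]) (auto simp: dist_real_def)
  qed
  then obtain r y where r: "strict_mono (r :: nat \<Rightarrow> nat)" and y: "converges_locally_uniformly (\<lambda>k t. Z (s (r k) + t)) y"
    using locally_uniform_subsequence[of "\<lambda>n t. Z (s n + t)" C] C by blast
  have sr: "filterlim (\<lambda>k. s (r k)) at_top sequentially"
    using filterlim_compose[OF s filterlim_subseq[OF r]] .
  have "mean_value_path f y" using Z sr y unfolding asymptotic_solution_def by blast
  moreover have pw: "(\<lambda>k. Z (s (r k) + t)) \<longlonglongrightarrow> y t" for t
    using converges_locally_uniformly_pointwise[OF y] .
  have "norm (y t) \<le> C" for t
    by (rule tendsto_upperbound[OF tendsto_norm[OF pw[of t]]]) (use C in auto)
  then have "bounded (range y)" unfolding bounded_iff by auto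
  moreover have "range y \<subseteq> limit_set Z"
  proof clarify
    fix u
    have "filterlim (\<lambda>k. s (r k) + u) at_top sequentially"
      using filterlim_tendsto_add_at_top[OF tendsto_const sr] by (simp add: add.commute)
    then show "y u \<in> limit_set Z" using pw by (rule limit_set_seqI)
  qed
  ultimately show ?thesis using that r y by blast
qed

lemma mean_value_path_asymptotic_solution:
  assumes f: "locally_bounded f" and y: "mean_value_path f y" and b: "bounded (range y)"
  shows "asymptotic_solution f y"
proof -
  obtain K where "K-lipschitz_on UNIV y" using mean_value_path_lipschitz[OF assms] .
  then have "uniformly_continuous_on UNIV y" by (rule lipschitz_on_uniformly_continuous)
  then show ?thesis
    unfolding asymptotic_solution_def using b mean_value_path_limit[OF mean_value_path_shift[OF y]] by auto
qed

lemma limit_set_visited: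
  assumes "p \<in> limit_set Z" "e > 0"
  obtains s where "s \<ge> S" "dist (Z s) p < e"
proof -
  have "p \<in> closure (Z ` {max 0 S..})" using assms(1) by (auto simp: limit_set_def)
  then obtain s where "s \<ge> max 0 S" "dist (Z s) p < e"
    using assms(2) unfolding closure_approachable by auto
  then show ?thesis using that[of s] by simp
qed

text \<open>Otherwise there are arbitrarily late times at which no path in the limit set is followed, but a
  subsequence of the translates by these times converges to such a path.\<close>

lemma limit_set_tracking:
  assumes Z: "asymptotic_solution f Z" and e: "e > 0"
  obtains S where "\<And>s. s \<ge> S \<Longrightarrow> \<exists>y. mean_value_path f y \<and> bounded (range y) \<and> range y \<subseteq> limit_set Z \<and>
    (\<forall>t\<in>{0..T}. dist (Z (s + t)) (y t) < e)"
proof -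
  define P where "P s y \<longleftrightarrow> mean_value_path f y \<and> bounded (range y) \<and> range y \<subseteq> limit_set Z \<and>
    (\<forall>t\<in>{0..T}. dist (Z (s + t)) (y t) < e)" for s y
  have "\<exists>S. \<forall>s\<ge>S. \<exists>y. P s y"
  proof (rule ccontr)
    assume "\<not> (\<exists>S. \<forall>s\<ge>S. \<exists>y. P s y)"
    then have "\<forall>n. \<exists>s\<ge>real n. \<forall>y. \<not> P s y" by blast
    then obtain s where s: "\<And>n. s n \<ge> real n" "\<And>n y. \<not> P (s n) y" by metis
    have "filterlim s at_top sequentially"
      by (rule filterlim_at_top_mono[OF filterlim_real_sequentially]) (use s in auto)
    then obtain r y where y: "strict_mono (r :: nat \<Rightarrow> nat)"
      "converges_locally_uniformly (\<lambda>k t. Z (s (r k) + t)) y" "mean_value_path f y" 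
      "bounded (range y)" "range y \<subseteq> limit_set Z"
      using asymptotic_solution_subsequence[OF Z] by blast
    obtain k where "\<forall>t\<in>{-T..T}. dist (Z (s (r k) + t)) (y t) < e"
      using converges_locally_uniformly_eventually[OF y(2) e, of T] unfolding eventually_sequentially by blast
    then have "P (s (r k)) y" using y unfolding P_def by auto
    then show False using s(2) by blast
  qed
  then show ?thesis using that unfolding P_def by blast
qed

text \<open>The curve is close to \<open>p\<close> at a late time \<open>s0\<close> and close to \<open>q\<close> at a much later time \<open>s1\<close>. The
  interval from \<open>s0\<close> to \<open>s1\<close> is cut into pieces of equal length, and on each piece the curve is replaced by
  a path in the limit set that it follows there.\<close>

lemma limit_set_internally_chain_transitive:
  assumes f: "locally_bounded f" and Z: "asymptotic_solution f Z"
  shows "internally_chain_transitive (krasovskii f) (limit_set Z)"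
  unfolding internally_chain_transitive_def
proof (intro conjI ballI)
  have "limit_set Z \<subseteq> closure (range Z)" unfolding limit_set_def by (metis INF_lower atLeast_iff closure_mono image_mono order_refl subset_UNIV subset_trans)
  then have "bounded (limit_set Z)"
    using Z bounded_subset[OF bounded_closure] unfolding asymptotic_solution_def by blast
  moreover have "closed (limit_set Z)" unfolding limit_set_def by (intro closed_INT) auto
  ultimately show "compact (limit_set Z)" by (simp add: compact_eq_bounded_closed)
  fix p q assume p: "p \<in> limit_set Z" and q: "q \<in> limit_set Z"
  show "chain_connected (krasovskii f) (limit_set Z) p q"
    unfolding chain_connected_def
  proof (intro allI impI)
    fix e T :: real assume e: "e > 0" and T: "T > 0"
    define T1 where "T1 = T + 1"
    obtain S where S: "\<And>s. s \<ge> S \<Longrightarrow> \<exists>y. mean_value_path f y \<and> bounded (range y) \<and> range y \<subseteq> limit_set Z \<and>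
      (\<forall>t\<in>{0..2 * T1}. dist (Z (s + t)) (y t) < e / 2)"
      using limit_set_tracking[OF Z, of "e / 2" "2 * T1"] e by auto
    obtain s0 where s0: "s0 \<ge> S" "dist (Z s0) p < e / 2" using limit_set_visited[OF p, of "e/2" S] e by auto
    obtain s1 where s1: "s1 \<ge> s0 + T1" "dist (Z s1) q < e / 2" using limit_set_visited[OF q, of "e/2" "s0 + T1"] e by auto
    \<comment> \<open>rounding down makes each piece at least \<open>T1\<close> long, and at most \<open>2 * T1\<close> since \<open>n\<close> is at least 1\<close>
  define n where "n = nat \<lfloor>(s1 - s0) / T1\<rfloor>"
    define \<tau> where "\<tau> = (s1 - s0) / real n"
    have T1: "T1 > 0" "T1 > T" using T by (auto simp: T1_def)
    have D: "(s1 - s0) / T1 \<ge> 1" using s1(1) T1 by (simp add: field_simps)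
    then have fl: "\<lfloor>(s1 - s0) / T1\<rfloor> \<ge> 1" by simp
    then have n1: "n \<ge> 1" unfolding n_def by linarith
    have rn: "real n \<le> (s1 - s0) / T1" "(s1 - s0) / T1 < real n + 1"
      using fl unfolding n_def by linarith+
    have \<tau>1: "\<tau> \<ge> T1" using rn(1) n1 T1 unfolding \<tau>_def by (simp add: field_simps)
    have "s1 - s0 < (real n + 1) * T1" using rn(2) T1 by (simp add: field_simps)
    also have "\<dots> \<le> (2 * real n) * T1" using n1 T1 by (intro mult_right_mono) auto
    finally have \<tau>2: "\<tau> \<le> 2 * T1" using n1 unfolding \<tau>_def by (simp add: field_simps)
    define u where "u i = s0 + (real i - 1) * \<tau>" for i :: nat
    have "u i \<ge> S" if "i \<ge> 1" for i using that s0(1) \<tau>1 T1 unfolding u_def by (simp add: add_increasing2)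
    then have "\<forall>i. \<exists>y. i \<ge> 1 \<longrightarrow> mean_value_path f y \<and> bounded (range y) \<and> range y \<subseteq> limit_set Z \<and>
      (\<forall>t\<in>{0..2 * T1}. dist (Z (u i + t)) (y t) < e / 2)"
      using S by blast
    then obtain Y where Y: "\<And>i. i \<ge> 1 \<Longrightarrow> mean_value_path f (Y i) \<and> bounded (range (Y i)) \<and> range (Y i) \<subseteq> limit_set Z \<and>
      (\<forall>t\<in>{0..2 * T1}. dist (Z (u i + t)) (Y i t) < e / 2)" by metis
    have start: "dist (Z (u i)) (Y i 0) < e / 2" if "i \<ge> 1" for i
    proof -
      have "dist (Z (u i + 0)) (Y i 0) < e / 2" using Y[OF that] T1 by (metis atLeastAtMost_iff less_eq_real_def mult_pos_pos order_refl zero_less_numeral)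
      then show ?thesis by simp
    qed
    have fin: "dist (Z (u (Suc i))) (Y i \<tau>) < e / 2" if "i \<ge> 1" for i
    proof -
      have "\<tau> \<in> {0..2 * T1}" using \<tau>1 \<tau>2 T1 by auto
      then have "dist (Z (u i + \<tau>)) (Y i \<tau>) < e / 2" using Y[OF that] by blast
      moreover have "u i + \<tau> = u (Suc i)" by (simp add: u_def algebra_simps)
      ultimately show ?thesis by simp
    qed
    have u1: "u 1 = s0" by (simp add: u_def)
    have un: "u (Suc n) = s1" using n1 by (simp add: u_def \<tau>_def)
    show "solution_chain (krasovskii f) (limit_set Z) e T p q"
      unfolding solution_chain_def
    proof (intro exI[of _ n] exI[of _ Y] exI[of _ "\<lambda>_. \<tau>"] conjI ballI)
      show "n \<ge> 1" by (rule n1)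
      show "norm (Y 1 0 - p) \<le> e"
        using start[of 1] s0(2) dist_triangle[of "Y 1 0" p "Z s0"] unfolding u1 by (simp add: dist_norm[symmetric] dist_commute)
      show "norm (Y n \<tau> - q) \<le> e"
        using fin[OF n1] s1(2) dist_triangle[of "Y n \<tau>" q "Z s1"] unfolding un by (simp add: dist_norm[symmetric] dist_commute)
    next
      fix i assume "i \<in> {1..n}"
      then have i: "i \<ge> 1" by simp
      show "solution_on (krasovskii f) {0..} (Y i)"
        using Y[OF i] mean_value_path_solution[OF f] by blast
      show "\<tau> > T" using \<tau>1 T1 by simp
      fix t show "Y i t \<in> limit_set Z" using Y[OF i] by blast
    next
      fix i assume "i \<in> {1..<n}"
      then have i: "i \<ge> 1" by simp
      show "norm (Y i \<tau> - Y (Suc i) 0) \<le> e"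
        using fin[OF i] start[of "Suc i"] dist_triangle[of "Y i \<tau>" "Y (Suc i) 0" "Z (u (Suc i))"]
        by (simp add: dist_norm[symmetric] dist_commute)
    qed
  qed
qed

lemma solution_chain_mono:
  "solution_chain F A e T x y \<Longrightarrow> A \<subseteq> B \<Longrightarrow> solution_chain F B e T x y"
  unfolding solution_chain_def by (elim exE) (intro exI, auto)

lemma limit_set_chain_recurrent:
  assumes f: "locally_bounded f" and Z: "asymptotic_solution f Z"
  shows "limit_set Z \<subseteq> chain_recurrent_points (krasovskii f)"
proof
  fix p assume p: "p \<in> limit_set Z"
  have "solution_chain (krasovskii f) UNIV e T p p" if "e > 0" "T > 0" for e T
  proof (rule solution_chain_mono[OF _ subset_UNIV])
    show "solution_chain (krasovskii f) (limit_set Z) e T p p"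
      using limit_set_internally_chain_transitive[OF assms] p that
      unfolding internally_chain_transitive_def chain_connected_def by simp
  qed
  then show "p \<in> chain_recurrent_points (krasovskii f)" by (simp add: chain_recurrent_points_def)
qed

section \<open>Asymptotic solutions and attractors\<close>

lemma infdist_less_of_dist:
  "infdist y \<Lambda> < a \<Longrightarrow> dist x y < b \<Longrightarrow> infdist x \<Lambda> < a + b"
  using infdist_triangle[of x \<Lambda> y] by linarith

text \<open>From times at which the curve is close to \<open>p\<close> it follows a solution starting at \<open>p\<close>, which converges to \<open>\<Lambda>\<close>.\<close>

lemma asymptotic_solution_approaches_attractor:
  assumes f: "locally_bounded f" and Z: "asymptotic_solution f Z"
    and s: "filterlim s at_top sequentially" and lim: "(\<lambda>k. Z (s k)) \<longlonglongrightarrow> p"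
    and p: "p \<in> domain_of_attraction (krasovskii f) \<Lambda>" and e: "e > 0"
  obtains t where "t \<ge> S" "infdist (Z t) \<Lambda> < e"
proof -
  obtain r y where r: "strict_mono (r :: nat \<Rightarrow> nat)"
    and y: "converges_locally_uniformly (\<lambda>k t. Z (s (r k) + t)) y" "mean_value_path f y" "bounded (range y)"
    using asymptotic_solution_subsequence[OF Z s] by blast
  have "(\<lambda>k. Z (s (r k))) \<longlonglongrightarrow> p" using LIMSEQ_subseq_LIMSEQ[OF lim r] by (simp add: o_def)
  moreover have "(\<lambda>k. Z (s (r k))) \<longlonglongrightarrow> y 0" using converges_locally_uniformly_pointwise[OF y(1), of 0] by simp
  ultimately have "y 0 = p" by (rule LIMSEQ_unique[symmetric])
  then have "converges_to_set y \<Lambda> at_top"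
    using p mean_value_path_solution[OF f y(2,3)] unfolding domain_of_attraction_def by blast
  then have "eventually (\<lambda>t. infdist (y t) \<Lambda> < e / 2) at_top"
    using e unfolding converges_to_set_def by (intro order_tendstoD(2)[of _ 0]) auto
  then obtain t where t: "infdist (y t) \<Lambda> < e / 2" unfolding eventually_at_top_linorder by blast
  have "filterlim (\<lambda>k. s (r k)) at_top sequentially"
    using filterlim_compose[OF s filterlim_subseq[OF r]] .
  then have "eventually (\<lambda>k. S - t \<le> s (r k)) sequentially" by (simp add: filterlim_at_top)
  moreover have "eventually (\<lambda>k. dist (Z (s (r k) + t)) (y t) < e / 2) sequentially"
    using converges_locally_uniformly_pointwise[OF y(1), of t] e by (intro tendstoD) auto
  ultimately have "eventually (\<lambda>k. S - t \<le> s (r k) \<and> dist (Z (s (r k) + t)) (y t) < e / 2) sequentially"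
    by (rule eventually_conj)
  then obtain k where "S - t \<le> s (r k)" "dist (Z (s (r k) + t)) (y t) < e / 2"
    unfolding eventually_sequentially by blast
  then show ?thesis using that[of "s (r k) + t"] infdist_less_of_dist[OF t, of "Z (s (r k) + t)" "e / 2"] by simp
qed

text \<open>If this failed at arbitrarily late times, a limit of translates would be a solution that starts
  within the stability radius. It would remain close to \<open>\<Lambda>\<close> and eventually be closer than \<open>\<delta> / 2\<close>, and the
  translates converging to it would do the same.\<close>

lemma asymptotic_solution_stays_near_attractor:
  assumes f: "locally_bounded f" and Z: "asymptotic_solution f Z"
    and las: "locally_asymptotically_stable (krasovskii f) \<Lambda>" and e: "e > 0"
  obtains S \<delta> where "\<delta> > 0"
    "\<And>s. s \<ge> S \<Longrightarrow> infdist (Z s) \<Lambda> < \<delta> \<Longrightarrow> \<exists>t\<ge>1. infdist (Z (s + t)) \<Lambda> < \<delta> \<and> (\<forall>u\<in>{0..t}. infdist (Z (s + u)) \<Lambda> < e)"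
proof -
  have "e / 2 > 0" using e by simp
  then obtain d1 where d1: "d1 > 0" "\<And>y. solution_on (krasovskii f) {0..} y \<Longrightarrow> infdist (y 0) \<Lambda> < d1 \<Longrightarrow> \<forall>t\<ge>0. infdist (y t) \<Lambda> < e / 2"
    using las unfolding locally_asymptotically_stable_def by metis
  obtain d2 where d2: "d2 > 0" "\<And>y. solution_on (krasovskii f) {0..} y \<Longrightarrow> infdist (y 0) \<Lambda> < d2 \<Longrightarrow> converges_to_set y \<Lambda> at_top"
    using las unfolding locally_asymptotically_stable_def by metis
  \<comment> \<open>strictly below \<open>d1\<close> and \<open>d2\<close>, since in the limit only \<open>infdist (y 0) \<Lambda> \<le> \<delta>\<close> survives\<close>
  define \<delta> where "\<delta> = min d1 d2 / 2"
  have \<delta>: "\<delta> > 0" "\<delta> < d1" "\<delta> < d2" using d1(1) d2(1) by (auto simp: \<delta>_def)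
  define P where "P s \<longleftrightarrow> (\<exists>t\<ge>1. infdist (Z (s + t)) \<Lambda> < \<delta> \<and> (\<forall>u\<in>{0..t}. infdist (Z (s + u)) \<Lambda> < e))" for s
  have "\<exists>S. \<forall>s\<ge>S. infdist (Z s) \<Lambda> < \<delta> \<longrightarrow> P s"
  proof (rule ccontr)
    assume "\<not> (\<exists>S. \<forall>s\<ge>S. infdist (Z s) \<Lambda> < \<delta> \<longrightarrow> P s)"
    then have "\<forall>n. \<exists>s\<ge>real n. infdist (Z s) \<Lambda> < \<delta> \<and> \<not> P s" by blast
    then obtain s where s: "\<And>n. s n \<ge> real n" "\<And>n. infdist (Z (s n)) \<Lambda> < \<delta>" "\<And>n. \<not> P (s n)" by metis
    have "filterlim s at_top sequentially"
      by (rule filterlim_at_top_mono[OF filterlim_real_sequentially]) (use s in auto)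
    then obtain r y where y: "strict_mono (r :: nat \<Rightarrow> nat)"
      "converges_locally_uniformly (\<lambda>k t. Z (s (r k) + t)) y" "mean_value_path f y" "bounded (range y)"
      using asymptotic_solution_subsequence[OF Z] by blast
    have sol: "solution_on (krasovskii f) {0..} y" using mean_value_path_solution[OF f y(3,4)] .
    have "(\<lambda>k. infdist (Z (s (r k) + 0)) \<Lambda>) \<longlonglongrightarrow> infdist (y 0) \<Lambda>"
      by (intro tendsto_infdist converges_locally_uniformly_pointwise[OF y(2)])
    then have "infdist (y 0) \<Lambda> \<le> \<delta>"
      by (rule tendsto_upperbound) (use s(2) in \<open>auto intro: less_imp_le always_eventually\<close>)
    then have near: "\<forall>t\<ge>0. infdist (y t) \<Lambda> < e / 2" and "converges_to_set y \<Lambda> at_top"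
      using d1(2)[OF sol] d2(2)[OF sol] \<delta> by auto
    then have "eventually (\<lambda>t. infdist (y t) \<Lambda> < \<delta> / 2) at_top"
      using \<delta> unfolding converges_to_set_def by (intro order_tendstoD(2)[of _ 0]) auto
    then have "eventually (\<lambda>t. t \<ge> 1 \<and> infdist (y t) \<Lambda> < \<delta> / 2) at_top"
      by (intro eventually_conj eventually_ge_at_top)
    then obtain t where t: "t \<ge> 1" "infdist (y t) \<Lambda> < \<delta> / 2"
      using eventually_happens'[OF trivial_limit_at_top_linorder] by blast
    have "min (e / 2) (\<delta> / 2) > 0" using e \<delta> by simp
    then obtain k where k: "\<forall>u\<in>{-t..t}. dist (Z (s (r k) + u)) (y u) < min (e / 2) (\<delta> / 2)"
      using converges_locally_uniformly_eventually[OF y(2), of _ t] unfolding eventually_sequentially by blast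
    have "infdist (Z (s (r k) + t)) \<Lambda> < \<delta> / 2 + \<delta> / 2"
      by (rule infdist_less_of_dist[OF t(2)]) (use k t in auto)
    moreover have "infdist (Z (s (r k) + u)) \<Lambda> < e / 2 + e / 2" if "u \<in> {0..t}" for u
      by (rule infdist_less_of_dist[of "y u"]) (use k t near that in auto)
    ultimately have "P (s (r k))" using t(1) unfolding P_def by (intro exI[of _ t]) auto
    then show False using s(3) by blast
  qed
  then show ?thesis using that \<delta>(1) unfolding P_def by blast
qed

lemma asymptotic_solution_converges_to_attractor:
  assumes f: "locally_bounded f" and Z: "asymptotic_solution f Z"
    and las: "locally_asymptotically_stable (krasovskii f) \<Lambda>"
    and s: "filterlim s at_top sequentially" and lim: "(\<lambda>k. Z (s k)) \<longlonglongrightarrow> p"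
    and p: "p \<in> domain_of_attraction (krasovskii f) \<Lambda>"
  shows "converges_to_set Z \<Lambda> at_top"
  unfolding converges_to_set_def
proof (rule tendstoI)
  fix e :: real assume e: "e > 0"
  obtain S \<delta> where \<delta>: "\<delta> > 0" and step: "\<And>s. s \<ge> S \<Longrightarrow> infdist (Z s) \<Lambda> < \<delta> \<Longrightarrow>
      \<exists>t\<ge>1. infdist (Z (s + t)) \<Lambda> < \<delta> \<and> (\<forall>u\<in>{0..t}. infdist (Z (s + u)) \<Lambda> < e)"
    by (rule asymptotic_solution_stays_near_attractor[OF f Z las e]) (rule that)
  obtain s0 where s0: "s0 \<ge> S" "infdist (Z s0) \<Lambda> < \<delta>"
    by (rule asymptotic_solution_approaches_attractor[OF f Z s lim p \<delta>]) (rule that)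
  have *: "\<exists>v\<ge>s0 + real n. infdist (Z v) \<Lambda> < \<delta> \<and> (\<forall>u\<in>{s0..<v}. infdist (Z u) \<Lambda> < e)" for n
  proof (induction n)
    case 0 show ?case using s0 by (intro exI[of _ s0]) auto
  next
    case (Suc n)
    then obtain v where v: "v \<ge> s0 + real n" "infdist (Z v) \<Lambda> < \<delta>" "\<forall>u\<in>{s0..<v}. infdist (Z u) \<Lambda> < e" by blast
    then have "v \<ge> S" using s0(1) by simp
    then obtain t where t: "t \<ge> 1" "infdist (Z (v + t)) \<Lambda> < \<delta>" "\<And>u. u \<in> {0..t} \<Longrightarrow> infdist (Z (v + u)) \<Lambda> < e"
      using step v(2) by blast
    have "infdist (Z u) \<Lambda> < e" if "u \<in> {s0..<v + t}" for u
    proof (cases "u < v")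
      case True then show ?thesis using v(3) that by auto
    next
      case False then show ?thesis using t(3)[of "u - v"] that by auto
    qed
    then show ?case using t v(1) by (intro exI[of _ "v + t"]) auto
  qed
  have "infdist (Z u) \<Lambda> < e" if "u \<ge> s0" for u
  proof -
    obtain n where "u - s0 < real n" using reals_Archimedean2 by blast
    then show ?thesis using *[of n] that by (smt (verit) atLeastLessThan_iff)
  qed
  then show "eventually (\<lambda>t. dist (infdist (Z t) \<Lambda>) 0 < e) at_top"
    unfolding eventually_at_top_linorder by (auto intro!: exI[of _ s0] simp: infdist_nonneg)
qed

section \<open>Step sizes and negligible noise\<close>

locale step_sizes =
  fixes a :: "nat \<Rightarrow> real"
  assumes a_pos: "\<And>n. a n > 0" and a_lim: "a \<longlonglongrightarrow> 0"
    and a_sum: "filterlim (\<lambda>n. \<Sum>i<n. a i) at_top sequentially"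
begin

abbreviation \<tau> :: "nat \<Rightarrow> real" where "\<tau> \<equiv> step_time a"

lemma step_time_0 [simp]: "\<tau> 0 = 0" by (simp add: step_time_def)

lemma step_time_Suc: "\<tau> (Suc n) = \<tau> n + a n" by (simp add: step_time_def)

lemma step_time_diff: "n \<le> k \<Longrightarrow> \<tau> k - \<tau> n = (\<Sum>i\<in>{n..<k}. a i)"
  by (induction k rule: dec_induct) (simp_all add: step_time_Suc)

lemma strict_mono_step_time: "strict_mono \<tau>"
  by (rule strict_mono_Suc_iff[THEN iffD2]) (simp add: step_time_Suc a_pos)

lemma step_time_le_iff [simp]: "\<tau> n \<le> \<tau> k \<longleftrightarrow> n \<le> k"
  using strict_mono_step_time by (rule strict_mono_less_eq)

lemma step_time_less_iff [simp]: "\<tau> n < \<tau> k \<longleftrightarrow> n < k"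
  using strict_mono_step_time by (rule strict_mono_less)

lemma step_time_nonneg [simp]: "\<tau> n \<ge> 0"
  using step_time_le_iff[of 0 n] by simp

lemma step_time_at_top: "filterlim \<tau> at_top sequentially"
  using a_sum by (simp add: step_time_def[abs_def])

lemma step_index_bounds:
  assumes "t \<ge> 0"
  shows "\<tau> (step_index a t) \<le> t" "t < \<tau> (Suc (step_index a t))"
proof -
  let ?A = "{n. \<tau> n \<le> t}"
  obtain N where N: "\<And>n. n \<ge> N \<Longrightarrow> \<tau> n \<ge> t + 1"
    using step_time_at_top unfolding filterlim_at_top eventually_sequentially by meson
  have "?A \<subseteq> {..<N}"
  proof
    fix n assume "n \<in> ?A"
    then show "n \<in> {..<N}" using N[of n] by (cases "n < N") auto
  qed
  then have fin: "finite ?A" using finite_subset by blast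
  have ne: "0 \<in> ?A" using assms by simp
  have si: "step_index a t = Max ?A" using assms by (simp add: step_index_def)
  show "\<tau> (step_index a t) \<le> t" using Max_in[OF fin] ne unfolding si by blast
  show "t < \<tau> (Suc (step_index a t))"
  proof (rule ccontr)
    assume "\<not> t < \<tau> (Suc (step_index a t))"
    then have "Suc (step_index a t) \<in> ?A" by simp
    then have "Suc (step_index a t) \<le> step_index a t" using Max_ge[OF fin] unfolding si by blast
    then show False by simp
  qed
qed

lemma step_index_le_iff: "t \<ge> 0 \<Longrightarrow> n \<le> step_index a t \<longleftrightarrow> \<tau> n \<le> t"
  using step_index_bounds[of t] step_time_le_iff[of n "step_index a t"] step_time_less_iff[of n "Suc (step_index a t)"]
  by (smt (verit) less_Suc_eq_le)

lemma step_index_eqI: "\<tau> n \<le> t \<Longrightarrow> t < \<tau> (Suc n) \<Longrightarrow> step_index a t = n"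
  using step_index_le_iff[of t n] step_index_le_iff[of t "Suc n"] step_time_nonneg[of n] by linarith

lemma step_index_step_time [simp]: "step_index a (\<tau> n) = n"
  by (rule step_index_eqI) auto

lemma step_index_at_top: "filterlim (step_index a) at_top at_top"
  unfolding filterlim_at_top
proof
  fix n
  have "eventually (\<lambda>t. t \<ge> \<tau> n) at_top" by (rule eventually_ge_at_top)
  then show "eventually (\<lambda>t. n \<le> step_index a t) at_top"
  proof eventually_elim
    case (elim t)
    then show ?case using step_index_le_iff[of t n] step_time_nonneg[of n] by linarith
  qed
qed

text \<open>The condition of Kushner and Clark, stated with indices: windows are delimited by two indices
  whose times differ by at most \<open>T\<close>.\<close>

definition negligible_noise :: "(nat \<Rightarrow> 'b::real_normed_vector) \<Rightarrow> bool" where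
  "negligible_noise e \<longleftrightarrow> (\<forall>T. \<forall>\<epsilon>>0. \<exists>N. \<forall>n\<ge>N. \<forall>k\<ge>n. \<tau> k - \<tau> n \<le> T \<longrightarrow>
     norm (\<Sum>i\<in>{n..<k}. a i *\<^sub>R e i) \<le> \<epsilon>)"

lemma negligible_noiseD:
  assumes "negligible_noise e" "\<epsilon> > 0"
  obtains N where "\<And>n k. N \<le> n \<Longrightarrow> n \<le> k \<Longrightarrow> \<tau> k - \<tau> n \<le> T \<Longrightarrow> norm (\<Sum>i\<in>{n..<k}. a i *\<^sub>R e i) \<le> \<epsilon>"
  using assms unfolding negligible_noise_def by metis

text \<open>A window of length \<open>T\<close> is cut into finitely many windows of length at most \<open>\<delta>\<close>. The errors proportional to the
  length add up to at most \<open>c * T\<close>, and the number of pieces, which depends only on \<open>T\<close> and \<open>\<delta>\<close>, is known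
  before \<open>\<eta>\<close> is chosen.\<close>

lemma negligible_noise_local:
  fixes e :: "nat \<Rightarrow> 'b::real_normed_vector"
  assumes local: "\<And>c. c > 0 \<Longrightarrow> \<exists>\<delta>>0. \<forall>\<eta>>0. \<exists>N. \<forall>n\<ge>N. \<forall>k\<ge>n. \<tau> k - \<tau> n \<le> \<delta> \<longrightarrow>
     norm (\<Sum>i\<in>{n..<k}. a i *\<^sub>R e i) \<le> c * (\<tau> k - \<tau> n) + \<eta>"
  shows "negligible_noise e"
  unfolding negligible_noise_def
proof (intro allI impI)
  fix T \<epsilon> :: real assume \<epsilon>: "\<epsilon> > 0"
  define T' where "T' = max T 1"
  define c where "c = \<epsilon> / (2 * T')"
  have T': "T' > 0" "T \<le> T'" by (auto simp: T'_def)
  have c: "c > 0" "c * T' = \<epsilon> / 2" using \<epsilon> T' by (auto simp: c_def)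
  obtain \<delta> where \<delta>: "\<delta> > 0" and loc: "\<And>\<eta>. \<eta> > 0 \<Longrightarrow> \<exists>N. \<forall>n\<ge>N. \<forall>k\<ge>n. \<tau> k - \<tau> n \<le> \<delta> \<longrightarrow>
     norm (\<Sum>i\<in>{n..<k}. a i *\<^sub>R e i) \<le> c * (\<tau> k - \<tau> n) + \<eta>"
    using local[OF c(1)] by blast
  obtain p :: nat where p: "2 * T' / \<delta> < real p" using reals_Archimedean2 by blast
  have "2 * T' / \<delta> > 0" using T' \<delta> by simp
  then have p0: "real p > 0" using p by linarith
  define \<eta> where "\<eta> = \<epsilon> / (2 * real p)"
  have \<eta>: "\<eta> > 0" "real p * \<eta> = \<epsilon> / 2" using \<epsilon> p0 by (auto simp: \<eta>_def)
  obtain N1 where N1: "\<And>n k. n \<ge> N1 \<Longrightarrow> k \<ge> n \<Longrightarrow> \<tau> k - \<tau> n \<le> \<delta> \<Longrightarrow>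
     norm (\<Sum>i\<in>{n..<k}. a i *\<^sub>R e i) \<le> c * (\<tau> k - \<tau> n) + \<eta>"
    using loc[OF \<eta>(1)] by blast
  have "eventually (\<lambda>i. a i < \<delta> / 2) sequentially" using a_lim \<delta> by (intro order_tendstoD(2)[of _ 0]) auto
  then obtain N2 where N2: "\<And>i. i \<ge> N2 \<Longrightarrow> a i < \<delta> / 2" unfolding eventually_sequentially by blast
  define N where "N = max N1 N2"
  have claim: "norm (\<Sum>i\<in>{n..<k}. a i *\<^sub>R e i) \<le> c * (\<tau> k - \<tau> n) + real q * \<eta>"
    if "n \<ge> N" "k \<ge> n" "\<tau> k - \<tau> n \<le> real q * (\<delta> / 2)" for q n k
    using that
  proof (induction q arbitrary: n)
    case 0
    then have "k = n" using step_time_le_iff[of k n] by simp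
    then show ?case by simp
  next
    case (Suc q)
    show ?case
    proof (cases "\<tau> k - \<tau> n \<le> \<delta>")
      case True
      then have "norm (\<Sum>i\<in>{n..<k}. a i *\<^sub>R e i) \<le> c * (\<tau> k - \<tau> n) + \<eta>"
        using N1[of n k] Suc.prems by (simp add: N_def)
      also have "\<eta> \<le> real (Suc q) * \<eta>" using \<eta>(1) by (simp add: algebra_simps)
      finally show ?thesis by simp
    next
      case False
      \<comment> \<open>the last index within time \<open>\<delta>\<close> of \<open>n\<close>; as steps are below \<open>\<delta> / 2\<close>, it lies more than \<open>\<delta> / 2\<close> ahead\<close>
      define l where "l = step_index a (\<tau> n + \<delta>)"
      have l: "\<tau> l \<le> \<tau> n + \<delta>" "\<tau> n + \<delta> < \<tau> (Suc l)"
        using step_index_bounds[of "\<tau> n + \<delta>"] \<delta> by (auto simp: l_def add_nonneg_nonneg)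
      have nl: "n \<le> l" using step_index_le_iff[of "\<tau> n + \<delta>" n] \<delta> by (simp add: l_def)
      have "\<tau> l < \<tau> k" using l False by linarith
      then have lk: "l \<le> k" by simp
      have "a l < \<delta> / 2" using N2[of l] nl Suc.prems(1) by (simp add: N_def)
      then have "\<tau> l - \<tau> n > \<delta> / 2" using l(2) by (simp add: step_time_Suc)
      then have "\<tau> k - \<tau> l \<le> real q * (\<delta> / 2)" using Suc.prems(3) by (simp add: algebra_simps)
      then have A: "norm (\<Sum>i\<in>{l..<k}. a i *\<^sub>R e i) \<le> c * (\<tau> k - \<tau> l) + real q * \<eta>"
        using Suc.IH[of l] nl lk Suc.prems(1) by simp
      have B: "norm (\<Sum>i\<in>{n..<l}. a i *\<^sub>R e i) \<le> c * (\<tau> l - \<tau> n) + \<eta>"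
        using N1[of n l] nl l(1) Suc.prems(1) by (simp add: N_def)
      have "(\<Sum>i\<in>{n..<k}. a i *\<^sub>R e i) = (\<Sum>i\<in>{n..<l}. a i *\<^sub>R e i) + (\<Sum>i\<in>{l..<k}. a i *\<^sub>R e i)"
        using nl lk by (simp add: sum.atLeastLessThan_concat)
      also have "norm \<dots> \<le> (c * (\<tau> l - \<tau> n) + \<eta>) + (c * (\<tau> k - \<tau> l) + real q * \<eta>)"
        by (intro norm_triangle_le add_mono A B)
      also have "\<dots> = c * (\<tau> k - \<tau> n) + real (Suc q) * \<eta>" by (simp add: algebra_simps)
      finally show ?thesis .
    qed
  qed
  show "\<exists>N. \<forall>n\<ge>N. \<forall>k\<ge>n. \<tau> k - \<tau> n \<le> T \<longrightarrow> norm (\<Sum>i\<in>{n..<k}. a i *\<^sub>R e i) \<le> \<epsilon>"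
  proof (intro exI[of _ N] allI impI)
    fix n k assume nk: "n \<ge> N" "k \<ge> n" "\<tau> k - \<tau> n \<le> T"
    have "T' \<le> real p * (\<delta> / 2)" using p \<delta> by (simp add: field_simps)
    then have "norm (\<Sum>i\<in>{n..<k}. a i *\<^sub>R e i) \<le> c * (\<tau> k - \<tau> n) + real p * \<eta>"
      using nk T' by (intro claim) auto
    also have "\<dots> \<le> c * T' + real p * \<eta>" using nk T' c by simp
    also have "\<dots> = \<epsilon>" using c \<eta> by simp
    finally show "norm (\<Sum>i\<in>{n..<k}. a i *\<^sub>R e i) \<le> \<epsilon>" .
  qed
qed

lemma negligible_noise_zero: "negligible_noise (\<lambda>_. 0)"
  by (auto simp: negligible_noise_def)

lemma negligible_noise_add:
  assumes e: "negligible_noise e" and g: "negligible_noise g"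
  shows "negligible_noise (\<lambda>i. e i + g i)"
  unfolding negligible_noise_def
proof (intro allI impI)
  fix T \<epsilon> :: real assume "\<epsilon> > 0"
  then have \<epsilon>: "\<epsilon> / 2 > 0" by simp
  obtain N1 where N1: "\<And>n k. N1 \<le> n \<Longrightarrow> n \<le> k \<Longrightarrow> \<tau> k - \<tau> n \<le> T \<Longrightarrow> norm (\<Sum>i\<in>{n..<k}. a i *\<^sub>R e i) \<le> \<epsilon> / 2"
    using negligible_noiseD[OF e \<epsilon>] by metis
  obtain N2 where N2: "\<And>n k. N2 \<le> n \<Longrightarrow> n \<le> k \<Longrightarrow> \<tau> k - \<tau> n \<le> T \<Longrightarrow> norm (\<Sum>i\<in>{n..<k}. a i *\<^sub>R g i) \<le> \<epsilon> / 2"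
    using negligible_noiseD[OF g \<epsilon>] by metis
  show "\<exists>N. \<forall>n\<ge>N. \<forall>k\<ge>n. \<tau> k - \<tau> n \<le> T \<longrightarrow> norm (\<Sum>i\<in>{n..<k}. a i *\<^sub>R (e i + g i)) \<le> \<epsilon>"
  proof (intro exI[of _ "max N1 N2"] allI impI)
    fix n k assume nk: "n \<ge> max N1 N2" "k \<ge> n" "\<tau> k - \<tau> n \<le> T"
    have "norm (\<Sum>i\<in>{n..<k}. a i *\<^sub>R (e i + g i)) \<le> norm (\<Sum>i\<in>{n..<k}. a i *\<^sub>R e i) + norm (\<Sum>i\<in>{n..<k}. a i *\<^sub>R g i)"
      by (simp add: scaleR_add_right sum.distrib norm_triangle_ineq)
    also have "\<dots> \<le> \<epsilon> / 2 + \<epsilon> / 2" using nk by (intro add_mono N1 N2) auto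
    finally show "norm (\<Sum>i\<in>{n..<k}. a i *\<^sub>R (e i + g i)) \<le> \<epsilon>" by simp
  qed
qed

lemma negligible_noise_sum:
  "finite C \<Longrightarrow> (\<And>q. q \<in> C \<Longrightarrow> negligible_noise (g q)) \<Longrightarrow> negligible_noise (\<lambda>i. \<Sum>q\<in>C. g q i)"
  by (induction C rule: finite_induct) (auto simp: negligible_noise_zero intro!: negligible_noise_add)

text \<open>The additional term \<open>G\<close> allows domination by noise that is itself only negligible, not small.\<close>

lemma negligible_noise_approx:
  fixes e :: "nat \<Rightarrow> 'b::real_normed_vector"
  assumes approx: "\<And>c. c > 0 \<Longrightarrow> \<exists>e' G. negligible_noise e' \<and> negligible_noise G \<and> 
    (\<forall>\<^sub>F i in sequentially. norm (e i - e' i) \<le> c + G i)"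
  shows "negligible_noise e"
proof (rule negligible_noise_local)
  fix c :: real assume "c > 0"
  then obtain e' G where e': "negligible_noise e'" and G: "negligible_noise G"
    and le: "\<forall>\<^sub>F i in sequentially. norm (e i - e' i) \<le> c + G i" using approx by blast
  obtain N0 where N0: "\<And>i. i \<ge> N0 \<Longrightarrow> norm (e i - e' i) \<le> c + G i" using le unfolding eventually_sequentially by blast
  show "\<exists>\<delta>>0. \<forall>\<eta>>0. \<exists>N. \<forall>n\<ge>N. \<forall>k\<ge>n. \<tau> k - \<tau> n \<le> \<delta> \<longrightarrow>
     norm (\<Sum>i\<in>{n..<k}. a i *\<^sub>R e i) \<le> c * (\<tau> k - \<tau> n) + \<eta>"
  proof (intro exI[of _ "1::real"] conjI allI impI)
    fix \<eta> :: real assume "\<eta> > 0"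
    then have \<eta>: "\<eta> / 2 > 0" by simp
    obtain N1 where N1: "\<And>n k. N1 \<le> n \<Longrightarrow> n \<le> k \<Longrightarrow> \<tau> k - \<tau> n \<le> 1 \<Longrightarrow> norm (\<Sum>i\<in>{n..<k}. a i *\<^sub>R e' i) \<le> \<eta> / 2"
      using negligible_noiseD[OF e' \<eta>] by metis
    obtain N2 where N2: "\<And>n k. N2 \<le> n \<Longrightarrow> n \<le> k \<Longrightarrow> \<tau> k - \<tau> n \<le> 1 \<Longrightarrow> norm (\<Sum>i\<in>{n..<k}. a i *\<^sub>R G i) \<le> \<eta> / 2"
      using negligible_noiseD[OF G \<eta>] by metis
    show "\<exists>N. \<forall>n\<ge>N. \<forall>k\<ge>n. \<tau> k - \<tau> n \<le> 1 \<longrightarrow> norm (\<Sum>i\<in>{n..<k}. a i *\<^sub>R e i) \<le> c * (\<tau> k - \<tau> n) + \<eta>"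
    proof (intro exI[of _ "max N0 (max N1 N2)"] allI impI)
      fix n k :: nat assume nk: "n \<ge> max N0 (max N1 N2)" "k \<ge> n" "\<tau> k - \<tau> n \<le> 1"
      have "(\<Sum>i\<in>{n..<k}. a i *\<^sub>R e i) = (\<Sum>i\<in>{n..<k}. a i *\<^sub>R e' i) + (\<Sum>i\<in>{n..<k}. a i *\<^sub>R (e i - e' i))"
        by (simp add: sum.distrib[symmetric] scaleR_add_right[symmetric])
      also have "norm \<dots> \<le> \<eta> / 2 + (\<Sum>i\<in>{n..<k}. a i * (c + G i))"
      proof (intro norm_triangle_le add_mono sum_norm_le)
        show "norm (\<Sum>i\<in>{n..<k}. a i *\<^sub>R e' i) \<le> \<eta> / 2" using nk by (intro N1) auto
        fix i assume "i \<in> {n..<k}"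
        then have "norm (e i - e' i) \<le> c + G i" using nk by (intro N0) auto
        then show "norm (a i *\<^sub>R (e i - e' i)) \<le> a i * (c + G i)" using a_pos[of i] by simp
      qed
      also have "(\<Sum>i\<in>{n..<k}. a i * (c + G i)) = c * (\<tau> k - \<tau> n) + (\<Sum>i\<in>{n..<k}. a i *\<^sub>R G i)"
        using nk(2) by (simp add: step_time_diff sum_distrib_left distrib_left sum.distrib mult.commute)
      also have "(\<Sum>i\<in>{n..<k}. a i *\<^sub>R G i) \<le> \<eta> / 2" using N2[of n k] nk by (simp add: abs_le_iff)
      finally show "norm (\<Sum>i\<in>{n..<k}. a i *\<^sub>R e i) \<le> c * (\<tau> k - \<tau> n) + \<eta>" by simp
    qed
  qed simp
qed

lemma negligible_noise_tendsto_zero: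
  assumes "(\<lambda>i. norm (e i)) \<longlonglongrightarrow> 0"
  shows "negligible_noise e"
proof (rule negligible_noise_approx)
  fix c :: real assume "c > 0"
  then have "\<forall>\<^sub>F i in sequentially. norm (e i) < c" using assms by (rule order_tendstoD(2)[rotated])
  then have "\<forall>\<^sub>F i in sequentially. norm (e i - 0) \<le> c + 0" by eventually_elim simp
  then show "\<exists>e' G. negligible_noise e' \<and> negligible_noise G \<and> (\<forall>\<^sub>F i in sequentially. norm (e i - e' i) \<le> c + G i)"
    by (intro exI[of _ "\<lambda>_. 0"]) (simp add: negligible_noise_zero)
qed

end

section \<open>Averaging along the iterates\<close>

context step_sizes
begin

text \<open>Asymptotic uniform continuity of \<open>x\<close> as a function of the time \<open>step_time a\<close>.\<close>

definition slowly_moving :: "(nat \<Rightarrow> 'b::metric_space) \<Rightarrow> bool" where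
  "slowly_moving x \<longleftrightarrow> (\<forall>\<epsilon>>0. \<exists>\<delta>>0. \<exists>N. \<forall>n\<ge>N. \<forall>k\<ge>n. \<tau> k - \<tau> n \<le> \<delta> \<longrightarrow> dist (x k) (x n) \<le> \<epsilon>)"

lemma increments_sum:
  fixes x :: "nat \<Rightarrow> 'b::real_vector"
  assumes "\<And>i. x (Suc i) = x i + a i *\<^sub>R r i" "n \<le> k"
  shows "x k - x n = (\<Sum>i\<in>{n..<k}. a i *\<^sub>R r i)"
  using assms(2) by (induction k rule: dec_induct) (auto simp: assms(1) diff_eq_eq add.commute add.left_commute)

lemma slowly_moving_of_increments:
  fixes x :: "nat \<Rightarrow> 'b::real_normed_vector"
  assumes x: "\<And>i. x (Suc i) = x i + a i *\<^sub>R (w i + r i)"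
    and w: "\<And>i. norm (w i) \<le> K" and r: "negligible_noise r"
  shows "slowly_moving x"
  unfolding slowly_moving_def
proof (intro allI impI)
  fix \<epsilon> :: real assume \<epsilon>: "\<epsilon> > 0"
  have K: "K \<ge> 0" using w[of 0] norm_ge_zero order_trans by blast
  define \<delta> where "\<delta> = \<epsilon> / (2 * (K + 1))"
  have \<delta>: "\<delta> > 0" "K * \<delta> \<le> \<epsilon> / 2" using \<epsilon> K by (auto simp: \<delta>_def field_simps)
  obtain N where N: "\<And>n k. N \<le> n \<Longrightarrow> n \<le> k \<Longrightarrow> \<tau> k - \<tau> n \<le> \<delta> \<Longrightarrow> norm (\<Sum>i\<in>{n..<k}. a i *\<^sub>R r i) \<le> \<epsilon> / 2"
    using negligible_noiseD[OF r, of "\<epsilon> / 2"] \<epsilon> by (metis half_gt_zero)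
  show "\<exists>\<delta>>0. \<exists>N. \<forall>n\<ge>N. \<forall>k\<ge>n. \<tau> k - \<tau> n \<le> \<delta> \<longrightarrow> dist (x k) (x n) \<le> \<epsilon>"
  proof (intro exI[of _ \<delta>] exI[of _ N] conjI allI impI \<delta>(1))
    fix n k assume nk: "n \<ge> N" "k \<ge> n" "\<tau> k - \<tau> n \<le> \<delta>"
    have "x k - x n = (\<Sum>i\<in>{n..<k}. a i *\<^sub>R w i) + (\<Sum>i\<in>{n..<k}. a i *\<^sub>R r i)"
      using increments_sum[of x "\<lambda>i. w i + r i", OF x nk(2)] by (simp add: scaleR_add_right sum.distrib)
    also have "norm \<dots> \<le> (\<Sum>i\<in>{n..<k}. a i * K) + \<epsilon> / 2"
    proof (intro norm_triangle_le add_mono sum_norm_le)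
      fix i show "norm (a i *\<^sub>R w i) \<le> a i * K" using w[of i] a_pos[of i] by simp
    qed (use N nk in auto)
    also have "(\<Sum>i\<in>{n..<k}. a i * K) = K * (\<tau> k - \<tau> n)" using nk(2) by (simp add: step_time_diff sum_distrib_left mult.commute)
    also have "\<dots> \<le> K * \<delta>" using nk(3) K by (intro mult_left_mono) auto
    finally show "dist (x k) (x n) \<le> \<epsilon>" using \<delta>(2) by (simp add: dist_norm)
  qed
qed

text \<open>The point \<open>0\<close> is joined to \<open>x\<close> by a segment. The number of steps of length less than the modulus of
  continuity depends only on \<open>R\<close>.\<close>

lemma bounded_oscillation:
  fixes g :: "'a::real_normed_vector \<Rightarrow> 'i \<Rightarrow> 'b::real_normed_vector"
  assumes g: "continuous_uniformly_on_bounded g UNIV" and R: "R > 0"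
  obtains K where "\<And>x i. norm x \<le> R \<Longrightarrow> norm (g x i - g 0 i) \<le> K"
proof -
  obtain d where d: "d > 0" "\<And>x y i. norm x \<le> R \<Longrightarrow> norm y \<le> R \<Longrightarrow> dist x y < d \<Longrightarrow> dist (g x i) (g y i) < 1"
    using g bounded_cball[of 0 R] unfolding continuous_uniformly_on_bounded_def 
    by (metis UNIV_I mem_cball_0 zero_less_one)
  obtain p :: nat where p: "R / d < real p" using reals_Archimedean2 by blast
  have "R / d > 0" using R d by simp
  then have p0: "real p > 0" using p by linarith
  have Rp: "R / real p < d" using p p0 d(1) by (simp add: field_simps)
  have "norm (g x i - g 0 i) \<le> real p" if x: "norm x \<le> R" for x i
  proof -
    have "norm (g ((real j / real p) *\<^sub>R x) i - g 0 i) \<le> real j" if "j \<le> p" for j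
      using that
    proof (induction j)
      case 0 then show ?case by simp
    next
      case (Suc j)
      have in_ball: "norm ((real l / real p) *\<^sub>R x) \<le> R" if "l \<le> p" for l
      proof -
        have "norm ((real l / real p) *\<^sub>R x) \<le> 1 * norm x"
          unfolding norm_scaleR using that p0 by (intro mult_right_mono) auto
        then show ?thesis using x by simp
      qed
      have "dist ((real (Suc j) / real p) *\<^sub>R x) ((real j / real p) *\<^sub>R x) = norm ((1 / real p) *\<^sub>R x)"
        by (simp add: dist_norm scaleR_diff_left[symmetric] diff_divide_distrib[symmetric])
      also have "\<dots> \<le> R / real p" using x p0 by (simp add: divide_right_mono)
      finally have "dist ((real (Suc j) / real p) *\<^sub>R x) ((real j / real p) *\<^sub>R x) < d" using Rp by simp
      then have "norm (g ((real (Suc j) / real p) *\<^sub>R x) i - g ((real j / real p) *\<^sub>R x) i) < 1"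
        using d(2)[OF in_ball in_ball, of "Suc j" j i] Suc.prems by (simp add: dist_norm)
      moreover have "norm (g ((real j / real p) *\<^sub>R x) i - g 0 i) \<le> real j" using Suc by simp
      ultimately show ?case
        using norm_triangle_ineq[of "g ((real (Suc j) / real p) *\<^sub>R x) i - g ((real j / real p) *\<^sub>R x) i" "g ((real j / real p) *\<^sub>R x) i - g 0 i"]
        by simp
    qed
    from this[of p] show ?thesis using p0 by simp
  qed
  then show ?thesis by (rule that)
qed

text \<open>On a short window all iterates are close to one point of a finite net, and the noise at the
  finitely many points of the net is negligible simultaneously.\<close>

lemma negligible_noise_along_slow_sequence:
  fixes g :: "'a::euclidean_space \<Rightarrow> nat \<Rightarrow> 'b::real_normed_vector"
  assumes g: "continuous_uniformly_on_bounded g UNIV" and avg: "\<And>x. negligible_noise (g x)"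
    and bd: "bounded (range x)" and slow: "slowly_moving x"
  shows "negligible_noise (\<lambda>i. g (x i) i)"
proof (rule negligible_noise_local)
  fix c :: real assume c: "c > 0"
  have bdc: "bounded (closure (range x))" using bd by (rule bounded_closure)
  obtain d where d: "d > 0" "\<And>u v i. u \<in> closure (range x) \<Longrightarrow> v \<in> closure (range x) \<Longrightarrow> dist u v < d \<Longrightarrow> dist (g u i) (g v i) < c"
    using g bdc c unfolding continuous_uniformly_on_bounded_def by (metis UNIV_I)
  obtain C where C: "finite C" "C \<subseteq> closure (range x)" "range x \<subseteq> (\<Union>q\<in>C. ball q (d / 2))"
    by (rule bounded_finite_ball_cover[where d="\<lambda>_. d / 2", OF bd half_gt_zero[OF d(1)]]) (rule that)
  obtain \<delta> N0 where \<delta>: "\<delta> > 0" and N0: "\<And>n k. n \<ge> N0 \<Longrightarrow> k \<ge> n \<Longrightarrow> \<tau> k - \<tau> n \<le> \<delta> \<Longrightarrow> dist (x k) (x n) \<le> d / 3"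
    using slow d(1) unfolding slowly_moving_def by (metis zero_less_divide_iff zero_less_numeral)
  show "\<exists>\<delta>>0. \<forall>\<eta>>0. \<exists>N. \<forall>n\<ge>N. \<forall>k\<ge>n. \<tau> k - \<tau> n \<le> \<delta> \<longrightarrow>
     norm (\<Sum>i\<in>{n..<k}. a i *\<^sub>R g (x i) i) \<le> c * (\<tau> k - \<tau> n) + \<eta>"
  proof (intro exI[of _ \<delta>] conjI allI impI \<delta>)
    fix \<eta> :: real assume \<eta>: "\<eta> > 0"
    have "\<exists>N. \<forall>n k. N \<le> n \<longrightarrow> n \<le> k \<longrightarrow> \<tau> k - \<tau> n \<le> \<delta> \<longrightarrow> norm (\<Sum>i\<in>{n..<k}. a i *\<^sub>R g q i) \<le> \<eta>" for q
      using negligible_noiseD[OF avg \<eta>] by metis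
    then obtain N where N: "\<And>q n k. N q \<le> n \<Longrightarrow> n \<le> k \<Longrightarrow> \<tau> k - \<tau> n \<le> \<delta> \<Longrightarrow> norm (\<Sum>i\<in>{n..<k}. a i *\<^sub>R g q i) \<le> \<eta>"
      by metis
    show "\<exists>N. \<forall>n\<ge>N. \<forall>k\<ge>n. \<tau> k - \<tau> n \<le> \<delta> \<longrightarrow> norm (\<Sum>i\<in>{n..<k}. a i *\<^sub>R g (x i) i) \<le> c * (\<tau> k - \<tau> n) + \<eta>"
    proof (intro exI[of _ "Max (insert N0 (N ` C))"] allI impI)
      fix n k assume n: "n \<ge> Max (insert N0 (N ` C))" and nk: "n \<le> k" "\<tau> k - \<tau> n \<le> \<delta>"
      have n0: "n \<ge> N0" and nC: "\<And>q. q \<in> C \<Longrightarrow> n \<ge> N q"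
        using n C(1) by (auto dest: order_trans[rotated])
      have "x n \<in> (\<Union>q\<in>C. ball q (d / 2))" using C(3) by blast
      then obtain q where q: "q \<in> C" "dist q (x n) < d / 2" by auto
      have near: "norm (g (x i) i - g q i) \<le> c" if i: "i \<in> {n..<k}" for i
      proof -
        have "\<tau> i \<le> \<tau> k" using i by simp
        then have "\<tau> i - \<tau> n \<le> \<delta>" using nk(2) by linarith
        then have "dist (x i) (x n) \<le> d / 3" using i n0 by (intro N0) auto
        then have "dist (x i) q < d" using q(2) d(1) dist_triangle[of "x i" q "x n"] by (simp add: dist_commute)
        then have "dist (g (x i) i) (g q i) < c" using d(2)[of "x i" q i] q(1) C(2) closure_subset[of "range x"] by blast
        then show ?thesis by (simp add: dist_norm)
      qed
      have "(\<Sum>i\<in>{n..<k}. a i *\<^sub>R g (x i) i) = (\<Sum>i\<in>{n..<k}. a i *\<^sub>R (g (x i) i - g q i)) + (\<Sum>i\<in>{n..<k}. a i *\<^sub>R g q i)"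
        by (simp add: sum.distrib[symmetric] scaleR_add_right[symmetric])
      also have "norm \<dots> \<le> (\<Sum>i\<in>{n..<k}. a i * c) + \<eta>"
      proof (intro norm_triangle_le add_mono sum_norm_le)
        fix i assume "i \<in> {n..<k}"
        then show "norm (a i *\<^sub>R (g (x i) i - g q i)) \<le> a i * c" using near[of i] a_pos[of i] by simp
      qed (use N nC q nk in auto)
      also have "(\<Sum>i\<in>{n..<k}. a i * c) = c * (\<tau> k - \<tau> n)"
        using nk(1) by (simp add: step_time_diff sum_distrib_left mult.commute)
      finally show "norm (\<Sum>i\<in>{n..<k}. a i *\<^sub>R g (x i) i) \<le> c * (\<tau> k - \<tau> n) + \<eta>" .
    qed
  qed
qed

text \<open>That the iterates move slowly is itself a consequence of averaging, at the single point \<open>0\<close>: the remaining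
  part \<open>g (x i) i - g 0 i\<close> of the increment is bounded.\<close>

lemma negligible_noise_along_iterates:
  fixes g :: "'a::euclidean_space \<Rightarrow> nat \<Rightarrow> 'a"
  assumes g: "continuous_uniformly_on_bounded g UNIV" and avg: "\<And>x. negligible_noise (g x)"
    and x: "\<And>i. x (Suc i) = x i + a i *\<^sub>R (w i + g (x i) i + r i)"
    and bd: "bounded (range x)" and w: "bounded (range w)" and r: "negligible_noise r"
  shows "negligible_noise (\<lambda>i. g (x i) i)"
proof (rule negligible_noise_along_slow_sequence[OF g avg bd])
  obtain R where R: "R > 0" "\<And>i. norm (x i) \<le> R" using bd unfolding bounded_pos by auto
  obtain K where K: "\<And>x i. norm x \<le> R \<Longrightarrow> norm (g x i - g 0 i) \<le> K" using bounded_oscillation[OF g R(1)] by blast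
  obtain W where W: "\<And>i. norm (w i) \<le> W" using w unfolding bounded_iff by auto
  show "slowly_moving x"
  proof (rule slowly_moving_of_increments[of x "\<lambda>i. w i + (g (x i) i - g 0 i)" "\<lambda>i. g 0 i + r i" "W + K"])
    show "x (Suc i) = x i + a i *\<^sub>R (w i + (g (x i) i - g 0 i) + (g 0 i + r i))" for i
      using x[of i] by (simp add: algebra_simps)
    show "norm (w i + (g (x i) i - g 0 i)) \<le> W + K" for i
      by (intro norm_triangle_le add_mono W K R)
    show "negligible_noise (\<lambda>i. g 0 i + r i)" by (intro negligible_noise_add avg r)
  qed
qed

text \<open>By positivity \<open>g i (x i)\<close> is dominated by \<open>c\<close> plus the sum of the values of \<open>g i\<close> at the points of a finite net,
  wherever the iterates move within the set covered by the net.\<close>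

lemma negligible_noise_along_bounded_sequence:
  fixes g :: "nat \<Rightarrow> 'a::euclidean_space \<Rightarrow> real"
  assumes g: "\<And>y e. e > 0 \<Longrightarrow> \<exists>d>0. \<forall>z. dist z y < d \<longrightarrow> (\<forall>i. dist (g i z) (g i y) < e)"
    and pos: "\<And>i y. g i y \<ge> 0" and avg: "\<And>y. negligible_noise (\<lambda>i. g i y)"
    and bd: "bounded (range x)"
    and v: "\<And>i. norm (v i) \<le> g i (x i)"
  shows "negligible_noise v"
proof (rule negligible_noise_approx)
  fix c :: real assume c: "c > 0"
  obtain d where d: "\<And>y. d y > 0" "\<And>y z i. dist z y < d y \<Longrightarrow> dist (g i z) (g i y) < c"
    using g[OF c] by metis
  obtain C where C: "finite C" "range x \<subseteq> (\<Union>y\<in>C. ball y (d y))"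
    by (rule bounded_finite_ball_cover[where d=d, OF bd d(1)]) (rule that)
  have "norm (v i - 0) \<le> c + (\<Sum>y\<in>C. g i y)" for i
  proof -
    have "x i \<in> (\<Union>y\<in>C. ball y (d y))" using C(2) by blast
    then obtain y where y: "y \<in> C" "dist (x i) y < d y" by (auto simp: dist_commute)
    have "norm (v i) \<le> g i (x i)" by (rule v)
    also have "\<dots> \<le> c + g i y" using d(2)[OF y(2), of i] by (simp add: dist_real_def)
    also have "g i y \<le> (\<Sum>y\<in>C. g i y)" using y(1) C(1) pos by (intro member_le_sum) auto
    finally show ?thesis by simp
  qed
  then show "\<exists>e' G. negligible_noise e' \<and> negligible_noise G \<and> (\<forall>\<^sub>F i in sequentially. norm (v i - e' i) \<le> c + G i)"
    using negligible_noise_sum[OF C(1), of "\<lambda>y i. g i y"] avg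
    by (intro exI[of _ "\<lambda>_. 0"] exI[of _ "\<lambda>i. \<Sum>y\<in>C. g i y"]) (simp add: negligible_noise_zero)
qed

end

section \<open>Interpolation of the iterates\<close>

lemma tendsto_of_dist_tendsto_zero:
  fixes f g :: "'c \<Rightarrow> 'a::real_normed_vector"
  assumes "(f \<longlongrightarrow> l) F" "((\<lambda>k. dist (f k) (g k)) \<longlongrightarrow> 0) F"
  shows "(g \<longlongrightarrow> l) F"
proof -
  have "((\<lambda>k. f k - g k) \<longlongrightarrow> 0) F"
    by (rule tendsto_norm_zero_cancel) (use assms(2) in \<open>simp add: dist_norm\<close>)
  from tendsto_diff[OF assms(1) this] show ?thesis by simp
qed

context step_sizes
begin

text \<open>Extended to negative times by the constant \<open>x 0\<close>, so that all shifted processes are translates of this one.\<close>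

definition interpolated :: "(nat \<Rightarrow> 'b::real_normed_vector) \<Rightarrow> real \<Rightarrow> 'b" where
  "interpolated x = shifted a x 0"

lemma interpolated_eq:
  assumes "\<tau> n \<le> t" "t \<le> \<tau> (Suc n)"
  shows "interpolated x t = x n + ((t - \<tau> n) / a n) *\<^sub>R (x (Suc n) - x n)"
proof -
  have t: "t \<ge> 0" using assms(1) step_time_nonneg[of n] by linarith
  have formula: "interpolated x t = x k + ((t - \<tau> k) / a k) *\<^sub>R (x (Suc k) - x k)" if "step_index a t = k" for k
  proof -
    have "(\<tau> (Suc k) - t) / a k = 1 - (t - \<tau> k) / a k"
      using a_pos[of k] by (simp add: step_time_Suc field_simps)
    then have "interpolated x t = (1 - (t - \<tau> k) / a k) *\<^sub>R x k + ((t - \<tau> k) / a k) *\<^sub>R x (Suc k)"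
      using t that by (simp add: interpolated_def shifted_def interpolation_def Let_def)
    then show ?thesis unfolding scaleR_diff_left scaleR_diff_right by simp
  qed
  show ?thesis
  proof (cases "t = \<tau> (Suc n)")
    case True
    then have "step_index a t = Suc n" by simp
    from formula[OF this] True show ?thesis using a_pos[of n] by (simp add: step_time_Suc)
  next
    case False
    then show ?thesis using assms by (intro formula step_index_eqI) auto
  qed
qed

lemma interpolated_step_time [simp]: "interpolated x (\<tau> n) = x n"
  using interpolated_eq[of n "\<tau> n" x] by simp

lemma interpolated_neg: "t \<le> 0 \<Longrightarrow> interpolated x t = x 0"
  using interpolated_step_time[of x 0] by (cases "t = 0") (auto simp: interpolated_def shifted_def)

lemma shifted_eq_interpolated: "shifted a x n = (\<lambda>t. interpolated x (\<tau> n + t))"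
proof
  fix t show "shifted a x n t = interpolated x (\<tau> n + t)"
    using interpolated_neg[of "\<tau> n + t" x]
    by (cases "\<tau> n + t \<ge> 0") (auto simp: interpolated_def shifted_def add.commute)
qed

lemma dist_interpolated_node:
  assumes "t \<ge> 0"
  shows "dist (interpolated x t) (x (step_index a t)) \<le> dist (x (Suc (step_index a t))) (x (step_index a t))"
proof -
  let ?n = "step_index a t"
  have b: "\<tau> ?n \<le> t" "t \<le> \<tau> (Suc ?n)" using step_index_bounds[OF assms] by auto
  have "norm (((t - \<tau> ?n) / a ?n) *\<^sub>R (x (Suc ?n) - x ?n)) \<le> 1 * norm (x (Suc ?n) - x ?n)"
    unfolding norm_scaleR using b a_pos[of ?n] by (intro mult_right_mono) (auto simp: step_time_Suc field_simps)
  then show ?thesis by (simp add: interpolated_eq[OF b] dist_norm)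
qed

lemma bounded_interpolated:
  assumes "\<And>n. norm (x n) \<le> C"
  shows "norm (interpolated x t) \<le> 3 * C"
proof (cases "t \<ge> 0")
  case True
  let ?n = "step_index a t"
  have "norm (interpolated x t) \<le> norm (x ?n) + dist (x (Suc ?n)) (x ?n)"
    using dist_interpolated_node[OF True, of x] norm_triangle_ineq2[of "interpolated x t" "x ?n"] by (simp add: dist_norm)
  also have "dist (x (Suc ?n)) (x ?n) \<le> norm (x (Suc ?n)) + norm (x ?n)" by (simp add: dist_norm norm_triangle_ineq4)
  finally show ?thesis using assms[of ?n] assms[of "Suc ?n"] by linarith
next
  case False
  then show ?thesis using order_trans[OF norm_ge_zero assms] assms[of 0] by (simp add: interpolated_neg order_trans[of _ C])
qed

lemma continuous_interpolated: "continuous_on UNIV (interpolated x)"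
proof -
  have c: "continuous_on {..\<tau> n} (interpolated x)" for n
  proof (induction n)
    case 0
    have "continuous_on {..\<tau> 0} (\<lambda>t::real. x 0)" by simp
    then show ?case by (rule continuous_on_eq) (simp add: interpolated_neg)
  next
    case (Suc n)
    have "continuous_on {\<tau> n..\<tau> (Suc n)} (\<lambda>t. x n + ((t - \<tau> n) / a n) *\<^sub>R (x (Suc n) - x n))"
      using a_pos[of n] by (intro continuous_intros) auto
    then have "continuous_on {\<tau> n..\<tau> (Suc n)} (interpolated x)"
      by (rule continuous_on_eq) (metis atLeastAtMost_iff interpolated_eq)
    with Suc have "continuous_on ({..\<tau> n} \<union> {\<tau> n..\<tau> (Suc n)}) (interpolated x)"
      by (intro continuous_on_closed_Un) auto
    moreover have "{..\<tau> n} \<union> {\<tau> n..\<tau> (Suc n)} = {..\<tau> (Suc n)}"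
      using step_time_le_iff[of n "Suc n"] by (auto simp del: step_time_le_iff)
    ultimately show ?case by simp
  qed
  have "isCont (interpolated x) t" for t
  proof -
    have "eventually (\<lambda>n. t < \<tau> n) sequentially"
      using step_time_at_top by (simp add: filterlim_at_top_dense)
    then obtain n where n: "t < \<tau> n" unfolding eventually_sequentially by blast
    show ?thesis by (rule continuous_on_interior[OF c[of n]]) (use n in simp)
  qed
  then show ?thesis by (simp add: continuous_at_imp_continuous_on)
qed

lemma slowly_moving_increment_tendsto:
  assumes "slowly_moving x"
  shows "(\<lambda>n. dist (x (Suc n)) (x n)) \<longlonglongrightarrow> 0"
proof (rule tendstoI)
  fix \<epsilon> :: real assume \<epsilon>: "\<epsilon> > 0"
  obtain \<delta> N where \<delta>: "\<delta> > 0" and N: "\<And>n k. n \<ge> N \<Longrightarrow> k \<ge> n \<Longrightarrow> \<tau> k - \<tau> n \<le> \<delta> \<Longrightarrow> dist (x k) (x n) \<le> \<epsilon> / 2"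
    using assms half_gt_zero[OF \<epsilon>] unfolding slowly_moving_def by metis
  have "eventually (\<lambda>n. a n < \<delta>) sequentially" using a_lim \<delta> by (intro order_tendstoD(2)[of _ 0]) auto
  then show "eventually (\<lambda>n. dist (dist (x (Suc n)) (x n)) 0 < \<epsilon>) sequentially"
    using eventually_ge_at_top[of N]
  proof eventually_elim
    case (elim n)
    then have "dist (x (Suc n)) (x n) \<le> \<epsilon> / 2" by (intro N) (auto simp: step_time_Suc)
    then show ?case using \<epsilon> by simp
  qed
qed

lemma interpolated_node_tendsto:
  assumes "slowly_moving x"
  shows "((\<lambda>t. dist (interpolated x t) (x (step_index a t))) \<longlongrightarrow> 0) at_top"
    and "((\<lambda>t. dist (x (Suc (step_index a t))) (x (step_index a t))) \<longlongrightarrow> 0) at_top"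
proof -
  show *: "((\<lambda>t. dist (x (Suc (step_index a t))) (x (step_index a t))) \<longlongrightarrow> 0) at_top"
    by (rule filterlim_compose[OF slowly_moving_increment_tendsto[OF assms] step_index_at_top])
  show "((\<lambda>t. dist (interpolated x t) (x (step_index a t))) \<longlongrightarrow> 0) at_top"
    by (rule tendsto_sandwich[OF _ _ tendsto_const *])
      (auto intro: eventually_mono[OF eventually_ge_at_top[of 0]] dist_interpolated_node)
qed

text \<open>At late times the curve is close to the node before it, and nodes move slowly; the rest of
  the line is a compact interval and a half-line on which the curve is constant.\<close>

lemma uniformly_continuous_interpolated:
  assumes slow: "slowly_moving x"
  shows "uniformly_continuous_on UNIV (interpolated x)"
  unfolding uniformly_continuous_on_def
proof (intro allI impI)
  let ?Z = "interpolated x"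
  fix \<epsilon> :: real assume \<epsilon>: "\<epsilon> > 0"
  then have \<epsilon>4: "\<epsilon> / 4 > 0" by simp
  obtain \<delta> N where \<delta>: "\<delta> > 0" and N: "\<And>n k. n \<ge> N \<Longrightarrow> k \<ge> n \<Longrightarrow> \<tau> k - \<tau> n \<le> \<delta> \<Longrightarrow> dist (x k) (x n) \<le> \<epsilon> / 4"
    using slow \<epsilon>4 unfolding slowly_moving_def by metis
  have "eventually (\<lambda>n. a n < \<delta> / 2) sequentially" using a_lim \<delta> by (intro order_tendstoD(2)[of _ 0]) auto
  then obtain N' where N': "\<And>n. n \<ge> N' \<Longrightarrow> a n < \<delta> / 2" unfolding eventually_sequentially by blast
  have "eventually (\<lambda>t. dist (?Z t) (x (step_index a t)) < \<epsilon> / 4) at_top"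
    using order_tendstoD(2)[OF interpolated_node_tendsto(1)[OF slow] \<epsilon>4] .
  then obtain S0 where S0: "\<And>t. t \<ge> S0 \<Longrightarrow> dist (?Z t) (x (step_index a t)) < \<epsilon> / 4"
    unfolding eventually_at_top_linorder by blast
  define S where "S = max S0 (\<tau> (max N N'))"
  have S: "S \<ge> 0" "S \<ge> S0" "S \<ge> \<tau> (max N N')" using step_time_nonneg[of "max N N'"] unfolding S_def by linarith+
  have late: "dist (?Z t) (?Z s) < \<epsilon>" if st: "S \<le> s" "s \<le> t" "t - s < \<delta> / 2" for s t
  proof -
    let ?n = "step_index a s" and ?k = "step_index a t"
    have s0: "s \<ge> 0" "t \<ge> 0" using S st by auto
    have n: "?n \<ge> max N N'" using step_index_le_iff[OF s0(1), of "max N N'"] S st by simp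
    have "\<tau> ?n \<le> t" using step_index_bounds(1)[OF s0(1)] st by simp
    then have nk: "?n \<le> ?k" using step_index_le_iff[OF s0(2)] by simp
    have "s - \<tau> ?n < \<delta> / 2" using step_index_bounds(2)[OF s0(1)] N'[of ?n] n by (simp add: step_time_Suc)
    then have "\<tau> ?k - \<tau> ?n \<le> \<delta>" using step_index_bounds(1)[OF s0(2)] st by linarith
    then have "dist (x ?k) (x ?n) \<le> \<epsilon> / 4" using n nk by (intro N) auto
    moreover have "dist (?Z t) (x ?k) < \<epsilon> / 4" "dist (?Z s) (x ?n) < \<epsilon> / 4" using S st by (intro S0; linarith)+
    ultimately show ?thesis
      using dist_triangle[of "?Z t" "?Z s" "x ?k"] dist_triangle[of "x ?k" "?Z s" "x ?n"] dist_commute[of "?Z s" "x ?n"]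
        zero_le_dist[of "?Z t" "?Z s"] \<epsilon> by linarith
  qed
  have "uniformly_continuous_on {-1..S + 1} ?Z"
    by (intro compact_uniformly_continuous continuous_on_subset[OF continuous_interpolated]) auto
  then obtain d where d: "d > 0" "\<And>s t. s \<in> {-1..S+1} \<Longrightarrow> t \<in> {-1..S+1} \<Longrightarrow> dist t s < d \<Longrightarrow> dist (?Z t) (?Z s) < \<epsilon>"
    using \<epsilon> unfolding uniformly_continuous_on_def by metis
  define r where "r = min 1 (min d (\<delta> / 2))"
  have r: "r > 0" "r \<le> 1" "r \<le> d" "r \<le> \<delta> / 2" using d(1) \<delta> by (auto simp: r_def)
  have ordered: "dist (?Z t) (?Z s) < \<epsilon>" if st: "s \<le> t" "t - s < r" for s t
  proof -
    consider "S \<le> s" | "s < S" "-1 \<le> s" | "s < -1" by linarith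
    then show ?thesis
    proof cases
      case 1 then show ?thesis using late[of s t] st r by simp
    next
      case 2 then show ?thesis using d(2)[of s t] st r by (simp add: dist_real_def)
    next
      case 3 then show ?thesis using \<epsilon> st r by (simp add: interpolated_neg)
    qed
  qed
  have "dist (?Z t) (?Z s) < \<epsilon>" if "dist t s < r" for s t
    using ordered[of s t] ordered[of t s] that by (cases "s \<le> t") (auto simp: dist_real_def dist_commute)
  then show "\<exists>d>0. \<forall>s\<in>UNIV. \<forall>t\<in>UNIV. dist t s < d \<longrightarrow> dist (?Z t) (?Z s) < \<epsilon>"
    using r(1) by blast
qed

lemma weighted_mean_in_convex:
  assumes C: "convex C" and w: "\<And>i. i \<in> {n..<k} \<Longrightarrow> w i \<in> C" and nk: "n < k"
  shows "(\<Sum>i\<in>{n..<k}. a i *\<^sub>R w i) /\<^sub>R (\<tau> k - \<tau> n) \<in> C"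
proof -
  have pos: "\<tau> k - \<tau> n > 0" using nk by simp
  have "(\<Sum>i\<in>{n..<k}. (a i / (\<tau> k - \<tau> n)) *\<^sub>R w i) \<in> C"
  proof (rule convex_sum[OF _ C])
    show "(\<Sum>i\<in>{n..<k}. a i / (\<tau> k - \<tau> n)) = 1"
      using pos step_time_diff[of n k] nk by (simp add: sum_divide_distrib[symmetric])
    show "0 \<le> a i / (\<tau> k - \<tau> n)" if "i \<in> {n..<k}" for i
      using pos a_pos[of i] by simp
  qed (use w in auto)
  then show ?thesis by (simp add: scaleR_sum_right divide_inverse mult.commute)
qed

text \<open>Let \<open>n k\<close> and \<open>l k\<close> be the first node after \<open>s k + p\<close> and the last node up to \<open>s k + q\<close>. All
  nodes from \<open>n k\<close> to \<open>l k\<close> lie in \<open>U\<close> for large \<open>k\<close>, so that the weighted mean of the \<open>w i\<close> lies in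
  \<open>hull_image f U\<close>; and \<open>x (l k) - x (n k)\<close>, which differs from the weighted sum by negligible noise, tends to
  \<open>y q - y p\<close>.\<close>

lemma interpolated_limit_mean_value_path:
  fixes x :: "nat \<Rightarrow> 'b::euclidean_space"
  assumes slow: "slowly_moving x"
    and x: "\<And>i. x (Suc i) = x i + a i *\<^sub>R (w i + e i)"
    and w: "\<And>i. w i \<in> krasovskii f (x i)" and e: "negligible_noise e"
    and s: "filterlim s at_top sequentially"
    and y: "converges_locally_uniformly (\<lambda>k t. interpolated x (s k + t)) y"
  shows "mean_value_path f y"
  unfolding mean_value_path_def
proof (intro conjI allI impI)
  let ?Z = "interpolated x"
  have cZ: "continuous_on UNIV (\<lambda>t. ?Z (c + t))" for c
    by (auto intro!: continuous_on_compose2[of UNIV ?Z UNIV "\<lambda>t. c + t", OF continuous_interpolated] continuous_on_add continuous_on_const continuous_on_id)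
  show cy: "continuous_on UNIV y"
    by (rule converges_locally_uniformly_continuous[OF cZ y])
  fix p q :: real and U assume pq: "p < q" and U: "open U" "y ` {p..q} \<subseteq> U"
  have "eventually (\<lambda>k. (\<lambda>t. ?Z (s k + t)) ` {p..q} \<subseteq> U) sequentially"
    by (rule converges_locally_uniformly_eventually_subset[OF cy y U])
  have sp: "filterlim (\<lambda>k. s k + p) at_top sequentially" and sq: "filterlim (\<lambda>k. s k + q) at_top sequentially"
    using filterlim_tendsto_add_at_top[OF tendsto_const s] by (simp_all add: add.commute)
  \<comment> \<open>\<open>Suc\<close> because the node before \<open>s k + p\<close> may lie outside \<open>U\<close>\<close>
  define n where "n k = Suc (step_index a (s k + p))" for k
  define l where "l k = step_index a (s k + q)" for k
  have n': "filterlim (\<lambda>k. step_index a (s k + p)) at_top sequentially"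
    and l: "filterlim l at_top sequentially"
    unfolding l_def by (rule filterlim_compose[OF step_index_at_top sp], rule filterlim_compose[OF step_index_at_top sq])
  have n: "filterlim n at_top sequentially" unfolding n_def using n' by (rule filterlim_compose[OF filterlim_Suc])
  have pos: "eventually (\<lambda>k. 0 \<le> s k + p) sequentially" 
    using sp by (simp add: filterlim_at_top)
  have an: "(\<lambda>k. a (step_index a (s k + p))) \<longlonglongrightarrow> 0" and al: "(\<lambda>k. a (l k)) \<longlonglongrightarrow> 0"
    by (rule filterlim_compose[OF a_lim n'], rule filterlim_compose[OF a_lim l])
  have tn: "(\<lambda>k. \<tau> (n k) - (s k + p)) \<longlonglongrightarrow> 0"
  proof (rule tendsto_sandwich[OF _ _ tendsto_const an])
    show "eventually (\<lambda>k. 0 \<le> \<tau> (n k) - (s k + p)) sequentially" using pos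
      by eventually_elim (use step_index_bounds in \<open>force simp: n_def\<close>)
    show "eventually (\<lambda>k. \<tau> (n k) - (s k + p) \<le> a (step_index a (s k + p))) sequentially" using pos
      by eventually_elim (use step_index_bounds in \<open>force simp: n_def step_time_Suc\<close>)
  qed
  have tl: "(\<lambda>k. (s k + q) - \<tau> (l k)) \<longlonglongrightarrow> 0"
  proof (rule tendsto_sandwich[OF _ _ tendsto_const al])
    show "eventually (\<lambda>k. 0 \<le> (s k + q) - \<tau> (l k)) sequentially" using pos
      by eventually_elim (use step_index_bounds pq in \<open>force simp: l_def\<close>)
    show "eventually (\<lambda>k. (s k + q) - \<tau> (l k) \<le> a (l k)) sequentially" using pos
    proof eventually_elim
      case (elim k)
      then have "0 \<le> s k + q" using pq by simp
      from step_index_bounds(2)[OF this] show ?case by (simp add: l_def step_time_Suc)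
    qed
  qed
  have "(\<lambda>k. (q - p) - (\<tau> (n k) - (s k + p)) - ((s k + q) - \<tau> (l k))) \<longlonglongrightarrow> (q - p) - 0 - 0"
    by (intro tendsto_intros tn tl)
  then have len: "(\<lambda>k. \<tau> (l k) - \<tau> (n k)) \<longlonglongrightarrow> q - p" by (simp add: algebra_simps)
  have nl: "eventually (\<lambda>k. n k < l k) sequentially"
    using order_tendstoD(1)[OF len, of 0] pq by simp
  have xl: "(\<lambda>k. x (l k)) \<longlonglongrightarrow> y q"
  proof -
    have "(\<lambda>k. dist (?Z (s k + q)) (x (l k))) \<longlonglongrightarrow> 0"
      unfolding l_def by (rule filterlim_compose[OF interpolated_node_tendsto(1)[OF slow] sq])
    from tendsto_of_dist_tendsto_zero[OF converges_locally_uniformly_pointwise[OF y, of q] this] show ?thesis .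
  qed
  have xn: "(\<lambda>k. x (n k)) \<longlonglongrightarrow> y p"
  proof -
    have "(\<lambda>k. dist (?Z (s k + p)) (x (step_index a (s k + p)))) \<longlonglongrightarrow> 0"
      by (rule filterlim_compose[OF interpolated_node_tendsto(1)[OF slow] sp])
    from tendsto_of_dist_tendsto_zero[OF converges_locally_uniformly_pointwise[OF y, of p] this]
    have "(\<lambda>k. x (step_index a (s k + p))) \<longlonglongrightarrow> y p" .
    moreover have "(\<lambda>k. dist (x (step_index a (s k + p))) (x (n k))) \<longlonglongrightarrow> 0"
      unfolding n_def using filterlim_compose[OF interpolated_node_tendsto(2)[OF slow] sp] by (simp add: dist_commute)
    ultimately show ?thesis by (rule tendsto_of_dist_tendsto_zero)
  qed
  have E: "(\<lambda>k. \<Sum>i\<in>{n k..<l k}. a i *\<^sub>R e i) \<longlonglongrightarrow> 0"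
  proof (rule tendstoI)
    fix \<epsilon> :: real assume \<epsilon>: "\<epsilon> > 0"
    obtain N where N: "\<And>n k. N \<le> n \<Longrightarrow> n \<le> k \<Longrightarrow> \<tau> k - \<tau> n \<le> q - p + 1 \<Longrightarrow> norm (\<Sum>i\<in>{n..<k}. a i *\<^sub>R e i) \<le> \<epsilon> / 2"
      using negligible_noiseD[OF e half_gt_zero[OF \<epsilon>]] by metis
    have "eventually (\<lambda>k. n k \<ge> N) sequentially" using n by (simp add: filterlim_at_top)
    moreover have "eventually (\<lambda>k. \<tau> (l k) - \<tau> (n k) < q - p + 1) sequentially"
      by (rule order_tendstoD(2)[OF len]) simp
    ultimately show "eventually (\<lambda>k. dist (\<Sum>i\<in>{n k..<l k}. a i *\<^sub>R e i) 0 < \<epsilon>) sequentially"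
      using nl
    proof eventually_elim
      case (elim k)
      then have "norm (\<Sum>i\<in>{n k..<l k}. a i *\<^sub>R e i) \<le> \<epsilon> / 2" by (intro N) auto
      then show ?case using \<epsilon> by simp
    qed
  qed
  have W: "eventually (\<lambda>k. (\<Sum>i\<in>{n k..<l k}. a i *\<^sub>R w i) = x (l k) - x (n k) - (\<Sum>i\<in>{n k..<l k}. a i *\<^sub>R e i)) sequentially"
    using nl
  proof eventually_elim
    case (elim k)
    then show ?case
      using increments_sum[of x "\<lambda>i. w i + e i" "n k" "l k", OF x] by (simp add: scaleR_add_right sum.distrib)
  qed
  have "(\<lambda>k. (x (l k) - x (n k) - (\<Sum>i\<in>{n k..<l k}. a i *\<^sub>R e i)) /\<^sub>R (\<tau> (l k) - \<tau> (n k))) \<longlonglongrightarrow> (y q - y p - 0) /\<^sub>R (q - p)"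
    using pq by (intro tendsto_intros xl xn E len) auto
  then have lim: "(\<lambda>k. (x (l k) - x (n k) - (\<Sum>i\<in>{n k..<l k}. a i *\<^sub>R e i)) /\<^sub>R (\<tau> (l k) - \<tau> (n k))) \<longlonglongrightarrow> (y q - y p) /\<^sub>R (q - p)"
    by simp
  have "eventually (\<lambda>k. (x (l k) - x (n k) - (\<Sum>i\<in>{n k..<l k}. a i *\<^sub>R e i)) /\<^sub>R (\<tau> (l k) - \<tau> (n k)) \<in> hull_image f U) sequentially"
    using W nl \<open>eventually (\<lambda>k. (\<lambda>t. ?Z (s k + t)) ` {p..q} \<subseteq> U) sequentially\<close> pos
  proof eventually_elim
    case (elim k)
    have "w i \<in> hull_image f U" if i: "i \<in> {n k..<l k}" for i
    proof -
      have "\<tau> i \<ge> \<tau> (n k)" "\<tau> i \<le> \<tau> (l k)" using i by auto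
      moreover have "s k + p < \<tau> (n k)" "\<tau> (l k) \<le> s k + q"
        using step_index_bounds(2)[of "s k + p"] step_index_bounds(1)[of "s k + q"] elim(4) pq unfolding n_def l_def by auto
      ultimately have "\<tau> i - s k \<in> {p..q}" unfolding atLeastAtMost_iff by linarith
      then have "?Z (s k + (\<tau> i - s k)) \<in> U" using elim(3) by blast
      then have "x i \<in> U" by simp
      then show ?thesis using w[of i] krasovskii_subset_hull_image[OF U(1)] by blast
    qed
    then have "(\<Sum>i\<in>{n k..<l k}. a i *\<^sub>R w i) /\<^sub>R (\<tau> (l k) - \<tau> (n k)) \<in> hull_image f U"
      by (rule weighted_mean_in_convex[OF convex_closure[OF convex_convex_hull] _ elim(2)])
    then show ?case unfolding elim(1) .
  qed
  then show "(y q - y p) /\<^sub>R (q - p) \<in> hull_image f U"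
    using lim by (intro Lim_in_closed_set[of "hull_image f U" _ sequentially]) auto
qed

lemma interpolated_asymptotic_solution:
  fixes x :: "nat \<Rightarrow> 'b::euclidean_space"
  assumes f: "locally_bounded f" and bd: "bounded (range x)"
    and x: "\<And>i. x (Suc i) = x i + a i *\<^sub>R (w i + e i)"
    and w: "\<And>i. w i \<in> krasovskii f (x i)" and e: "negligible_noise e"
  shows "asymptotic_solution f (interpolated x)"
proof -
  obtain C where C: "\<And>i. norm (x i) \<le> C" using bd unfolding bounded_iff by auto
  obtain K where "\<And>i. norm (w i) \<le> K"
    using krasovskii_bounded_along[OF f bd w] unfolding bounded_iff by auto
  then have slow: "slowly_moving x" by (rule slowly_moving_of_increments[OF x _ e])
  have "bounded (range (interpolated x))"
    using bounded_interpolated[of x C, OF C] unfolding bounded_iff by auto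
  then show ?thesis
    unfolding asymptotic_solution_def
    using uniformly_continuous_interpolated[OF slow] interpolated_limit_mean_value_path[OF slow x w e] by blast
qed

end

section \<open>Consequences for a sample path\<close>

context step_sizes
begin

lemma scheme_asymptotic_solution:
  fixes x :: "nat \<Rightarrow> 'a::euclidean_space" and bbar hbar :: "'a \<Rightarrow> 'a"
  assumes bbar: "locally_bounded bbar" and hbar: "continuous_on UNIV hbar"
    and bd: "bounded (range x)"
    and x: "\<And>i. x (Suc i) = x i + a i *\<^sub>R (u i + hbar (x i) + g (x i) i + r i)"
    and u: "\<And>i. u i \<in> krasovskii bbar (x i)"
    and g: "continuous_uniformly_on_bounded g UNIV" and avg: "\<And>y. negligible_noise (g y)"
    and r: "negligible_noise r"
  shows "asymptotic_solution (\<lambda>y. bbar y + hbar y) (interpolated x)"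
proof -
  have f: "locally_bounded (\<lambda>y. bbar y + hbar y)" by (rule locally_bounded_add_continuous[OF bbar hbar])
  have w: "u i + hbar (x i) \<in> krasovskii (\<lambda>y. bbar y + hbar y) (x i)" for i
    using hbar by (intro krasovskii_add_continuous u) (simp add: continuous_on_eq_continuous_at)
  have "negligible_noise (\<lambda>i. g (x i) i)"
    by (rule negligible_noise_along_iterates[OF g avg x bd krasovskii_bounded_along[OF f bd w] r])
  then have "negligible_noise (\<lambda>i. g (x i) i + r i)" by (intro negligible_noise_add r)
  then show ?thesis
    using x by (intro interpolated_asymptotic_solution[OF f bd _ w]) (simp_all add: add.assoc)
qed

lemma asymptotic_solution_shifted_bounded:
  assumes "asymptotic_solution f (interpolated x)"
  shows "\<exists>C. \<forall>n t. norm (shifted a x n t) \<le> C"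
  using assms unfolding asymptotic_solution_def bounded_iff shifted_eq_interpolated by auto

lemma asymptotic_solution_shifted_equicontinuous:
  assumes "asymptotic_solution f (interpolated x)"
  shows "equicontinuous_on S (shifted a x)"
  unfolding equicontinuous_on_def
proof (intro allI impI)
  fix e :: real assume "e > 0"
  then obtain d where d: "d > 0" "\<And>s t. dist s t < d \<Longrightarrow> dist (interpolated x s) (interpolated x t) < e"
    using assms unfolding asymptotic_solution_def uniformly_continuous_on_def by (metis UNIV_I)
  show "\<exists>d>0. \<forall>n. \<forall>s\<in>S. \<forall>t\<in>S. dist s t < d \<longrightarrow> dist (shifted a x n s) (shifted a x n t) < e"
  proof (intro exI[of _ d] conjI allI ballI impI d(1))
    fix n and s t :: real assume "dist s t < d"
    then have "dist (\<tau> n + s) (\<tau> n + t) < d" by (simp add: dist_real_def)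
    then show "dist (shifted a x n s) (shifted a x n t) < e" unfolding shifted_eq_interpolated by (rule d(2))
  qed
qed

lemma step_time_subseq_at_top: "strict_mono (r :: nat \<Rightarrow> nat) \<Longrightarrow> filterlim (\<lambda>k. \<tau> (r k)) at_top sequentially"
  by (rule filterlim_compose[OF step_time_at_top filterlim_subseq])

text \<open>The limit is again an asymptotic solution, so the result on limit sets applies to it as well as
  to the interpolated iterates.\<close>

lemma limit_of_shifted:
  assumes f: "locally_bounded f" and Z: "asymptotic_solution f (interpolated x)"
    and r: "strict_mono (r :: nat \<Rightarrow> nat)" and y: "converges_locally_uniformly (\<lambda>k. shifted a x (r k)) y"
  shows "solution_on (krasovskii f) UNIV y \<and> internally_chain_transitive (krasovskii f) (limit_set y)"
proof -
  have y': "converges_locally_uniformly (\<lambda>k t. interpolated x (\<tau> (r k) + t)) y"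
    using y unfolding shifted_eq_interpolated .
  have mv: "mean_value_path f y"
    using Z step_time_subseq_at_top[OF r] y' unfolding asymptotic_solution_def by blast
  obtain C where C: "\<And>t. norm (interpolated x t) \<le> C"
    using Z unfolding asymptotic_solution_def bounded_iff by auto
  have "norm (y t) \<le> C" for t
    by (rule tendsto_upperbound[OF tendsto_norm[OF converges_locally_uniformly_pointwise[OF y', of t]]]) (use C in auto)
  then have bd: "bounded (range y)" unfolding bounded_iff by auto
  show ?thesis
    using mean_value_path_solution[OF f mv bd]
      limit_set_internally_chain_transitive[OF f mean_value_path_asymptotic_solution[OF f mv bd]] by blast
qed

lemma limit_point_chain_recurrent:
  assumes f: "locally_bounded f" and Z: "asymptotic_solution f (interpolated x)"
    and r: "strict_mono (r :: nat \<Rightarrow> nat)" and lim: "(\<lambda>k. x (r k)) \<longlonglongrightarrow> \<theta>"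
  shows "\<theta> \<in> chain_recurrent_points (krasovskii f)"
proof -
  have "\<theta> \<in> limit_set (interpolated x)"
    by (rule limit_set_seqI[OF step_time_subseq_at_top[OF r]]) (use lim in simp)
  then show ?thesis using limit_set_chain_recurrent[OF f Z] by blast
qed

lemma recurrent_visits_converge:
  assumes f: "locally_bounded f" and Z: "asymptotic_solution f (interpolated x)"
    and las: "locally_asymptotically_stable (krasovskii f) \<Lambda>"
    and C: "compact C" "C \<subseteq> domain_of_attraction (krasovskii f) \<Lambda>"
    and visits: "\<exists>\<^sub>\<infinity>n. x n \<in> C"
  shows "converges_to_set x \<Lambda> sequentially"
proof -
  have inf: "infinite {n. x n \<in> C}" using visits by (simp add: frequently_cofinite)
  define e where "e = enumerate {n. x n \<in> C}"
  have e: "strict_mono e" "\<And>k. x (e k) \<in> C"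
    using strict_mono_enumerate[OF inf] enumerate_in_set[OF inf] by (auto simp: e_def)
  obtain p r where p: "p \<in> C" and r: "strict_mono (r :: nat \<Rightarrow> nat)" "((\<lambda>k. x (e k)) \<circ> r) \<longlonglongrightarrow> p"
    using C(1) e(2) unfolding compact_def by meson
  have "converges_to_set (interpolated x) \<Lambda> at_top"
  proof (rule asymptotic_solution_converges_to_attractor[OF f Z las])
    show "filterlim (\<lambda>k. \<tau> ((e \<circ> r) k)) at_top sequentially"
      by (rule step_time_subseq_at_top[OF strict_mono_o[OF e(1) r(1)]])
    show "(\<lambda>k. interpolated x (\<tau> ((e \<circ> r) k))) \<longlonglongrightarrow> p" using r(2) by (simp add: o_def)
    show "p \<in> domain_of_attraction (krasovskii f) \<Lambda>" using p C(2) by blast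
  qed
  from filterlim_compose[OF this[unfolded converges_to_set_def] step_time_at_top]
  show ?thesis unfolding converges_to_set_def by simp
qed

end

section \<open>Almost sure negligibility of the noise\<close>

text \<open>The supremum over \<open>t\<close> runs over uncountably many times but only countably many windows.\<close>

lemma measurable_window_sup:
  fixes S :: "'w \<Rightarrow> nat set \<Rightarrow> real"
  assumes "\<And>p q. (\<lambda>\<omega>. S \<omega> {p..<q}) \<in> borel_measurable M"
  shows "(\<lambda>\<omega>. window_sup a T n (S \<omega>)) \<in> borel_measurable M"
proof -
  let ?I = "\<lambda>j. (\<lambda>t. step_index a (real j * T + t)) ` {0..T}"
  have eq: "window_sup a T n (S \<omega>) =
      (SUP j\<in>{n..}. SUP q\<in>?I j. ereal (S \<omega> {step_index a (real j * T)..<q}))" for \<omega>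
    unfolding window_sup_def by (simp add: image_image)
  show ?thesis unfolding eq
    by (intro borel_measurable_SUP borel_measurable_ereal assms) auto
qed

lemma AE_window_sup_small:
  fixes S :: "'w \<Rightarrow> nat set \<Rightarrow> real"
  assumes M: "prob_space M"
    and meas: "\<And>p q. (\<lambda>\<omega>. S \<omega> {p..<q}) \<in> borel_measurable M"
    and lim: "\<And>\<epsilon>. \<epsilon> > 0 \<Longrightarrow> (\<lambda>n. \<P>(\<omega> in M. window_sup a T n (S \<omega>) \<ge> ereal \<epsilon>)) \<longlonglongrightarrow> 0"
  shows "AE \<omega> in M. \<forall>\<epsilon>>0. \<exists>n. window_sup a T n (S \<omega>) < ereal \<epsilon>"
proof -
  interpret prob_space M by (rule M)
  have [measurable]: "(\<lambda>\<omega>. window_sup a T n (S \<omega>)) \<in> borel_measurable M" for n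
    by (rule measurable_window_sup[where S=S]) (rule meas)
  have "AE \<omega> in M. \<exists>n. window_sup a T n (S \<omega>) < ereal (1 / Suc k)" for k
  proof -
    let ?A = "{\<omega>\<in>space M. \<forall>n. window_sup a T n (S \<omega>) \<ge> ereal (1 / Suc k)}"
    have "prob ?A \<le> prob {\<omega>\<in>space M. window_sup a T n (S \<omega>) \<ge> ereal (1 / Suc k)}" for n
      by (intro finite_measure_mono) auto
    then have "prob ?A \<le> 0"
      using lim[of "1 / Suc k"] by (intro tendsto_lowerbound[of _ 0 sequentially]) auto
    then have "prob ?A = 0" by (simp add: measure_le_0_iff)
    then have "AE \<omega> in M. \<omega> \<notin> ?A" by (subst (asm) prob_eq_0) auto
    then show ?thesis by (rule AE_mp) (auto simp: not_le)
  qed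
  then have "AE \<omega> in M. \<forall>k. \<exists>n. window_sup a T n (S \<omega>) < ereal (1 / Suc k)"
    by (simp add: AE_all_countable)
  then show ?thesis
  proof eventually_elim
    case (elim \<omega>)
    show ?case
    proof (intro allI impI)
      fix \<epsilon> :: real assume "\<epsilon> > 0"
      then obtain k where k: "1 / real (Suc k) < \<epsilon>" using nat_approx_posE by blast
      obtain n where "window_sup a T n (S \<omega>) < ereal (1 / Suc k)" using elim by blast
      also have "\<dots> < ereal \<epsilon>" using k by simp
      finally show "\<exists>n. window_sup a T n (S \<omega>) < ereal \<epsilon>" by blast
    qed
  qed
qed

context step_sizes
begin

text \<open>The windows in \<open>window_sup\<close> start at multiples of \<open>T\<close>, which need not be nodes. A window of length at most \<open>T\<close>
  between two nodes meets at most two intervals of this grid, so its sum is a combination of three grid sums.\<close>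

lemma negligible_noise_of_window_sup:
  fixes e :: "nat \<Rightarrow> 'b::real_normed_vector"
  assumes T: "T > 0"
    and sup: "\<And>\<epsilon>. \<epsilon> > 0 \<Longrightarrow> \<exists>n. window_sup a T n (\<lambda>I. norm (\<Sum>i\<in>I. a i *\<^sub>R e i)) < ereal \<epsilon>"
  shows "negligible_noise e"
proof (rule negligible_noise_local)
  let ?m = "\<lambda>j. step_index a (real j * T)"
  fix c :: real assume c: "c > 0"
  show "\<exists>\<delta>>0. \<forall>\<eta>>0. \<exists>N. \<forall>n\<ge>N. \<forall>k\<ge>n. \<tau> k - \<tau> n \<le> \<delta> \<longrightarrow>
     norm (\<Sum>i\<in>{n..<k}. a i *\<^sub>R e i) \<le> c * (\<tau> k - \<tau> n) + \<eta>"
  proof (intro exI[of _ T] conjI allI impI T)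
    fix \<eta> :: real assume \<eta>: "\<eta> > 0"
    define \<epsilon> where "\<epsilon> = \<eta> / 3"
    have \<epsilon>: "\<epsilon> > 0" using \<eta> by (simp add: \<epsilon>_def)
    obtain J where J: "window_sup a T J (\<lambda>I. norm (\<Sum>i\<in>I. a i *\<^sub>R e i)) < ereal \<epsilon>" using sup[OF \<epsilon>] by blast
    have win: "norm (\<Sum>i\<in>{?m j..<k}. a i *\<^sub>R e i) < \<epsilon>"
      if j: "j \<ge> J" and k: "step_index a (real j * T + t) = k" "0 \<le> t" "t \<le> T" for j k t
    proof -
      have "ereal (norm (\<Sum>i\<in>{?m j..<k}. a i *\<^sub>R e i)) \<le> window_sup a T J (\<lambda>I. norm (\<Sum>i\<in>I. a i *\<^sub>R e i))"
        unfolding window_sup_def k(1)[symmetric]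
      proof (rule SUP_upper2)
        show "j \<in> {J..}" using j by simp
        show "ereal (norm (\<Sum>i\<in>{?m j..<step_index a (real j * T + t)}. a i *\<^sub>R e i)) \<le>
          (SUP t\<in>{0..T}. ereal (norm (\<Sum>i\<in>{?m j..<step_index a (real j * T + t)}. a i *\<^sub>R e i)))"
          by (rule SUP_upper) (use k in auto)
      qed
      also note J
      finally show ?thesis by simp
    qed
    have "eventually (\<lambda>n. \<tau> n \<ge> real J * T) sequentially" using step_time_at_top by (simp add: filterlim_at_top)
    then obtain N where N: "\<tau> N \<ge> real J * T" unfolding eventually_sequentially by blast
    show "\<exists>N. \<forall>n\<ge>N. \<forall>k\<ge>n. \<tau> k - \<tau> n \<le> T \<longrightarrow> norm (\<Sum>i\<in>{n..<k}. a i *\<^sub>R e i) \<le> c * (\<tau> k - \<tau> n) + \<eta>"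
    proof (intro exI[of _ N] allI impI)
      fix n k assume n: "N \<le> n" and nk: "n \<le> k" "\<tau> k - \<tau> n \<le> T"
      let ?s = "\<lambda>p q. \<Sum>i\<in>{p..<q}. a i *\<^sub>R e i"
      define j where "j = nat \<lfloor>\<tau> n / T\<rfloor>"
      have "real j = of_int \<lfloor>\<tau> n / T\<rfloor>" using T unfolding j_def by simp
      then have "real j \<le> \<tau> n / T" "\<tau> n / T < real j + 1" by linarith+
      then have j: "real j * T \<le> \<tau> n" "\<tau> n < real (Suc j) * T" using T by (auto simp: field_simps)
      have "real J * T \<le> \<tau> n" using N n order_trans[of _ "\<tau> N" "\<tau> n"] by simp
      then have "real J * T < real (Suc j) * T" using j(2) by linarith
      then have jJ: "j \<ge> J" using T by simp
      have jT0: "0 \<le> real j * T" "0 \<le> real (Suc j) * T" using T by auto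
      have mj: "?m j \<le> n" using step_index_bounds(1)[OF jT0(1)] j(1) order_trans[of "\<tau> (?m j)" _ "\<tau> n"] by simp
      have n1: "norm (?s (?m j) n) < \<epsilon>"
        by (rule win[OF jJ, of "\<tau> n - real j * T"]) (use j in \<open>auto simp: algebra_simps\<close>)
      have "norm (?s n k) \<le> 3 * \<epsilon>"
      proof (cases "\<tau> k \<le> real (Suc j) * T")
        case True
        have "\<tau> n \<le> \<tau> k" using nk by simp
        then have "real j * T \<le> \<tau> k" using j(1) by linarith
        then have "norm (?s (?m j) k) < \<epsilon>"
          using True by (intro win[OF jJ, of "\<tau> k - real j * T"]) (auto simp: algebra_simps)
        moreover have "?s n k = ?s (?m j) k - ?s (?m j) n"
          using mj nk by (simp add: sum.atLeastLessThan_concat[of "?m j" n k, symmetric])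
        ultimately show ?thesis
          using n1 norm_triangle_ineq4[of "?s (?m j) k" "?s (?m j) n"] \<epsilon> by simp
      next
        case False
        have "\<tau> n < \<tau> (Suc (?m (Suc j)))" using step_index_bounds(2)[OF jT0(2)] j(2) by linarith
        then have nm: "n \<le> ?m (Suc j)" by simp
        have "\<tau> (?m (Suc j)) < \<tau> k" using step_index_bounds(1)[OF jT0(2)] False by linarith
        then have mk: "?m (Suc j) \<le> k" by simp
        have k1: "norm (?s (?m (Suc j)) k) < \<epsilon>"
          using False j nk jJ by (intro win[of "Suc j" "\<tau> k - real (Suc j) * T"]) (auto simp: algebra_simps)
        have "norm (?s (?m j) (?m (Suc j))) < \<epsilon>"
          using T by (intro win[OF jJ, of T]) (auto simp: algebra_simps)
        moreover have s1: "?s (?m j) n + ?s n (?m (Suc j)) = ?s (?m j) (?m (Suc j))"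
          by (rule sum.atLeastLessThan_concat[OF mj nm])
        have s2: "?s n (?m (Suc j)) + ?s (?m (Suc j)) k = ?s n k"
          by (rule sum.atLeastLessThan_concat[OF nm mk])
        have eq: "?s n k = ?s (?m j) (?m (Suc j)) - ?s (?m j) n + ?s (?m (Suc j)) k"
          unfolding s1[symmetric] s2[symmetric] by simp
        have "norm (?s n k) \<le> norm (?s (?m j) (?m (Suc j))) + norm (?s (?m j) n) + norm (?s (?m (Suc j)) k)"
          unfolding eq using norm_triangle_ineq[of "?s (?m j) (?m (Suc j)) - ?s (?m j) n" "?s (?m (Suc j)) k"]
            norm_triangle_ineq4[of "?s (?m j) (?m (Suc j))" "?s (?m j) n"] by linarith
        ultimately show ?thesis using n1 k1 by linarith
      qed
      moreover have "c * (\<tau> k - \<tau> n) \<ge> 0" using c nk by simp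
      ultimately show "norm (?s n k) \<le> c * (\<tau> k - \<tau> n) + \<eta>" by (simp add: \<epsilon>_def)
    qed
  qed
qed

lemma AE_negligible_noise:
  fixes e :: "nat \<Rightarrow> 'w \<Rightarrow> 'b::euclidean_space"
  assumes M: "prob_space M" and T: "T > 0" and meas: "\<And>i. e i \<in> borel_measurable M"
    and lim: "\<And>\<epsilon>. \<epsilon> > 0 \<Longrightarrow>
      (\<lambda>n. \<P>(\<omega> in M. window_sup a T n (\<lambda>I. norm (\<Sum>i\<in>I. a i *\<^sub>R e i \<omega>)) \<ge> ereal \<epsilon>)) \<longlonglongrightarrow> 0"
  shows "AE \<omega> in M. negligible_noise (\<lambda>i. e i \<omega>)"
proof -
  have "AE \<omega> in M. \<forall>\<epsilon>>0. \<exists>n. window_sup a T n (\<lambda>I. norm (\<Sum>i\<in>I. a i *\<^sub>R e i \<omega>)) < ereal \<epsilon>"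
    using meas by (intro AE_window_sup_small[where S="\<lambda>\<omega> I. norm (\<Sum>i\<in>I. a i *\<^sub>R e i \<omega>)", OF M _ lim]) auto
  then show ?thesis by eventually_elim (rule negligible_noise_of_window_sup[OF T], blast)
qed

text \<open>A single null set serves all \<open>x\<close>: it is chosen for a countable dense set of points, and equicontinuity does the rest.\<close>

lemma AE_all_negligible_noise:
  fixes g :: "'a::euclidean_space \<Rightarrow> nat \<Rightarrow> 'w \<Rightarrow> 'b::real_normed_vector"
  assumes AE: "\<And>x. AE \<omega> in M. negligible_noise (\<lambda>i. g x i \<omega>)"
    and cont: "\<And>x e. e > 0 \<Longrightarrow> \<exists>d>0. \<forall>y. dist y x < d \<longrightarrow> (\<forall>i. \<forall>\<omega>\<in>space M. dist (g y i \<omega>) (g x i \<omega>) < e)"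
  shows "AE \<omega> in M. \<forall>x. negligible_noise (\<lambda>i. g x i \<omega>)"
proof -
  obtain D :: "'a set" where D: "countable D" "\<And>U. open U \<Longrightarrow> U \<noteq> {} \<Longrightarrow> \<exists>d\<in>D. d \<in> U"
    by (rule countable_dense_setE) (rule that)
  have "AE \<omega> in M. \<forall>x\<in>D. negligible_noise (\<lambda>i. g x i \<omega>)"
    using AE D(1) by (simp add: AE_ball_countable)
  then show ?thesis using AE_space
  proof eventually_elim
    case (elim \<omega>)
    show ?case
    proof (intro allI negligible_noise_approx)
      fix x :: 'a and c :: real assume "c > 0"
      then obtain d where d: "d > 0" "\<And>y i. dist y x < d \<Longrightarrow> dist (g y i \<omega>) (g x i \<omega>) < c"
        using cont[of c x] elim(2) by blast
      obtain q where q: "q \<in> D" "q \<in> ball x d" using D(2)[of "ball x d"] d(1) by auto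
      then have "norm (g x i \<omega> - g q i \<omega>) \<le> c + 0" for i
        using d(2)[of q i] by (simp add: dist_norm norm_minus_commute less_imp_le)
      then show "\<exists>e' G. negligible_noise e' \<and> negligible_noise G \<and>
          (\<forall>\<^sub>F i in sequentially. norm (g x i \<omega> - e' i) \<le> c + G i)"
        using elim(1) q(1) by (intro exI[of _ "\<lambda>i. g q i \<omega>"] exI[of _ "\<lambda>_. 0"]) (simp add: negligible_noise_zero)
    qed
  qed
qed

end

section \<open>The stochastic approximation theorem\<close>

lemma continuous_uniformly_on_bounded_diff:
  fixes h :: "'a::euclidean_space \<Rightarrow> 'z \<Rightarrow> 'b::real_normed_vector" and k :: "'a \<Rightarrow> 'b"
  assumes h: "continuous_uniformly_on_bounded h Q" and k: "continuous_on UNIV k"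
  shows "continuous_uniformly_on_bounded (\<lambda>x z. h x z - k x) Q"
  unfolding continuous_uniformly_on_bounded_def
proof (intro allI impI)
  fix S :: "'a set" and e :: real assume S: "bounded S" and "e > 0"
  then have e: "e / 2 > 0" by simp
  obtain d1 where d1: "d1 > 0" "\<And>x y z. x \<in> S \<Longrightarrow> y \<in> S \<Longrightarrow> dist x y < d1 \<Longrightarrow> z \<in> Q \<Longrightarrow> dist (h x z) (h y z) < e / 2"
    using h S e unfolding continuous_uniformly_on_bounded_def by meson
  have "uniformly_continuous_on (closure S) k"
    using S by (intro compact_uniformly_continuous continuous_on_subset[OF k]) auto
  then obtain d2 where d2: "d2 > 0" "\<And>x y. x \<in> closure S \<Longrightarrow> y \<in> closure S \<Longrightarrow> dist x y < d2 \<Longrightarrow> dist (k x) (k y) < e / 2"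
    using e unfolding uniformly_continuous_on_def by metis
  show "\<exists>d>0. \<forall>x\<in>S. \<forall>y\<in>S. dist x y < d \<longrightarrow> (\<forall>z\<in>Q. dist (h x z - k x) (h y z - k y) < e)"
  proof (intro exI[of _ "min d1 d2"] conjI ballI impI)
    fix x y z assume xy: "x \<in> S" "y \<in> S" "dist x y < min d1 d2" and z: "z \<in> Q"
    have "dist (h x z) (h y z) < e / 2" using d1(2) xy z by simp
    moreover have "dist (k x) (k y) < e / 2" using d2(2) xy closure_subset[of S] by (simp add: subset_iff)
    ultimately show "dist (h x z - k x) (h y z - k y) < e"
      using norm_triangle_ineq4[of "h x z - h y z" "k x - k y"] by (simp add: dist_norm algebra_simps)
  qed (use d1 d2 in simp)
qed

lemma continuous_uniformly_on_boundedD: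
  fixes h :: "'a::euclidean_space \<Rightarrow> 'z \<Rightarrow> 'b::metric_space"
  assumes "continuous_uniformly_on_bounded h Q" "e > 0"
  shows "\<exists>d>0. \<forall>y. dist y x < d \<longrightarrow> (\<forall>z\<in>Q. dist (h y z) (h x z) < e)"
proof -
  have "bounded (ball x 1)" by simp
  then obtain d where d: "d > 0" "\<And>u v. u \<in> ball x 1 \<Longrightarrow> v \<in> ball x 1 \<Longrightarrow> dist u v < d \<Longrightarrow> \<forall>z\<in>Q. dist (h u z) (h v z) < e"
    using assms unfolding continuous_uniformly_on_bounded_def by meson
  then show ?thesis
    by (intro exI[of _ "min d 1"]) (auto simp: dist_commute)
qed

lemma converges_to_set_measurable:
  assumes X: "\<And>n. X n \<in> borel_measurable M"
  shows "{\<omega>\<in>space M. converges_to_set (\<lambda>n. X n \<omega>) \<Lambda> sequentially} \<in> sets M"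
proof -
  have [measurable]: "(\<lambda>\<omega>. infdist (X n \<omega>) \<Lambda>) \<in> borel_measurable M" for n
    by (rule borel_measurable_continuous_on[OF _ X]) (intro continuous_intros)
  have "converges_to_set (\<lambda>n. X n \<omega>) \<Lambda> sequentially \<longleftrightarrow> (\<forall>k. \<exists>N. \<forall>n\<ge>N. infdist (X n \<omega>) \<Lambda> < 1 / real (Suc k))" for \<omega>
  proof
    assume "converges_to_set (\<lambda>n. X n \<omega>) \<Lambda> sequentially"
    then have "\<forall>\<^sub>F n in sequentially. infdist (X n \<omega>) \<Lambda> < 1 / real (Suc k)" for k
      unfolding converges_to_set_def by (intro order_tendstoD(2)[of _ 0]) auto
    then show "\<forall>k. \<exists>N. \<forall>n\<ge>N. infdist (X n \<omega>) \<Lambda> < 1 / real (Suc k)" unfolding eventually_sequentially by blast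
  next
    assume *: "\<forall>k. \<exists>N. \<forall>n\<ge>N. infdist (X n \<omega>) \<Lambda> < 1 / real (Suc k)"
    show "converges_to_set (\<lambda>n. X n \<omega>) \<Lambda> sequentially"
      unfolding converges_to_set_def
    proof (rule LIMSEQ_I)
      fix e :: real assume "e > 0"
      then obtain k where k: "1 / real (Suc k) < e" using nat_approx_posE by blast
      obtain N where "\<forall>n\<ge>N. infdist (X n \<omega>) \<Lambda> < 1 / real (Suc k)" using * by blast
      then show "\<exists>N. \<forall>n\<ge>N. norm (infdist (X n \<omega>) \<Lambda> - 0) < e"
        using k by (intro exI[of _ N]) (auto simp: infdist_nonneg intro: less_trans)
    qed
  qed
  then show ?thesis by simp
qed

theorem theorem2p1:
  fixes M :: "'w measure"
    and N\<^sub>\<xi> :: "'x measure" and N\<^sub>\<zeta> :: "'z measure" and N\<^sub>\<eta> :: "'y measure"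
    and a :: "nat \<Rightarrow> real"
    and X :: "nat \<Rightarrow> 'w \<Rightarrow> 'a::euclidean_space"
    and \<xi> :: "nat \<Rightarrow> 'w \<Rightarrow> 'x" and \<zeta> :: "nat \<Rightarrow> 'w \<Rightarrow> 'z" and \<eta> :: "nat \<Rightarrow> 'w \<Rightarrow> 'y"
    and b :: "nat \<Rightarrow> 'a \<Rightarrow> 'x \<Rightarrow> 'a" and h :: "'a \<Rightarrow> 'z \<Rightarrow> 'a" and h\<^sub>0 :: "'y \<Rightarrow> 'a"
    and \<beta> :: "nat \<Rightarrow> 'w \<Rightarrow> 'a"
    and hbar bbar :: "'a \<Rightarrow> 'a" and m :: "nat \<Rightarrow> 'a \<Rightarrow> 'x \<Rightarrow> real"
  assumes prob: "prob_space M" and complete: "complete_measure M"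
    and a_pos: "\<And>n. a n > 0" and a_lim: "a \<longlonglongrightarrow> 0"
    and a_sum: "filterlim (\<lambda>n. \<Sum>i<n. a i) at_top sequentially"
    and X_rv: "\<And>n. X n \<in> borel_measurable M"
    and \<xi>_rv: "\<And>n. \<xi> n \<in> measurable M N\<^sub>\<xi>"
    and \<zeta>_rv: "\<And>n. \<zeta> n \<in> measurable M N\<^sub>\<zeta>"
    and \<eta>_rv: "\<And>n. \<eta> n \<in> measurable M N\<^sub>\<eta>"
    and h_meas: "\<And>x. h x \<in> borel_measurable N\<^sub>\<zeta>"
    and m_meas: "\<And>n x. m n x \<in> borel_measurable N\<^sub>\<xi>"
    and algorithm: "\<And>n \<omega>. \<omega> \<in> space M \<Longrightarrow>
      X (Suc n) \<omega> = X n \<omega> + a n *\<^sub>R b n (X n \<omega>) (\<xi> n \<omega>) + a n *\<^sub>R h (X n \<omega>) (\<zeta> n \<omega>)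
        + a n *\<^sub>R h\<^sub>0 (\<eta> n \<omega>) + a n *\<^sub>R \<beta> n \<omega>"
    and X_bounded: "AE \<omega> in M. bounded (range (\<lambda>n. X n \<omega>))"
    and A_i: "continuous_uniformly_on_bounded h (space N\<^sub>\<zeta>)"
    and A_ii: "(case_prod h \<in> borel_measurable (borel \<Otimes>\<^sub>M N\<^sub>\<zeta>) \<and>
                 (\<exists>C. \<forall>x. \<forall>z\<in>space N\<^sub>\<zeta>. norm (h x z) \<le> C)) \<or>
               growth_condition M a N\<^sub>\<zeta> \<zeta> h"
    and A_iii_cont: "continuous_on UNIV hbar"
    and A_iii: "\<exists>T>0. \<forall>\<epsilon>>0. \<forall>x.
      (\<lambda>n. \<P>(\<omega> in M. window_sup a T n
          (\<lambda>I. norm (\<Sum>i\<in>I. a i *\<^sub>R (h x (\<zeta> i \<omega>) - hbar x))) \<ge> ereal \<epsilon>)) \<longlonglongrightarrow> 0"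
    and A_iv_indep: "mutually_independent_noises M N\<^sub>\<xi> \<xi> N\<^sub>\<zeta> \<zeta> N\<^sub>\<eta> \<eta>"
    and A_iv_exogenous: "exogenous M N\<^sub>\<xi> \<xi> X" "exogenous M N\<^sub>\<zeta> \<zeta> X" "exogenous M N\<^sub>\<eta> \<eta> X"
    and A_iv_meas: "h\<^sub>0 \<in> borel_measurable N\<^sub>\<eta>"
    and A_iv: "\<exists>T>0. \<forall>\<epsilon>>0.
      (\<lambda>n. \<P>(\<omega> in M. window_sup a T n
          (\<lambda>I. norm (\<Sum>i\<in>I. a i *\<^sub>R h\<^sub>0 (\<eta> i \<omega>))) \<ge> ereal \<epsilon>)) \<longlonglongrightarrow> 0"
    and A_v_rv: "\<And>n. \<beta> n \<in> borel_measurable M"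
    and A_v_bounded: "\<And>n. \<exists>C. AE \<omega> in M. norm (\<beta> n \<omega>) \<le> C"
    and A_v_lim: "AE \<omega> in M. (\<lambda>n. norm (\<beta> n \<omega>)) \<longlonglongrightarrow> 0"
    and K_bbar: "locally_bounded bbar"
    and K_pos: "\<And>n x z. z \<in> space N\<^sub>\<xi> \<Longrightarrow> m n x z > 0"
    and K_cont: "continuous_uniformly_seq m (space N\<^sub>\<xi>)"
    and K_incl: "\<And>n x z. z \<in> space N\<^sub>\<xi> \<Longrightarrow>
      \<exists>u\<in>krasovskii bbar x. \<exists>v\<in>cball 0 1. b n x z = u + m n x z *\<^sub>R v"
    and K_avg: "\<exists>T>0. \<forall>\<epsilon>>0. \<forall>x.
      (\<lambda>n. \<P>(\<omega> in M. window_sup a T n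
          (\<lambda>I. \<bar>\<Sum>i\<in>I. a i * m i x (\<xi> i \<omega>)\<bar>) \<ge> ereal \<epsilon>)) \<longlonglongrightarrow> 0"
  defines "F \<equiv> krasovskii (\<lambda>x. bbar x + hbar x)"
  shows
    "(\<exists>\<Omega>\<^sub>0 \<in> null_sets M. \<forall>\<omega> \<in> space M - \<Omega>\<^sub>0.
        ((\<exists>C. \<forall>n t. norm (shifted a (\<lambda>k. X k \<omega>) n t) \<le> C) \<and>
         (\<forall>r. equicontinuous_on {-r..r} (shifted a (\<lambda>k. X k \<omega>)))) \<and>
        (\<forall>r x. strict_mono r \<longrightarrow>
           converges_locally_uniformly (\<lambda>k. shifted a (\<lambda>k. X k \<omega>) (r k)) x \<longrightarrow>
           solution_on F UNIV x \<and> internally_chain_transitive F (limit_set x)) \<and>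
        (\<forall>r \<theta>. strict_mono r \<longrightarrow> (\<lambda>k. X (r k) \<omega>) \<longlonglongrightarrow> \<theta> \<longrightarrow>
           \<theta> \<in> chain_recurrent_points F)) \<and>
     (\<forall>\<Lambda> C. locally_asymptotically_stable F \<Lambda> \<longrightarrow>
        compact C \<longrightarrow> C \<subseteq> domain_of_attraction F \<Lambda> \<longrightarrow>
        ((AE \<omega> in M. \<exists>\<^sub>\<infinity>n. X n \<omega> \<in> C) \<longrightarrow>
           (AE \<omega> in M. converges_to_set (\<lambda>n. X n \<omega>) \<Lambda> sequentially)) \<and>
        (\<forall>\<rho>. \<P>(\<omega> in M. \<exists>\<^sub>\<infinity>n. X n \<omega> \<in> C) \<ge> \<rho> \<longrightarrow>
           \<P>(\<omega> in M. converges_to_set (\<lambda>n. X n \<omega>) \<Lambda> sequentially) \<ge> \<rho>))"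
proof -
  interpret prob_space M by (rule prob)
  interpret step_sizes a using a_pos a_lim a_sum by unfold_locales
  let ?f = "\<lambda>x. bbar x + hbar x"
  let ?g = "\<lambda>x z. h x z - hbar x"
  have f: "locally_bounded ?f" by (rule locally_bounded_add_continuous[OF K_bbar A_iii_cont])
  have g: "continuous_uniformly_on_bounded ?g (space N\<^sub>\<zeta>)"
    by (rule continuous_uniformly_on_bounded_diff[OF A_i A_iii_cont])
  have \<xi>_sp: "\<xi> n \<omega> \<in> space N\<^sub>\<xi>" and \<zeta>_sp: "\<zeta> n \<omega> \<in> space N\<^sub>\<zeta>" if "\<omega> \<in> space M" for n \<omega>
    using measurable_space[OF \<xi>_rv that] measurable_space[OF \<zeta>_rv that] .
  have avg_h: "AE \<omega> in M. \<forall>x. negligible_noise (\<lambda>i. ?g x (\<zeta> i \<omega>))"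
  proof (rule AE_all_negligible_noise)
    fix x
    obtain T where T: "T > 0" and lim: "\<And>\<epsilon>. \<epsilon> > 0 \<Longrightarrow> (\<lambda>n. \<P>(\<omega> in M. window_sup a T n
          (\<lambda>I. norm (\<Sum>i\<in>I. a i *\<^sub>R (h x (\<zeta> i \<omega>) - hbar x))) \<ge> ereal \<epsilon>)) \<longlonglongrightarrow> 0"
      using A_iii by blast
    have "(\<lambda>\<omega>. ?g x (\<zeta> i \<omega>)) \<in> borel_measurable M" for i
      using measurable_compose[OF \<zeta>_rv h_meas] by (intro borel_measurable_diff) auto
    then show "AE \<omega> in M. negligible_noise (\<lambda>i. ?g x (\<zeta> i \<omega>))"
      by (rule AE_negligible_noise[OF prob T _ lim])
  next
    fix x and e :: real assume "e > 0"
    from continuous_uniformly_on_boundedD[OF g this]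
    show "\<exists>d>0. \<forall>y. dist y x < d \<longrightarrow> (\<forall>i. \<forall>\<omega>\<in>space M. dist (?g y (\<zeta> i \<omega>)) (?g x (\<zeta> i \<omega>)) < e)"
      using \<zeta>_sp by meson
  qed
  have avg_m: "AE \<omega> in M. \<forall>x. negligible_noise (\<lambda>i. m i x (\<xi> i \<omega>))"
  proof (rule AE_all_negligible_noise)
    fix x
    obtain T where T: "T > 0" and lim: "\<And>\<epsilon>. \<epsilon> > 0 \<Longrightarrow> (\<lambda>n. \<P>(\<omega> in M. window_sup a T n
          (\<lambda>I. \<bar>\<Sum>i\<in>I. a i * m i x (\<xi> i \<omega>)\<bar>) \<ge> ereal \<epsilon>)) \<longlonglongrightarrow> 0"
      using K_avg by blast
    show "AE \<omega> in M. negligible_noise (\<lambda>i. m i x (\<xi> i \<omega>))"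
      by (rule AE_negligible_noise[OF prob T measurable_compose[OF \<xi>_rv m_meas]]) (use lim in simp)
  next
    fix x and e :: real assume "e > 0"
    then obtain d where "d > 0" "\<And>y n z. dist y x < d \<Longrightarrow> z \<in> space N\<^sub>\<xi> \<Longrightarrow> dist (m n y z) (m n x z) < e"
      using K_cont unfolding continuous_uniformly_seq_def by meson
    then show "\<exists>d>0. \<forall>y. dist y x < d \<longrightarrow> (\<forall>i. \<forall>\<omega>\<in>space M. dist (m i y (\<xi> i \<omega>)) (m i x (\<xi> i \<omega>)) < e)"
      using \<xi>_sp by meson
  qed
  have avg_0: "AE \<omega> in M. negligible_noise (\<lambda>i. h\<^sub>0 (\<eta> i \<omega>))"
  proof -
    obtain T where T: "T > 0" and lim: "\<And>\<epsilon>. \<epsilon> > 0 \<Longrightarrow> (\<lambda>n. \<P>(\<omega> in M. window_sup a T n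
          (\<lambda>I. norm (\<Sum>i\<in>I. a i *\<^sub>R h\<^sub>0 (\<eta> i \<omega>))) \<ge> ereal \<epsilon>)) \<longlonglongrightarrow> 0"
      using A_iv by blast
    show ?thesis by (rule AE_negligible_noise[OF prob T measurable_compose[OF \<eta>_rv A_iv_meas] lim])
  qed
  have good: "AE \<omega> in M. asymptotic_solution ?f (interpolated (\<lambda>k. X k \<omega>))"
    using avg_h avg_m avg_0 A_v_lim X_bounded AE_space
  proof eventually_elim
    case (elim \<omega>)
    have "\<forall>i. \<exists>u v. u \<in> krasovskii bbar (X i \<omega>) \<and> norm v \<le> 1 \<and>
        b i (X i \<omega>) (\<xi> i \<omega>) = u + m i (X i \<omega>) (\<xi> i \<omega>) *\<^sub>R v"
    proof
      fix i
      from K_incl[where n=i and x="X i \<omega>", OF \<xi>_sp[OF elim(6), of i]]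
      show "\<exists>u v. u \<in> krasovskii bbar (X i \<omega>) \<and> norm v \<le> 1 \<and>
        b i (X i \<omega>) (\<xi> i \<omega>) = u + m i (X i \<omega>) (\<xi> i \<omega>) *\<^sub>R v"
        unfolding Bex_def mem_cball_0 by blast
    qed
    then obtain u v where u: "\<And>i. u i \<in> krasovskii bbar (X i \<omega>)" and v: "\<And>i. norm (v i) \<le> 1"
      and b: "\<And>i. b i (X i \<omega>) (\<xi> i \<omega>) = u i + m i (X i \<omega>) (\<xi> i \<omega>) *\<^sub>R v i"
      by metis
    have mv: "negligible_noise (\<lambda>i. m i (X i \<omega>) (\<xi> i \<omega>) *\<^sub>R v i)"
    proof (rule negligible_noise_along_bounded_sequence[of "\<lambda>i y. m i y (\<xi> i \<omega>)" "\<lambda>i. X i \<omega>"])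
      fix y and e :: real assume "e > 0"
      then obtain d where "d > 0" "\<And>z n s. dist z y < d \<Longrightarrow> s \<in> space N\<^sub>\<xi> \<Longrightarrow> dist (m n z s) (m n y s) < e"
        using K_cont unfolding continuous_uniformly_seq_def by meson
      then show "\<exists>d>0. \<forall>z. dist z y < d \<longrightarrow> (\<forall>i. dist (m i z (\<xi> i \<omega>)) (m i y (\<xi> i \<omega>)) < e)"
        using \<xi>_sp[OF elim(6)] by meson
    next
      show pos: "m i y (\<xi> i \<omega>) \<ge> 0" for i y using K_pos[OF \<xi>_sp[OF elim(6)]] less_imp_le by blast
      show "norm (m i (X i \<omega>) (\<xi> i \<omega>) *\<^sub>R v i) \<le> m i (X i \<omega>) (\<xi> i \<omega>)" for i
        using mult_left_mono[OF v[of i] pos[of i "X i \<omega>"]] pos[of i "X i \<omega>"] by simp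
    qed (use elim in auto)
    show ?case
    proof (rule scheme_asymptotic_solution[OF K_bbar A_iii_cont elim(5) _ u])
      show "X (Suc i) \<omega> = X i \<omega> + a i *\<^sub>R (u i + hbar (X i \<omega>) + ?g (X i \<omega>) (\<zeta> i \<omega>) +
          (m i (X i \<omega>) (\<xi> i \<omega>) *\<^sub>R v i + h\<^sub>0 (\<eta> i \<omega>) + \<beta> i \<omega>))" for i
        unfolding algorithm[OF elim(6)] b by (simp add: algebra_simps)
      show "continuous_uniformly_on_bounded (\<lambda>x i. ?g x (\<zeta> i \<omega>)) UNIV"
        using g \<zeta>_sp[OF elim(6)] unfolding continuous_uniformly_on_bounded_def by meson
      show "negligible_noise (\<lambda>i. ?g y (\<zeta> i \<omega>))" for y using elim(1) by blast
      show "negligible_noise (\<lambda>i. m i (X i \<omega>) (\<xi> i \<omega>) *\<^sub>R v i + h\<^sub>0 (\<eta> i \<omega>) + \<beta> i \<omega>)"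
        by (intro negligible_noise_add mv elim(3) negligible_noise_tendsto_zero elim(4))
    qed
  qed
  from good obtain \<Omega>\<^sub>0 where \<Omega>\<^sub>0: "\<Omega>\<^sub>0 \<in> null_sets M"
    "{\<omega>\<in>space M. \<not> asymptotic_solution ?f (interpolated (\<lambda>k. X k \<omega>))} \<subseteq> \<Omega>\<^sub>0"
    unfolding eventually_ae_filter by blast
  show ?thesis
    unfolding F_def
  proof (intro conjI bexI[OF _ \<Omega>\<^sub>0(1)] ballI allI impI)
    fix \<omega> assume "\<omega> \<in> space M - \<Omega>\<^sub>0"
    then have Z: "asymptotic_solution ?f (interpolated (\<lambda>k. X k \<omega>))" using \<Omega>\<^sub>0(2) by blast
    show "\<exists>C. \<forall>n t. norm (shifted a (\<lambda>k. X k \<omega>) n t) \<le> C"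
      by (rule asymptotic_solution_shifted_bounded[OF Z])
    show "equicontinuous_on {-r..r} (shifted a (\<lambda>k. X k \<omega>))" for r
      by (rule asymptotic_solution_shifted_equicontinuous[OF Z])
    show "solution_on (krasovskii ?f) UNIV x" "internally_chain_transitive (krasovskii ?f) (limit_set x)"
      if "strict_mono r" "converges_locally_uniformly (\<lambda>k. shifted a (\<lambda>k. X k \<omega>) (r k)) x" for r x
      using limit_of_shifted[OF f Z that] by auto
    show "\<theta> \<in> chain_recurrent_points (krasovskii ?f)" if "strict_mono r" "(\<lambda>k. X (r k) \<omega>) \<longlonglongrightarrow> \<theta>" for r \<theta>
      by (rule limit_point_chain_recurrent[OF f Z that])
  next
    fix \<Lambda> C
    assume las: "locally_asymptotically_stable (krasovskii ?f) \<Lambda>"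
      and C: "compact C" "C \<subseteq> domain_of_attraction (krasovskii ?f) \<Lambda>"
    have conv: "AE \<omega> in M. (\<exists>\<^sub>\<infinity>n. X n \<omega> \<in> C) \<longrightarrow> converges_to_set (\<lambda>n. X n \<omega>) \<Lambda> sequentially"
      using good by eventually_elim (use recurrent_visits_converge[OF f _ las C] in blast)
    show "AE \<omega> in M. converges_to_set (\<lambda>n. X n \<omega>) \<Lambda> sequentially" if "AE \<omega> in M. \<exists>\<^sub>\<infinity>n. X n \<omega> \<in> C"
      using conv that by eventually_elim blast
    show "\<P>(\<omega> in M. converges_to_set (\<lambda>n. X n \<omega>) \<Lambda> sequentially) \<ge> \<rho>"
      if "\<P>(\<omega> in M. \<exists>\<^sub>\<infinity>n. X n \<omega> \<in> C) \<ge> \<rho>" for \<rho>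
    proof -
      have "\<P>(\<omega> in M. \<exists>\<^sub>\<infinity>n. X n \<omega> \<in> C) \<le> \<P>(\<omega> in M. converges_to_set (\<lambda>n. X n \<omega>) \<Lambda> sequentially)"
        using conv by (intro finite_measure_mono_AE converges_to_set_measurable X_rv) auto
      then show ?thesis using that by linarith
    qed
  qed
qed

end
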